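(* Let $s_p$, $\boldsymbol{k}:=\boldsymbol{k}^{s_p}$ and $\mathrm{KS}^{1,p}(K,\widehat R_p,m)$ be defined with respect to the metric measure space $(K,\widehat R_p,m)$. Then $s_p=(d_{\mathrm f,p}+p-1)/p$, $\mathcal{F}_p=\mathrm{KS}^{1,p}(K,\widehat R_p,m)$, and $(\mathrm{WM})_{p,\boldsymbol{k}}$ holds. Moreover, there exists $C\in[1,\infty)$ such that $$C^{-1}\sup_{r>0}J_{p,r}^{\boldsymbol{k}}(f)\le\mathcal{E}_p(f)\le C\liminf_{r\downarrow0}J_{p,r}^{\boldsymbol{k}}(f)\quad\text{for any }f\in L^p(K,m),$$ where $\mathcal{E}_p(f):=\infty$ for $f\in L^p(K,m)\setminus\mathcal{F}_p$.
   Context: Self-similar structure. $K$ is a compact metrizable space, $S$ a finite set with $\#S\ge2$, $F_i\colon K\to K$ ($i\in S$) continuous injections, $K_i=F_i(K)$. $\mathcal{L}=(K,S,\{F_i\}_{i\in S})$ is a self-similar structure if there is a continuous surjection $\chi\colon S^{\mathbb{N}}\to K$ with $F_i\circ\chi=\chi\circ\sigma_i$, $\sigma_i(\omega_1\omega_2\dots)=i\omega_1\omega_2\dots$. It is post-critically finite (p.-c.f.) if $\mathcal{P}=\bigcup_{n\ge1}\sigma^n(\mathcal{C})$ is finite, where $\mathcal{C}=\chi^{-1}(\bigcup_{i\ne j}K_i\cap K_j)$ and $\sigma$ is the left shift. A self-similar measure with weight $(\theta_i)_{i\in S}$ ($\theta_i\in(0,1)$, $\sum\theta_i=1$) is a Borel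 probability measure $m$ with $m=\sum_i\theta_i(F_i)_*m$. $p$-resistance form on $K$: a pair $(\mathcal{E},\mathcal{F})$ with $\mathcal{F}\subseteq\mathbb{R}^K$ a linear subspace containing $\mathbb{R}\mathbf{1}_K$, $\mathcal{E}\colon\mathcal{F}\to[0,\infty)$ with $\mathcal{E}^{1/p}$ a seminorm with null space $\mathbb{R}\mathbf{1}_K$; $(\mathcal{F}/\mathbb{R}\mathbf{1}_K,\mathcal{E}^{1/p})$ is a Banach space; $\mathcal{F}$ separates the points of $K$; $R_{\mathcal{E}}(x,y)=\sup\{|u(x)-u(y)|^p/\mathcal{E}(u):u\in\mathcal{F}\setminus\mathbb{R}\mathbf{1}_K\}<\infty$ for all $x,y\in K$; and $(\mathrm{GC})_p$: whenever $n_1,n_2\in\mathbb{N}$, $q_1\in(0,p]$, $q_2\in[p,\infty]$, $T\colon\mathbb{R}^{n_1}\to\mathbb{R}^{n_2}$, $T(0)=0$ and $\|T(x)-T(y)\|_{\ell^{q_2}}\le\|x-y\|_{\ell^{q_1}}$ for all $x,y$, then for all $\boldsymbol{u}\in\mathcal{F}^{n_1}$, $T(\boldsymbol{u})\in\mathcal{F}^{n_2}$ and $\|(\mathcal{E}(T_l(\boldsymbol{u}))^{1/p})_l\|_{\ell^{q_2}}\le\|(\mathcal{E}(u_k)^{1/p})_k\|_{\ell^{q_1}}$ ($\|x\|_{\ell^q}=(\sum|x_k|^q)^{1/q}$ for $q<\infty$, $\|x\|_{\ell^\infty}=\max|x_k|$). Standing assumption. $p\in(1,\infty)$; $\mathcal{L}$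 is a p.-c.f. self-similar structure with $\#S\ge2$ and $K$ connected; $(\mathcal{E}_p,\mathcal{F}_p)$ is a self-similar $p$-resistance form on $\mathcal{L}$ with weight $(\rho_{p,i})_{i\in S}\in(0,\infty)^S$, i.e. a $p$-resistance form on $K$ with $\mathcal{F}_p\subseteq C(K)$, $\mathcal{F}_p=\{u\in C(K):u\circ F_i\in\mathcal{F}_p\ \forall i\in S\}$ and $\mathcal{E}_p(u)=\sum_{i\in S}\rho_{p,i}\mathcal{E}_p(u\circ F_i)$ for $u\in\mathcal{F}_p$; and $\min_{i\in S}\rho_{p,i}>1$. $d_{\mathrm f,p}\in(0,\infty)$ is determined by $\sum_{i\in S}\rho_{p,i}^{-d_{\mathrm f,p}/(p-1)}=1$, and $m$ is the self-similar measure on $\mathcal{L}$ with weight $(\rho_{p,i}^{-d_{\mathrm f,p}/(p-1)})_{i\in S}$. The $p$-resistance metric is $\widehat R_p(x,y)=R_{\mathcal{E}_p}(x,y)^{1/(p-1)}$, known to be a metric giving the original topology of $K$. Korevaar--Schoen space of $(K,\widehat R_p,m)$. With $B(x,r)=\{y:\widehat R_p(x,y)<r\}$ and $s>0$, $\boldsymbol{k}^s=\{k_r^s\}_{r>0}$, $k_r^s(x,y)=\frac{\mathbf{1}_{B(x,r)}(y)}{r^{ps}m(B(x,r))}$. For kernels $\boldsymbol{k}$, $J_{p,r}^{\boldsymbol{k}}(f)=\int_K\int_K|f(x)-f(y)|^pk_r(x,y)\,m(dy)m(dx)$, $B_{p,\infty}^{\boldsymbol{k}}=\{f\in L^p(K,m):\sup_{r>0}J_{p,r}^{\boldsymbol{k}}(f)<\infty\}$.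 $s_p=\sup\{s>0:B_{p,\infty}^{\boldsymbol{k}^s}\text{ contains a non-constant function}\}$, $\mathrm{KS}^{1,p}(K,\widehat R_p,m)=B_{p,\infty}^{\boldsymbol{k}^{s_p}}$. $(\mathrm{WM})_{p,\boldsymbol{k}}$: there is $C\in[1,\infty)$ with $\sup_{r>0}J_{p,r}^{\boldsymbol{k}}(f)\le C\liminf_{r\downarrow0}J_{p,r}^{\boldsymbol{k}}(f)$ for all $f\in B_{p,\infty}^{\boldsymbol{k}}$. Continuous functions are identified with their $m$-equivalence classes. *)

theory Defs
  imports "HOL-Probability.Probability"
begin

section \<open>Self-similar structures\<close>

text \<open>
  The compact metrizable space \<open>K\<close> is the universe of a type of class \<open>metric_space\<close>.  Only the
  topology of that type is used below; its distance \<open>dist\<close> never occurs.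
\<close>

definition shift_space :: "'i set \<Rightarrow> (nat \<Rightarrow> 'i) topology" where
  "shift_space S = product_topology (\<lambda>_. discrete_topology S) UNIV"

definition word_cons :: "'i \<Rightarrow> (nat \<Rightarrow> 'i) \<Rightarrow> nat \<Rightarrow> 'i" where
  "word_cons i \<omega> = (\<lambda>n. case n of 0 \<Rightarrow> i | Suc k \<Rightarrow> \<omega> k)"

definition left_shift :: "(nat \<Rightarrow> 'i) \<Rightarrow> nat \<Rightarrow> 'i" where
  "left_shift \<omega> = (\<lambda>n. \<omega> (Suc n))"

definition coding_map ::
  "'i set \<Rightarrow> ('i \<Rightarrow> 'a \<Rightarrow> 'a::metric_space) \<Rightarrow> ((nat \<Rightarrow> 'i) \<Rightarrow> 'a) \<Rightarrow> bool" where
  "coding_map S F c \<longleftrightarrow>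
     continuous_map (shift_space S) euclidean c \<and>
     c ` topspace (shift_space S) = UNIV \<and>
     (\<forall>i\<in>S. \<forall>\<omega>\<in>topspace (shift_space S). F i (c \<omega>) = c (word_cons i \<omega>))"

definition self_similar_structure ::
  "'i set \<Rightarrow> ('i \<Rightarrow> 'a \<Rightarrow> 'a::metric_space) \<Rightarrow> bool" where
  "self_similar_structure S F \<longleftrightarrow>
     compact (UNIV :: 'a set) \<and> finite S \<and> card S \<ge> 2 \<and>
     (\<forall>i\<in>S. continuous_on UNIV (F i) \<and> inj (F i)) \<and>
     (\<exists>c. coding_map S F c)"

definition critical_set ::
  "'i set \<Rightarrow> ('i \<Rightarrow> 'a \<Rightarrow> 'a::metric_space) \<Rightarrow> ((nat \<Rightarrow> 'i) \<Rightarrow> 'a) \<Rightarrow> (nat \<Rightarrow> 'i) set" where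
  "critical_set S F c =
     {\<omega> \<in> topspace (shift_space S). \<exists>i\<in>S. \<exists>j\<in>S. i \<noteq> j \<and> c \<omega> \<in> range (F i) \<inter> range (F j)}"

definition post_critical_set ::
  "'i set \<Rightarrow> ('i \<Rightarrow> 'a \<Rightarrow> 'a::metric_space) \<Rightarrow> ((nat \<Rightarrow> 'i) \<Rightarrow> 'a) \<Rightarrow> (nat \<Rightarrow> 'i) set" where
  "post_critical_set S F c = (\<Union>n\<in>{1..}. (left_shift ^^ n) ` critical_set S F c)"

text \<open>
  The coding map of a self-similar structure is unique on the shift space, so quantifying it
  existentially here does not introduce a choice.
\<close>

definition pcf_self_similar_structure ::
  "'i set \<Rightarrow> ('i \<Rightarrow> 'a \<Rightarrow> 'a::metric_space) \<Rightarrow> bool" where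
  "pcf_self_similar_structure S F \<longleftrightarrow>
     self_similar_structure S F \<and>
     (\<exists>c. coding_map S F c \<and> finite (post_critical_set S F c))"

definition self_similar_measure ::
  "'i set \<Rightarrow> ('i \<Rightarrow> 'a \<Rightarrow> 'a::metric_space) \<Rightarrow> ('i \<Rightarrow> real) \<Rightarrow> 'a measure \<Rightarrow> bool" where
  "self_similar_measure S F \<theta> m \<longleftrightarrow>
     (\<forall>i\<in>S. 0 < \<theta> i \<and> \<theta> i < 1) \<and> (\<Sum>i\<in>S. \<theta> i) = 1 \<and>
     sets m = sets borel \<and> prob_space m \<and>
     (\<forall>A\<in>sets borel. emeasure m A = (\<Sum>i\<in>S. ennreal (\<theta> i) * emeasure (distr m borel (F i)) A))"


section \<open>\<open>p\<close>-resistance forms\<close>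

definition const_funs :: "('a \<Rightarrow> real) set" where
  "const_funs = range (\<lambda>c _. c)"

definition lq_norm :: "ereal \<Rightarrow> nat \<Rightarrow> (nat \<Rightarrow> real) \<Rightarrow> real" where
  "lq_norm q n x =
     (if q = \<infinity> then Max ((\<lambda>k. \<bar>x k\<bar>) ` {..<n})
      else (\<Sum>k<n. \<bar>x k\<bar> powr real_of_ereal q) powr (1 / real_of_ereal q))"

text \<open>
  A map \<open>\<real>\<^sup>n\<^sup>1 \<rightarrow> \<real>\<^sup>n\<^sup>2\<close> is given by a map \<open>T\<close> on sequences of which only the coordinates below \<open>n1\<close>
  resp. \<open>n2\<close> are looked at.  The contraction hypothesis, being required for all sequences,
  forces the first \<open>n2\<close> coordinates of \<open>T x\<close> to depend on the first \<open>n1\<close> coordinates of \<open>x\<close> only.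
\<close>

definition generalized_contraction ::
  "real \<Rightarrow> (('a \<Rightarrow> real) \<Rightarrow> real) \<Rightarrow> ('a \<Rightarrow> real) set \<Rightarrow> bool" where
  "generalized_contraction p \<E> \<F> \<longleftrightarrow>
     (\<forall>n1 n2 :: nat. \<forall>q1 :: real. \<forall>q2 :: ereal. \<forall>T :: (nat \<Rightarrow> real) \<Rightarrow> nat \<Rightarrow> real.
        1 \<le> n1 \<longrightarrow> 1 \<le> n2 \<longrightarrow> 0 < q1 \<longrightarrow> q1 \<le> p \<longrightarrow> ereal p \<le> q2 \<longrightarrow>
        (\<forall>l<n2. T (\<lambda>_. 0) l = 0) \<longrightarrow>
        (\<forall>x y. lq_norm q2 n2 (\<lambda>l. T x l - T y l) \<le> lq_norm (ereal q1) n1 (\<lambda>k. x k - y k)) \<longrightarrow>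
        (\<forall>u :: nat \<Rightarrow> 'a \<Rightarrow> real. (\<forall>k<n1. u k \<in> \<F>) \<longrightarrow>
           (\<forall>l<n2. (\<lambda>x. T (\<lambda>k. u k x) l) \<in> \<F>) \<and>
           lq_norm q2 n2 (\<lambda>l. \<E> (\<lambda>x. T (\<lambda>k. u k x) l) powr (1 / p))
             \<le> lq_norm (ereal q1) n1 (\<lambda>k. \<E> (u k) powr (1 / p))))"

text \<open>The supremum is taken in \<open>[0, \<infinity>]\<close>.\<close>

definition resistance ::
  "real \<Rightarrow> (('a \<Rightarrow> real) \<Rightarrow> real) \<Rightarrow> ('a \<Rightarrow> real) set \<Rightarrow> 'a \<Rightarrow> 'a \<Rightarrow> ennreal" where
  "resistance p \<E> \<F> x y = (SUP u\<in>\<F> - const_funs. ennreal (\<bar>u x - u y\<bar> powr p / \<E> u))"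

text \<open>
  Completeness of the quotient of \<open>\<F>\<close> by the constants is expressed through representatives of
  Cauchy sequences.
\<close>

definition p_resistance_form ::
  "real \<Rightarrow> (('a \<Rightarrow> real) \<Rightarrow> real) \<Rightarrow> ('a \<Rightarrow> real) set \<Rightarrow> bool" where
  "p_resistance_form p \<E> \<F> \<longleftrightarrow>
     const_funs \<subseteq> \<F> \<and>
     (\<forall>u\<in>\<F>. \<forall>v\<in>\<F>. (\<lambda>x. u x + v x) \<in> \<F>) \<and>
     (\<forall>a. \<forall>u\<in>\<F>. (\<lambda>x. a * u x) \<in> \<F>) \<and>
     (\<forall>u\<in>\<F>. 0 \<le> \<E> u) \<and>
     (\<forall>a. \<forall>u\<in>\<F>. \<E> (\<lambda>x. a * u x) powr (1 / p) = \<bar>a\<bar> * \<E> u powr (1 / p)) \<and>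
     (\<forall>u\<in>\<F>. \<forall>v\<in>\<F>. \<E> (\<lambda>x. u x + v x) powr (1 / p) \<le> \<E> u powr (1 / p) + \<E> v powr (1 / p)) \<and>
     {u \<in> \<F>. \<E> u = 0} = const_funs \<and>
     (\<forall>u :: nat \<Rightarrow> 'a \<Rightarrow> real.
        (\<forall>n. u n \<in> \<F>) \<longrightarrow>
        (\<forall>e>0. \<exists>N. \<forall>j\<ge>N. \<forall>k\<ge>N. \<E> (\<lambda>x. u j x - u k x) powr (1 / p) < e) \<longrightarrow>
        (\<exists>v\<in>\<F>. (\<lambda>n. \<E> (\<lambda>x. u n x - v x) powr (1 / p)) \<longlonglongrightarrow> 0)) \<and>
     (\<forall>x y. x \<noteq> y \<longrightarrow> (\<exists>u\<in>\<F>. u x \<noteq> u y)) \<and>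
     (\<forall>x y. resistance p \<E> \<F> x y < \<infinity>) \<and>
     generalized_contraction p \<E> \<F>"

definition self_similar_p_resistance_form ::
  "real \<Rightarrow> 'i set \<Rightarrow> ('i \<Rightarrow> 'a \<Rightarrow> 'a::metric_space) \<Rightarrow> ('i \<Rightarrow> real)
    \<Rightarrow> (('a \<Rightarrow> real) \<Rightarrow> real) \<Rightarrow> ('a \<Rightarrow> real) set \<Rightarrow> bool" where
  "self_similar_p_resistance_form p S F \<rho> \<E> \<F> \<longleftrightarrow>
     p_resistance_form p \<E> \<F> \<and>
     (\<forall>i\<in>S. 0 < \<rho> i) \<and>
     (\<forall>u\<in>\<F>. continuous_on UNIV u) \<and>
     \<F> = {u. continuous_on UNIV u \<and> (\<forall>i\<in>S. u \<circ> F i \<in> \<F>)} \<and>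
     (\<forall>u\<in>\<F>. \<E> u = (\<Sum>i\<in>S. \<rho> i * \<E> (u \<circ> F i)))"

definition p_resistance_metric ::
  "real \<Rightarrow> (('a \<Rightarrow> real) \<Rightarrow> real) \<Rightarrow> ('a \<Rightarrow> real) set \<Rightarrow> 'a \<Rightarrow> 'a \<Rightarrow> real" where
  "p_resistance_metric p \<E> \<F> x y = enn2real (resistance p \<E> \<F> x y) powr (1 / (p - 1))"


section \<open>Korevaar--Schoen spaces\<close>

text \<open>
  Elements of \<open>L\<^sup>p\<close> are represented by functions; all sets of functions defined in this section
  are closed under equality almost everywhere among measurable functions.
\<close>

definition Lp_funs :: "real \<Rightarrow> 'a measure \<Rightarrow> ('a \<Rightarrow> real) set" where
  "Lp_funs p m = {f \<in> borel_measurable m. integrable m (\<lambda>x. \<bar>f x\<bar> powr p)}"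

definition J_functional ::
  "real \<Rightarrow> 'a measure \<Rightarrow> (real \<Rightarrow> 'a \<Rightarrow> 'a \<Rightarrow> real) \<Rightarrow> real \<Rightarrow> ('a \<Rightarrow> real) \<Rightarrow> ennreal" where
  "J_functional p m k r f =
     (\<integral>\<^sup>+x. (\<integral>\<^sup>+y. ennreal (\<bar>f x - f y\<bar> powr p * k r x y) \<partial>m) \<partial>m)"

definition J_sup ::
  "real \<Rightarrow> 'a measure \<Rightarrow> (real \<Rightarrow> 'a \<Rightarrow> 'a \<Rightarrow> real) \<Rightarrow> ('a \<Rightarrow> real) \<Rightarrow> ennreal" where
  "J_sup p m k f = (SUP r\<in>{0<..}. J_functional p m k r f)"

definition J_liminf ::
  "real \<Rightarrow> 'a measure \<Rightarrow> (real \<Rightarrow> 'a \<Rightarrow> 'a \<Rightarrow> real) \<Rightarrow> ('a \<Rightarrow> real) \<Rightarrow> ennreal" where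
  "J_liminf p m k f = Liminf (at_right 0) (\<lambda>r. J_functional p m k r f)"

definition besov_space ::
  "real \<Rightarrow> 'a measure \<Rightarrow> (real \<Rightarrow> 'a \<Rightarrow> 'a \<Rightarrow> real) \<Rightarrow> ('a \<Rightarrow> real) set" where
  "besov_space p m k = {f \<in> Lp_funs p m. J_sup p m k f < \<infinity>}"

definition weak_monotonicity ::
  "real \<Rightarrow> 'a measure \<Rightarrow> (real \<Rightarrow> 'a \<Rightarrow> 'a \<Rightarrow> real) \<Rightarrow> bool" where
  "weak_monotonicity p m k \<longleftrightarrow>
     (\<exists>C::real. C \<ge> 1 \<and> (\<forall>f\<in>besov_space p m k. J_sup p m k f \<le> ennreal C * J_liminf p m k f))"

definition ks_kernel ::
  "real \<Rightarrow> ('a \<Rightarrow> 'a \<Rightarrow> real) \<Rightarrow> 'a measure \<Rightarrow> real \<Rightarrow> real \<Rightarrow> 'a \<Rightarrow> 'a \<Rightarrow> real" where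
  "ks_kernel p d m s r x y =
     indicator {z. d x z < r} y / (r powr (p * s) * measure m {z. d x z < r})"

text \<open>The supremum is taken in \<open>[-\<infinity>, \<infinity>]\<close>; functions are non-constant as elements of \<open>L\<^sup>p\<close>.\<close>

definition ks_exponent ::
  "real \<Rightarrow> ('a \<Rightarrow> 'a \<Rightarrow> real) \<Rightarrow> 'a measure \<Rightarrow> ereal" where
  "ks_exponent p d m =
     Sup (ereal ` {s. 0 < s \<and>
       (\<exists>f\<in>besov_space p m (ks_kernel p d m s). \<not> (\<exists>c. AE x in m. f x = c))})"

definition ks_critical_kernel ::
  "real \<Rightarrow> ('a \<Rightarrow> 'a \<Rightarrow> real) \<Rightarrow> 'a measure \<Rightarrow> real \<Rightarrow> 'a \<Rightarrow> 'a \<Rightarrow> real" where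
  "ks_critical_kernel p d m = ks_kernel p d m (real_of_ereal (ks_exponent p d m))"

definition ks_space ::
  "real \<Rightarrow> ('a \<Rightarrow> 'a \<Rightarrow> real) \<Rightarrow> 'a measure \<Rightarrow> ('a \<Rightarrow> real) set" where
  "ks_space p d m = besov_space p m (ks_critical_kernel p d m)"

text \<open>All measurable representatives of the almost-everywhere classes of the elements of \<open>\<F>\<close>.\<close>

definition ae_representatives :: "'a measure \<Rightarrow> ('a \<Rightarrow> real) set \<Rightarrow> ('a \<Rightarrow> real) set" where
  "ae_representatives m \<F> = {f \<in> borel_measurable m. \<exists>u\<in>\<F>. AE x in m. f x = u x}"

text \<open>
  The definite description is meant for \<open>\<F>\<close> consisting of continuous functions and \<open>m\<close> of full
  support, where an element of \<open>\<F>\<close> is determined by its almost-everywhere class.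
\<close>

definition extended_energy ::
  "'a measure \<Rightarrow> (('a \<Rightarrow> real) \<Rightarrow> real) \<Rightarrow> ('a \<Rightarrow> real) set \<Rightarrow> ('a \<Rightarrow> real) \<Rightarrow> ennreal" where
  "extended_energy m \<E> \<F> f =
     (if f \<in> ae_representatives m \<F>
      then ennreal (\<E> (THE u. u \<in> \<F> \<and> (AE x in m. f x = u x)))
      else \<infinity>)"

end

theory Submission
  imports Defs
begin

text \<open>
  The proof compares balls with cells.  Subdividing words until the product of the \<open>\<rho>\<^sub>i\<close> reaches \<open>\<tau>\<close> covers the
  space by cells of weight about \<open>\<tau>\<close> which, for the \<open>p\<close>-resistance \<open>Res\<close> (the \<open>p - 1\<close>-st power of the resistance metric), behave like
  balls of radius \<open>1 / \<tau>\<close>: points of two cells that meet have resistance at most a constant times \<open>1 / \<tau>\<close>,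
  because the energy on a cell is scaled by its weight (\<open>Res_neighbours_le\<close>), and points of two cells that do
  not meet have resistance at least a constant times \<open>1 / \<tau>\<close>, because post-critical finiteness allows a
  function of energy \<open>O(\<tau>)\<close> that is \<open>1\<close> on the first and \<open>0\<close> on the second
  (\<open>Res_separated_cells\<close>).  Finite ramification also bounds the number of cells meeting a given one
  (\<open>card_neighbours\<close>).  With \<open>\<alpha> = df / (p - 1)\<close> this gives the Ahlfors regularity
  \<open>m (B) \<asymp> \<tau>\<^bsup>-\<alpha>\<^esup>\<close>, and at the exponent \<open>(df + p - 1) / p\<close> the kernel becomes \<open>\<tau>\<^bsup>2\<alpha>+1\<^esup>\<close> on the pairs of
  points at resistance less than \<open>1 / \<tau>\<close>, up to constants.  Only balls occur in the statement, and balls of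
  the metric are sublevel sets of \<open>Res\<close>, so the argument works with \<open>Res\<close> throughout.

  The energy dominates \<open>J\<close> (\<open>J_scale_le_energy\<close>): two points at resistance less than \<open>1 / \<tau>\<close> lie in adjacent
  cells, where \<open>\<bar>f x - f y\<bar>\<^bsup>p\<^esup>\<close> is at most a constant times the sum of the energies of \<open>f\<close> on the two rescaled
  cells, and these energies, multiplied by the weights, add up to the energy of \<open>f\<close>.

  \<open>J\<close> dominates the energy: for \<open>f\<close> in \<open>L\<^sup>p\<close>, interpolate the averages of \<open>f\<close> over the cells of weight about
  \<open>\<tau>\<close> piecewise by an element of the form.  Its energy is at most a constant times \<open>J\<close>, and its
  \<open>L\<^sup>p\<close>-distance to \<open>f\<close> is \<open>O((J / \<tau>)\<^bsup>1/p\<^esup>)\<close> (\<open>cell_average_approximation\<close>).  Along scales realising the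
  lower limit of \<open>J\<close> the interpolants have bounded energy and converge to \<open>f\<close>, so \<open>f\<close> belongs to the form
  and satisfies the estimate by lower semicontinuity of the energy (\<open>energy_lower_semicontinuous\<close>).  The
  latter rests on uniform convexity, which follows by applying the generalized contraction property to
  \<open>(a, b) \<mapsto> (a + b, a - b)\<close> with a pair of exponents \<open>2n / (2n - 1) \<le> p \<le> 2n\<close>; for an even exponent the
  scalar Clarkson inequality has a termwise proof (\<open>clarkson_even\<close>).

  The two estimates identify the Besov space of the critical kernel with the form and give weak
  monotonicity.  For a larger exponent, boundedness of \<open>J\<close> makes the critical \<open>J\<close> tend to zero,
  so that only constants remain; hence the critical exponent.
\<close>

section \<open>A Clarkson inequality with even exponents\<close>

lemma weighted_mean_monomial:
  fixes x y :: real
  assumes "1 \<le> i" "i < 2 * n" "0 \<le> x" "0 \<le> y"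
  defines "q \<equiv> 2 * real n / (2 * real n - 1)"
  shows "x ^ i * y ^ (2 * n - i)
    \<le> (1 - i / (2 * n)) * ((x powr q) ^ i * (y powr q) ^ (2 * n - 1 - i))
      + i / (2 * n) * ((x powr q) ^ (i - 1) * (y powr q) ^ (2 * n - i))"
    (is "_ \<le> (1 - ?l) * ?U + ?l * ?V")
proof (cases "x = 0 \<or> y = 0")
  case True
  have l: "0 \<le> ?l" "?l \<le> 1" using assms by auto
  have z: "x ^ i * y ^ (2 * n - i) = 0"
    using True assms by auto
  show ?thesis unfolding z using l by (intro add_nonneg_nonneg mult_nonneg_nonneg zero_le_power) auto
next
  case False
  hence xy: "0 < x" "0 < y" using assms by auto
  have n: "real n \<ge> 1" using assms by auto
  have l: "0 \<le> ?l" "?l \<le> 1" using assms by auto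
  have UV: "0 < ?U" "0 < ?V" using xy by auto
  have U: "?U = x powr (q * i) * y powr (q * (2 * real n - 1 - i))"
    using xy assms(1,2) by (simp add: powr_realpow[symmetric] powr_powr of_nat_diff algebra_simps)
  have V: "?V = x powr (q * (real i - 1)) * y powr (q * (2 * real n - i))"
    using xy assms(1,2) by (simp add: powr_realpow[symmetric] powr_powr of_nat_diff algebra_simps)
  have qn: "q * (2 * real n - 1) = 2 * real n"
    using n by (simp add: q_def)
  have ex: "q * i * (1 - ?l) + q * (real i - 1) * ?l = i"
  proof -
    have "q * i * (1 - ?l) + q * (real i - 1) * ?l = q * (2 * real n - 1) * (i / (2 * real n))"
      using n by (simp add: field_simps)
    then show ?thesis using qn n by simp
  qed
  have ey: "q * (2 * real n - 1 - i) * (1 - ?l) + q * (2 * real n - i) * ?l = 2 * real n - i"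
  proof -
    have "q * (2 * real n - 1 - i) * (1 - ?l) + q * (2 * real n - i) * ?l
        = q * (2 * real n - 1) * ((2 * real n - i) / (2 * real n))"
      using n by (simp add: field_simps)
    then show ?thesis using qn n by simp
  qed
  have "?U powr (1 - ?l) * ?V powr ?l
      = x powr (q * i * (1 - ?l) + q * (real i - 1) * ?l)
        * y powr (q * (2 * real n - 1 - i) * (1 - ?l) + q * (2 * real n - i) * ?l)"
    unfolding U V powr_add by (simp add: powr_mult powr_powr)
  also have "\<dots> = x powr i * y powr (2 * real n - i)"
    unfolding ex ey ..
  also have "\<dots> = x ^ i * y ^ (2 * n - i)"
    using xy assms(1,2) by (simp add: powr_realpow[symmetric] of_nat_diff)
  finally have eq: "x ^ i * y ^ (2 * n - i) = ?U powr (1 - ?l) * ?V powr ?l" by simp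
  show ?thesis
    unfolding eq using Youngs_inequality_0[of "1 - ?l" ?l ?U ?V] l UV by auto
qed

lemma conjugate_power:
  fixes Z :: real
  assumes n: "1 \<le> n" and "0 \<le> Z"
  shows "(Z powr (2 * real n / (2 * real n - 1))) ^ (2 * n - 1) = Z ^ (2 * n)"
proof (cases "Z = 0")
  case True
  then show ?thesis using n by (cases n) auto
next
  case False
  have "(Z powr (2 * real n / (2 * real n - 1))) ^ (2 * n - 1)
      = Z powr (real (2 * n - 1) * (2 * real n / (2 * real n - 1)))"
    by (subst powr_power) (use False in \<open>auto simp: mult.commute\<close>)
  also have "real (2 * n - 1) * (2 * real n / (2 * real n - 1)) = real (2 * n)"
    using n by (simp add: of_nat_diff)
  also have "Z powr real (2 * n) = Z ^ (2 * n)"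
    by (rule powr_realpow) (use False assms in auto)
  finally show ?thesis .
qed

lemma sum_even_odd_pairs:
  fixes T :: "nat \<Rightarrow> real"
  shows "(\<Sum>j<2 * n. T j) = (\<Sum>k<n. T (2 * k)) + (\<Sum>k<n. T (2 * k + 1))"
  by (induction n) (auto simp: algebra_simps)

text \<open>
  This is Clarkson's inequality for the exponents \<open>q = 2n / (2n - 1) \<le> 2 \<le> 2n\<close>.  For an even
  exponent it follows termwise: the odd terms of the two binomial expansions cancel, and the weighted
  inequality between the means bounds \<open>(2n choose i) x\<^sup>i y\<^sup>2\<^sup>n\<^sup>-\<^sup>i\<close> by the sum of the terms of index \<open>i\<close> and \<open>i - 1\<close> of
  the expansion of the right-hand side, with exactly the weights
  \<open>(2n choose i) (1 - i / 2n) = (2n - 1 choose i)\<close> and \<open>(2n choose i) (i / 2n) = (2n - 1 choose (i - 1))\<close>.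
\<close>

lemma clarkson_even:
  fixes x y :: real
  assumes n: "1 \<le> n"
  defines "q \<equiv> 2 * real n / (2 * real n - 1)"
  shows "\<bar>x + y\<bar> ^ (2 * n) + \<bar>x - y\<bar> ^ (2 * n) \<le> 2 * (\<bar>x\<bar> powr q + \<bar>y\<bar> powr q) ^ (2 * n - 1)"
proof -
  define X Y where "X = \<bar>x\<bar> powr q" and "Y = \<bar>y\<bar> powr q"
  define T where "T j = real (2 * n - 1 choose j) * X ^ j * Y ^ (2 * n - 1 - j)" for j
  define c where "c i = real (2 * n choose i) * \<bar>x\<bar> ^ i * \<bar>y\<bar> ^ (2 * n - i)" for i
  have pX: "(Z powr q) ^ (2 * n - 1) = Z ^ (2 * n)" if "0 \<le> Z" for Z :: real
    using conjugate_power[OF n that] by (simp only: q_def)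
  define a where "a k = (if k < n then T (2 * k) else 0)" for k
  define b where "b k = (if k = 0 then 0 else T (2 * k - 1))" for k
  have split: "c (2 * k) \<le> a k + b k" if k: "k \<le> n" for k
  proof (cases "k = 0 \<or> k = n")
    case True
    then show ?thesis
    proof
      assume "k = 0"
      then show ?thesis using n pX[of "\<bar>y\<bar>"]
        by (simp add: a_def b_def c_def T_def Y_def)
    next
      assume kn: "k = n"
      have "2 * n - 1 choose (2 * n - 1) = 1" by simp
      then show ?thesis using n pX[of "\<bar>x\<bar>"] kn
        by (simp add: a_def b_def c_def T_def X_def)
    qed
  next
    case False
    with k have k1: "1 \<le> k" "k < n" by auto
    let ?i = "2 * k"
    have A: "real (2 * n choose ?i) * (1 - ?i / (2 * n)) = real (2 * n - 1 choose ?i)"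
    proof -
      have "(2 * n - ?i) * (2 * n choose ?i) = 2 * n * ((2 * n - 1) choose ?i)"
        using binomial_absorb_comp[of "2 * n" ?i] by simp
      hence "real (2 * n - ?i) * real (2 * n choose ?i) = real (2 * n) * real ((2 * n - 1) choose ?i)"
        by (metis of_nat_mult)
      then show ?thesis using k1 n by (simp add: of_nat_diff field_simps)
    qed
    have B: "real (2 * n choose ?i) * (?i / (2 * n)) = real (2 * n - 1 choose (?i - 1))"
    proof -
      have "?i * (2 * n choose ?i) = 2 * n * ((2 * n - 1) choose (?i - 1))"
        using times_binomial_minus1_eq[of ?i "2 * n"] k1 by simp
      hence "real ?i * real (2 * n choose ?i) = real (2 * n) * real ((2 * n - 1) choose (?i - 1))"
        by (metis of_nat_mult)
      then show ?thesis using k1 n by (simp add: field_simps)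
    qed
    have "c ?i = real (2 * n choose ?i) * (\<bar>x\<bar> ^ ?i * \<bar>y\<bar> ^ (2 * n - ?i))"
      by (simp add: c_def)
    also have "\<dots> \<le> real (2 * n choose ?i) *
       ((1 - ?i / (2 * n)) * (X ^ ?i * Y ^ (2 * n - 1 - ?i)) + ?i / (2 * n) * (X ^ (?i - 1) * Y ^ (2 * n - ?i)))"
      unfolding X_def Y_def q_def
      by (intro mult_left_mono order.trans[OF weighted_mean_monomial[of ?i n "\<bar>x\<bar>" "\<bar>y\<bar>"]])
        (use k1 in auto)
    also have "\<dots> = real (2 * n choose ?i) * (1 - ?i / (2 * n)) * (X ^ ?i * Y ^ (2 * n - 1 - ?i))
       + real (2 * n choose ?i) * (?i / (2 * n)) * (X ^ (?i - 1) * Y ^ (2 * n - ?i))"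
      by (simp only: distrib_left mult.assoc)
    also have "\<dots> = a k + b k"
      unfolding A B using k1 by (simp add: a_def b_def T_def)
    finally show ?thesis .
  qed
  have "(x + y) ^ (2 * n) + (x - y) ^ (2 * n) = (\<Sum>i\<le>2 * n. real (2 * n choose i) * x ^ i * (y ^ (2 * n - i) + (- y) ^ (2 * n - i)))"
    unfolding binomial_ring[of x y "2 * n"] diff_conv_add_uminus binomial_ring[of x "- y" "2 * n"]
      sum.distrib[symmetric] distrib_left by (rule refl)
  also have "\<dots> = (\<Sum>i\<in>{..<2 * n} \<union> {2 * n}. real (2 * n choose i) * x ^ i * (y ^ (2 * n - i) + (- y) ^ (2 * n - i)))"
    by (rule sum.cong) auto
  also have "\<dots> = (\<Sum>i\<in>{..<2 * n} \<union> {2 * n}. if even i then 2 * c i else 0)"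
  proof (rule sum.cong[OF refl])
    fix i assume "i \<in> {..<2 * n} \<union> {2 * n}"
    hence i: "i \<le> 2 * n" by auto
    show "real (2 * n choose i) * x ^ i * (y ^ (2 * n - i) + (- y) ^ (2 * n - i)) = (if even i then 2 * c i else 0)"
    proof (cases "even i")
      case True
      hence e: "even (2 * n - i)" using i by auto
      show ?thesis using True e by (simp add: c_def power_even_abs)
    next
      case False
      hence e: "odd (2 * n - i)" using i by auto
      show ?thesis using False e by simp
    qed
  qed
  also have "\<dots> = (\<Sum>k<n. 2 * c (2 * k)) + 2 * c (2 * n)"
    by (subst sum.union_disjoint) (auto simp: sum_even_odd_pairs)
  also have "\<dots> = 2 * (\<Sum>k\<le>n. c (2 * k))"
    by (simp add: lessThan_Suc_atMost[symmetric] sum_distrib_left)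
  also have "\<dots> \<le> 2 * (\<Sum>k\<le>n. a k + b k)"
    by (intro mult_left_mono sum_mono split) auto
  also have "(\<Sum>k\<le>n. a k + b k) = (\<Sum>k<n. T (2 * k)) + (\<Sum>k<n. T (2 * k + 1))"
  proof -
    have "(\<Sum>k\<le>n. a k) = (\<Sum>k<n. T (2 * k))"
      by (simp add: lessThan_Suc_atMost[symmetric] a_def)
    moreover have "(\<Sum>k\<le>n. b k) = (\<Sum>k<n. T (2 * k + 1))"
      by (simp only: lessThan_Suc_atMost[symmetric] sum.lessThan_Suc_shift) (simp add: b_def)
    ultimately show ?thesis by (simp add: sum.distrib)
  qed
  also have "\<dots> = (\<Sum>j<2 * n. T j)" by (simp add: sum_even_odd_pairs)
  also have "\<dots> = (X + Y) ^ (2 * n - 1)"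
  proof -
    have "{..<2 * n} = {..2 * n - 1}" using n by auto
    then show ?thesis by (simp add: binomial_ring T_def)
  qed
  finally show ?thesis unfolding X_def Y_def by (simp add: power_even_abs)
qed


lemma powr_add_le:
  fixes s t p :: real
  assumes "0 \<le> s" "0 \<le> t" "0 < p"
  shows "(s + t) powr p \<le> 2 powr p * (s powr p + t powr p)"
proof -
  have "(s + t) powr p \<le> (2 * max s t) powr p"
    using assms by (intro powr_mono2) auto
  also have "\<dots> = 2 powr p * max s t powr p" using assms by (simp add: powr_mult)
  also have "max s t powr p \<le> s powr p + t powr p" by (auto simp: max_def)
  finally show ?thesis by simp
qed

lemma abs_add_powr_le:
  fixes s t p :: real
  assumes "0 < p"
  shows "\<bar>s + t\<bar> powr p \<le> 2 powr p * (\<bar>s\<bar> powr p + \<bar>t\<bar> powr p)"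
proof -
  have "\<bar>s + t\<bar> powr p \<le> (\<bar>s\<bar> + \<bar>t\<bar>) powr p"
    using assms by (intro powr_mono2) auto
  also have "\<dots> \<le> 2 powr p * (\<bar>s\<bar> powr p + \<bar>t\<bar> powr p)"
    using assms by (intro powr_add_le) auto
  finally show ?thesis .
qed

lemma abs_diff_powr_le:
  fixes s t u p :: real
  assumes "0 < p"
  shows "\<bar>s - u\<bar> powr p \<le> 2 powr p * (\<bar>s - t\<bar> powr p + \<bar>t - u\<bar> powr p)"
  using abs_add_powr_le[OF assms, of "s - t" "t - u"] by simp

lemma powr_sum_le:
  fixes b :: "'b \<Rightarrow> real"
  assumes "finite A" "\<And>q. q \<in> A \<Longrightarrow> 0 \<le> b q" "0 < p"
  shows "(\<Sum>q\<in>A. b q) powr p \<le> real (card A) powr p * (\<Sum>q\<in>A. b q powr p)"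
proof (cases "A = {}")
  case False
  define B where "B = Max (b ` A)"
  have B: "\<And>q. q \<in> A \<Longrightarrow> b q \<le> B" using assms by (auto simp: B_def)
  have "B \<in> b ` A" unfolding B_def using assms False by (intro Max_in) auto
  then obtain q0 where q0: "q0 \<in> A" "B = b q0" by auto
  have "(\<Sum>q\<in>A. b q) powr p \<le> (real (card A) * B) powr p"
    using assms B sum_bounded_above[of A b B] by (intro powr_mono2 sum_nonneg) auto
  also have "\<dots> = real (card A) powr p * B powr p" using q0 assms by (simp add: powr_mult)
  also have "B powr p \<le> (\<Sum>q\<in>A. b q powr p)"
    unfolding q0(2) by (rule member_le_sum) (use q0 assms in auto)
  finally show ?thesis by (simp add: mult_left_mono)
qed auto

lemma ennreal_le_lincomb:
  assumes "z \<le> a * s + b * t" "0 \<le> a" "0 \<le> s" "0 \<le> b" "0 \<le> t"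
  shows "ennreal z \<le> ennreal a * ennreal s + ennreal b * ennreal t"
proof -
  have "ennreal z \<le> ennreal (a * s + b * t)" using assms(1) by (rule ennreal_leI)
  also have "\<dots> = ennreal a * ennreal s + ennreal b * ennreal t"
    using assms by (simp add: ennreal_mult)
  finally show ?thesis .
qed

lemma nn_integral_diff_powr_le:
  fixes f g h :: "'b \<Rightarrow> real"
  assumes "0 < p" and [measurable]: "f \<in> borel_measurable M" "g \<in> borel_measurable M" "h \<in> borel_measurable M"
  shows "(\<integral>\<^sup>+x. ennreal (\<bar>f x - h x\<bar> powr p) \<partial>M) \<le> ennreal (2 powr p) *
    ((\<integral>\<^sup>+x. ennreal (\<bar>f x - g x\<bar> powr p) \<partial>M) + (\<integral>\<^sup>+x. ennreal (\<bar>g x - h x\<bar> powr p) \<partial>M))"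
proof -
  have "(\<integral>\<^sup>+x. ennreal (\<bar>f x - h x\<bar> powr p) \<partial>M)
      \<le> (\<integral>\<^sup>+x. ennreal (2 powr p) * ennreal (\<bar>f x - g x\<bar> powr p)
        + ennreal (2 powr p) * ennreal (\<bar>g x - h x\<bar> powr p) \<partial>M)"
    by (intro nn_integral_mono ennreal_le_lincomb)
      (use abs_diff_powr_le[OF assms(1)] in \<open>auto simp: distrib_left[symmetric]\<close>)
  also have "\<dots> = ennreal (2 powr p) *
      ((\<integral>\<^sup>+x. ennreal (\<bar>f x - g x\<bar> powr p) \<partial>M) + (\<integral>\<^sup>+x. ennreal (\<bar>g x - h x\<bar> powr p) \<partial>M))"
    by (subst nn_integral_add) (auto simp: nn_integral_cmult distrib_left)
  finally show ?thesis .
qed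

lemma convex_abs_powr:
  assumes "1 \<le> p"
  shows "convex_on UNIV (\<lambda>x::real. \<bar>x\<bar> powr p)"
proof (rule convex_onI)
  fix t x y :: real assume t: "0 < t" "t < 1"
  have pos: "((1 - t) * a + t * b) powr p \<le> (1 - t) * a powr p + t * b powr p"
    if ab: "0 \<le> a" "0 \<le> b" for a b :: real
  proof -
    have scale: "(s * c) powr p \<le> s * c powr p" if "0 < s" "s < 1" "0 \<le> c" for s c :: real
    proof -
      have "s powr p \<le> s powr 1" using that assms by (intro powr_mono') auto
      then show ?thesis using that by (simp add: powr_mult mult_right_mono)
    qed
    consider "a = 0" | "b = 0" | "0 < a" "0 < b" using ab by fastforce
    then show ?thesis
    proof cases
      case 1 then show ?thesis using scale[of t b] t ab by simp
    next
      case 2 then show ?thesis using scale[of "1 - t" a] t ab by simp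
    next
      case 3
      then show ?thesis
        using convex_onD[OF powr_convex[OF assms], of t a b] t by simp
    qed
  qed
  have "\<bar>(1 - t) * x + t * y\<bar> \<le> (1 - t) * \<bar>x\<bar> + t * \<bar>y\<bar>"
    using t by (intro order.trans[OF abs_triangle_ineq]) (simp add: abs_mult)
  hence "\<bar>(1 - t) * x + t * y\<bar> powr p \<le> ((1 - t) * \<bar>x\<bar> + t * \<bar>y\<bar>) powr p"
    using assms by (intro powr_mono2) auto
  also have "\<dots> \<le> (1 - t) * \<bar>x\<bar> powr p + t * \<bar>y\<bar> powr p" by (intro pos) auto
  finally show "\<bar>(1 - t) *\<^sub>R x + t *\<^sub>R y\<bar> powr p \<le> (1 - t) * \<bar>x\<bar> powr p + t * \<bar>y\<bar> powr p"
    by simp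
qed auto

section \<open>Resistance forms: contractions, uniform convexity, lower semicontinuity\<close>

locale p_form =
  fixes p :: real and \<E> :: "('a \<Rightarrow> real) \<Rightarrow> real" and \<F> :: "('a \<Rightarrow> real) set"
  assumes p_gt_1: "1 < p" and form: "p_resistance_form p \<E> \<F>"
begin

definition energy_norm :: "('a \<Rightarrow> real) \<Rightarrow> real" where
  "energy_norm u = \<E> u powr (1 / p)"

definition Res :: "'a \<Rightarrow> 'a \<Rightarrow> real" where
  "Res x y = enn2real (resistance p \<E> \<F> x y)"

lemma const_in: "(\<lambda>_. c) \<in> \<F>"
  using form by (auto simp: p_resistance_form_def const_funs_def)

lemma add_in: "u \<in> \<F> \<Longrightarrow> v \<in> \<F> \<Longrightarrow> (\<lambda>x. u x + v x) \<in> \<F>"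
  using form by (auto simp: p_resistance_form_def)

lemma scale_in: "u \<in> \<F> \<Longrightarrow> (\<lambda>x. a * u x) \<in> \<F>"
  using form by (auto simp: p_resistance_form_def)

lemma diff_in: "u \<in> \<F> \<Longrightarrow> v \<in> \<F> \<Longrightarrow> (\<lambda>x. u x - v x) \<in> \<F>"
  using add_in[of u "\<lambda>x. (-1) * v x"] scale_in[of v "-1"] by simp

lemma sum_in: "(\<And>q. q \<in> A \<Longrightarrow> g q \<in> \<F>) \<Longrightarrow> (\<lambda>x. \<Sum>q\<in>A. g q x) \<in> \<F>"
  by (induction A rule: infinite_finite_induct) (auto intro: const_in add_in)

lemma energy_nonneg: "u \<in> \<F> \<Longrightarrow> 0 \<le> \<E> u"
  using form by (auto simp: p_resistance_form_def)

lemma norm_nonneg: "0 \<le> energy_norm u"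
  by (simp add: energy_norm_def)

lemma energy_eq: "u \<in> \<F> \<Longrightarrow> \<E> u = energy_norm u powr p"
  using energy_nonneg[of u] p_gt_1 by (simp add: energy_norm_def powr_powr)

lemma norm_scale: "u \<in> \<F> \<Longrightarrow> energy_norm (\<lambda>x. a * u x) = \<bar>a\<bar> * energy_norm u"
  using form by (auto simp: p_resistance_form_def energy_norm_def)

lemma norm_add: "u \<in> \<F> \<Longrightarrow> v \<in> \<F> \<Longrightarrow> energy_norm (\<lambda>x. u x + v x) \<le> energy_norm u + energy_norm v"
  using form by (auto simp: p_resistance_form_def energy_norm_def)

lemma norm_minus_commute:
  "u \<in> \<F> \<Longrightarrow> v \<in> \<F> \<Longrightarrow> energy_norm (\<lambda>x. u x - v x) = energy_norm (\<lambda>x. v x - u x)"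
  using norm_scale[OF diff_in[of u v], of "-1"] by simp

lemma energy_zero_iff: "u \<in> \<F> \<Longrightarrow> \<E> u = 0 \<longleftrightarrow> (\<exists>c. u = (\<lambda>_. c))"
proof -
  assume "u \<in> \<F>"
  moreover have "{u \<in> \<F>. \<E> u = 0} = const_funs"
    using form by (simp add: p_resistance_form_def)
  ultimately show ?thesis by (auto simp: const_funs_def)
qed

lemma norm_const: "energy_norm (\<lambda>_. c) = 0"
  using energy_zero_iff[OF const_in[of c]] p_gt_1 by (auto simp: energy_norm_def)

lemma norm_sum:
  "(\<And>q. q \<in> A \<Longrightarrow> g q \<in> \<F>) \<Longrightarrow> energy_norm (\<lambda>x. \<Sum>q\<in>A. g q x) \<le> (\<Sum>q\<in>A. energy_norm (g q))"
proof (induction A rule: infinite_finite_induct)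
  case (insert q A)
  have "energy_norm (\<lambda>x. g q x + (\<Sum>q\<in>A. g q x))
      \<le> energy_norm (g q) + energy_norm (\<lambda>x. \<Sum>q\<in>A. g q x)"
    using insert by (intro norm_add sum_in) auto
  then show ?case using insert by force
qed (simp_all add: norm_const)

lemma norm_complete:
  assumes "\<And>n. u n \<in> \<F>"
    and "\<And>e. e > 0 \<Longrightarrow> \<exists>N. \<forall>j\<ge>N. \<forall>k\<ge>N. energy_norm (\<lambda>x. u j x - u k x) < e"
  obtains v where "v \<in> \<F>" "(\<lambda>n. energy_norm (\<lambda>x. u n x - v x)) \<longlonglongrightarrow> 0"
proof -
  have "\<forall>u :: nat \<Rightarrow> 'a \<Rightarrow> real.
        (\<forall>n. u n \<in> \<F>) \<longrightarrow>
        (\<forall>e>0. \<exists>N. \<forall>j\<ge>N. \<forall>k\<ge>N. \<E> (\<lambda>x. u j x - u k x) powr (1 / p) < e) \<longrightarrow>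
        (\<exists>v\<in>\<F>. (\<lambda>n. \<E> (\<lambda>x. u n x - v x) powr (1 / p)) \<longlonglongrightarrow> 0)"
    using form unfolding p_resistance_form_def by blast
  then show ?thesis using that assms unfolding energy_norm_def by blast
qed

lemma separates: "x \<noteq> y \<Longrightarrow> \<exists>u\<in>\<F>. u x \<noteq> u y"
  using form by (auto simp: p_resistance_form_def)

lemma Res_finite: "resistance p \<E> \<F> x y = ennreal (Res x y)"
  using form by (simp add: p_resistance_form_def Res_def)

lemma Res_nonneg: "0 \<le> Res x y" by (simp add: Res_def)

lemma diff_le_Res:
  assumes "u \<in> \<F>"
  shows "\<bar>u x - u y\<bar> powr p \<le> Res x y * \<E> u"
proof (cases "\<exists>c. u = (\<lambda>_. c)")
  case True
  then show ?thesis using Res_nonneg[of x y] energy_nonneg[OF assms] p_gt_1 by auto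
next
  case False
  hence pos: "\<E> u > 0" using energy_zero_iff[OF assms] energy_nonneg[OF assms] by force
  have "u \<in> \<F> - const_funs" using False assms by (auto simp: const_funs_def)
  hence "ennreal (\<bar>u x - u y\<bar> powr p / \<E> u) \<le> resistance p \<E> \<F> x y"
    unfolding resistance_def by (rule SUP_upper)
  hence "\<bar>u x - u y\<bar> powr p / \<E> u \<le> Res x y"
    unfolding Res_finite using Res_nonneg by (simp add: ennreal_le_iff)
  then show ?thesis using pos by (simp add: field_simps)
qed

lemma Res_leI:
  assumes "\<And>u. u \<in> \<F> \<Longrightarrow> \<bar>u x - u y\<bar> powr p \<le> b * \<E> u" "0 \<le> b"
  shows "Res x y \<le> b"
proof -
  have "resistance p \<E> \<F> x y \<le> ennreal b"
    unfolding resistance_def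
  proof (rule SUP_least)
    fix u assume u: "u \<in> \<F> - const_funs"
    hence "\<E> u > 0" using energy_zero_iff[of u] energy_nonneg[of u] by (force simp: const_funs_def)
    then show "ennreal (\<bar>u x - u y\<bar> powr p / \<E> u) \<le> ennreal b"
      using assms(1)[of u] u by (intro ennreal_leI) (simp add: field_simps)
  qed
  then show ?thesis unfolding Res_finite using assms(2) by (simp add: ennreal_le_iff)
qed

lemma abs_in:
  assumes u: "u \<in> \<F>"
  shows "(\<lambda>x. \<bar>u x\<bar>) \<in> \<F>"
proof -
  have gc: "generalized_contraction p \<E> \<F>" using form by (simp add: p_resistance_form_def)
  have norm1: "lq_norm (ereal p) 1 x = \<bar>x 0\<bar>" for x
    using p_gt_1 by (simp add: lq_norm_def powr_powr)
  have "\<forall>l<1. (\<lambda>x. (\<lambda>x l. \<bar>x 0\<bar>) (\<lambda>k. u x) l) \<in> \<F>"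
    using gc[unfolded generalized_contraction_def, rule_format,
        of 1 1 p "ereal p" "\<lambda>x l. \<bar>x 0\<bar>" "\<lambda>_. u"] u p_gt_1
    unfolding norm1 by auto
  then show ?thesis by auto
qed

lemma min_in:
  assumes "u \<in> \<F>" "v \<in> \<F>"
  shows "(\<lambda>x. min (u x) (v x)) \<in> \<F>"
proof -
  have "(\<lambda>x. (1/2) * ((u x + v x) - \<bar>u x - v x\<bar>)) \<in> \<F>"
    by (intro scale_in diff_in add_in abs_in assms)
  moreover have "(1/2) * ((u x + v x) - \<bar>u x - v x\<bar>) = min (u x) (v x)" for x
    by (auto simp: min_def abs_if field_simps)
  ultimately show ?thesis by simp
qed

text \<open>
  The lattice property turns separation of pairs of points into separation of a point from a finite set.
\<close>

lemma ex_hat: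
  assumes "finite A" "q \<notin> A"
  shows "\<exists>h\<in>\<F>. h q = 1 \<and> (\<forall>y\<in>A. h y = 0)"
  using assms
proof (induction A)
  case empty
  show ?case using const_in[of 1] by (intro bexI[of _ "\<lambda>_. 1"]) auto
next
  case (insert y A)
  then obtain h where h: "h \<in> \<F>" "h q = 1" "\<forall>z\<in>A. h z = 0" by auto
  from insert have "q \<noteq> y" by auto
  then obtain u where u: "u \<in> \<F>" "u q \<noteq> u y" using separates by blast
  define g where "g x = (1 / (u q - u y)) * (u x - u y)" for x
  have g: "g \<in> \<F>" "g q = 1" "g y = 0"
    using u scale_in[OF diff_in[OF u(1) const_in], of "1 / (u q - u y)" "u y"]
    by (simp_all add: g_def[abs_def])
  show ?case
    using h g by (intro bexI[of _ "\<lambda>x. min \<bar>h x\<bar> \<bar>g x\<bar>"] min_in abs_in) auto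
qed

text \<open>
  The contraction property for the linear map \<open>(a, b) \<mapsto> (a + b, a - b)\<close> transfers the scalar Clarkson
  inequality to the energy.  The two exponents \<open>2n / (2n - 1)\<close> and \<open>2n\<close> enclose \<open>p\<close> once \<open>n\<close> is large.
\<close>

lemma norm_clarkson:
  assumes n: "1 \<le> n" "p \<le> 2 * real n" "2 * real n / (2 * real n - 1) \<le> p"
    and u: "u \<in> \<F>" and v: "v \<in> \<F>"
  defines "q \<equiv> 2 * real n / (2 * real n - 1)"
  shows "energy_norm (\<lambda>x. u x + v x) ^ (2 * n) + energy_norm (\<lambda>x. u x - v x) ^ (2 * n)
    \<le> 2 * (energy_norm u powr q + energy_norm v powr q) ^ (2 * n - 1)"
proof -
  have gc: "generalized_contraction p \<E> \<F>" using form by (simp add: p_resistance_form_def)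
  have q0: "0 < q" "q \<le> p" using n by (auto simp: q_def)
  define \<kappa> :: real where "\<kappa> = 2 powr (- (1 / (2 * real n)))"
  have \<kappa>0: "0 < \<kappa>" by (simp add: \<kappa>_def)
  have \<kappa>: "\<kappa> ^ (2 * n) = 1 / 2"
  proof -
    have "\<kappa> ^ (2 * n) = 2 powr (real (2 * n) * (- (1 / (2 * real n))))"
      unfolding \<kappa>_def by (subst powr_power) auto
    also have "real (2 * n) * (- (1 / (2 * real n))) = -1" using n by simp
    finally show ?thesis by (simp add: powr_minus_divide)
  qed
  define T where "T x l = \<kappa> * (if l = 0 then x 0 + x 1 else x 0 - x 1)" for x :: "nat \<Rightarrow> real" and l :: nat
  have two: "{..<2} = {0, 1::nat}" by auto
  have nq: "lq_norm (ereal q) 2 z = (\<bar>z 0\<bar> powr q + \<bar>z 1\<bar> powr q) powr (1 / q)" for z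
    by (simp add: lq_norm_def two)
  have n2: "lq_norm (ereal (2 * real n)) 2 z = (\<bar>z 0\<bar> ^ (2 * n) + \<bar>z 1\<bar> ^ (2 * n)) powr (1 / (2 * real n))" for z
  proof -
    have "\<bar>z l\<bar> powr (2 * real n) = \<bar>z l\<bar> ^ (2 * n)" for l
    proof (cases "z l = 0")
      case False
      then show ?thesis using powr_realpow[of "\<bar>z l\<bar>" "2 * n"] by simp
    qed (use n in auto)
    then show ?thesis by (simp add: lq_norm_def two)
  qed
  have pw: "X powr (1 / (2 * real n)) \<le> Y powr (1 / q) \<longleftrightarrow> X \<le> Y ^ (2 * n - 1)"
    if "0 \<le> X" "0 \<le> Y" for X Y :: real
  proof -
    have "Y powr (1 / q) = (Y ^ (2 * n - 1)) powr (1 / (2 * real n))"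
    proof (cases "Y = 0")
      case False
      hence "Y ^ (2 * n - 1) = Y powr (2 * real n - 1)"
        using that n powr_realpow[of Y "2 * n - 1"] by (simp add: of_nat_diff)
      then show ?thesis using n by (simp add: powr_powr q_def)
    next
      case True
      then show ?thesis using n(1) q0 by (cases n) auto
    qed
    moreover have "X powr (1 / (2 * real n)) \<le> Z powr (1 / (2 * real n)) \<longleftrightarrow> X \<le> Z" if "0 \<le> Z" for Z
      using \<open>0 \<le> X\<close> that n powr_mono2[of "1 / (2 * real n)" X Z] powr_less_mono2[of "1 / (2 * real n)" Z X]
      by (auto simp: not_le[symmetric])
    ultimately show ?thesis using that by simp
  qed
  have contr: "lq_norm (ereal (2 * real n)) 2 (\<lambda>l. T x l - T y l) \<le> lq_norm (ereal q) 2 (\<lambda>k. x k - y k)" for x y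
  proof -
    define a b where "a = x 0 - y 0" and "b = x 1 - y 1"
    have T0: "T x 0 - T y 0 = \<kappa> * (a + b)" and T1: "T x 1 - T y 1 = \<kappa> * (a - b)"
      by (simp_all add: T_def a_def b_def algebra_simps)
    have "\<bar>\<kappa> * (a + b)\<bar> ^ (2 * n) + \<bar>\<kappa> * (a - b)\<bar> ^ (2 * n)
        = (\<bar>a + b\<bar> ^ (2 * n) + \<bar>a - b\<bar> ^ (2 * n)) / 2"
      using \<kappa>0 by (simp add: abs_mult power_mult_distrib \<kappa> add_divide_distrib)
    also have "\<dots> \<le> (\<bar>a\<bar> powr q + \<bar>b\<bar> powr q) ^ (2 * n - 1)"
      using clarkson_even[OF n(1), of a b] by (simp add: q_def)
    finally show ?thesis
      unfolding n2 nq T0 T1 by (subst pw) (auto simp: a_def b_def)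
  qed
  have res: "lq_norm (ereal (2 * real n)) 2 (\<lambda>l. \<E> (\<lambda>x. T (\<lambda>k. (if k = 0 then u else v) x) l) powr (1 / p))
        \<le> lq_norm (ereal q) 2 (\<lambda>k. \<E> (if k = 0 then u else v) powr (1 / p))"
  proof -
    have "1 \<le> (2::nat)" "0 < q" "q \<le> p" "ereal p \<le> ereal (2 * real n)" "\<forall>l<2. T (\<lambda>_. 0) l = 0"
       "\<forall>k<2. (if k = (0::nat) then u else v) \<in> \<F>"
      using q0 n u v by (auto simp: T_def)
    then show ?thesis
      using gc[unfolded generalized_contraction_def, rule_format,
          of 2 2 q "ereal (2 * real n)" T "\<lambda>k. if k = 0 then u else v"] contr by blast
  qed
  have e0: "\<E> (\<lambda>x. T (\<lambda>k. (if k = 0 then u else v) x) 0) powr (1 / p) = \<kappa> * energy_norm (\<lambda>x. u x + v x)"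
    using norm_scale[OF add_in[OF u v], of \<kappa>] \<kappa>0 by (simp add: T_def energy_norm_def)
  have e1: "\<E> (\<lambda>x. T (\<lambda>k. (if k = 0 then u else v) x) 1) powr (1 / p) = \<kappa> * energy_norm (\<lambda>x. u x - v x)"
    using norm_scale[OF diff_in[OF u v], of \<kappa>] \<kappa>0 by (simp add: T_def energy_norm_def)
  have "(\<kappa> * energy_norm (\<lambda>x. u x + v x)) ^ (2 * n) + (\<kappa> * energy_norm (\<lambda>x. u x - v x)) ^ (2 * n)
      \<le> (energy_norm u powr q + energy_norm v powr q) ^ (2 * n - 1)"
    using res \<kappa>0 unfolding n2 nq e0 e1
    by (subst (asm) pw) (auto simp: norm_nonneg abs_mult energy_norm_def)
  then show ?thesis by (simp add: power_mult_distrib \<kappa>)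
qed

text \<open>
  Uniform convexity in the form used for minimising sequences: two elements of the ball of radius
  \<open>b\<close> whose midpoint has norm at least \<open>a\<close> are close to each other when \<open>a\<close> is close to \<open>b\<close>.
\<close>

lemma uniformly_convex:
  obtains n where "1 \<le> n"
    "\<And>u v a b. u \<in> \<F> \<Longrightarrow> v \<in> \<F> \<Longrightarrow> 0 \<le> a \<Longrightarrow> energy_norm u \<le> b \<Longrightarrow> energy_norm v \<le> b
      \<Longrightarrow> 2 * a \<le> energy_norm (\<lambda>x. u x + v x)
      \<Longrightarrow> energy_norm (\<lambda>x. u x - v x) ^ (2 * n) \<le> 2 ^ (2 * n) * (b ^ (2 * n) - a ^ (2 * n))"
proof -
  \<comment> \<open>This \<open>n\<close> is large enough for both \<open>p\<close> and its conjugate exponent to be at most \<open>2n\<close>.\<close>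
  obtain n :: nat where "p + p / (p - 1) \<le> real n" using real_arch_simple by blast
  hence n: "p + p / (p - 1) \<le> 2 * real n" by simp
  have pp: "0 < p / (p - 1)" using p_gt_1 by simp
  have n1: "1 \<le> n" using n pp p_gt_1 by (cases n) auto
  have np: "p \<le> 2 * real n" using n pp by linarith
  have "p / (p - 1) \<le> 2 * real n" using n p_gt_1 by linarith
  hence "p \<le> 2 * real n * (p - 1)" using p_gt_1 by (simp add: field_simps)
  hence nq: "2 * real n / (2 * real n - 1) \<le> p" using n1 p_gt_1 by (simp add: field_simps)
  define q where "q = 2 * real n / (2 * real n - 1)"
  show ?thesis
  proof (rule that[OF n1])
    fix u v a b
    assume u: "u \<in> \<F>" and v: "v \<in> \<F>" and a: "0 \<le> a" "2 * a \<le> energy_norm (\<lambda>x. u x + v x)"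
      and b: "energy_norm u \<le> b" "energy_norm v \<le> b"
    have b0: "0 \<le> b" using b(1) norm_nonneg[of u] by linarith
    have q0: "0 \<le> q" using n1 by (simp add: q_def)
    have bb: "(b powr q) ^ (2 * n - 1) = b ^ (2 * n)"
      unfolding q_def by (rule conjugate_power[OF n1 b0])
    have "(2 * a) ^ (2 * n) + energy_norm (\<lambda>x. u x - v x) ^ (2 * n)
        \<le> energy_norm (\<lambda>x. u x + v x) ^ (2 * n) + energy_norm (\<lambda>x. u x - v x) ^ (2 * n)"
      using a by (intro add_right_mono power_mono) auto
    also have "\<dots> \<le> 2 * (energy_norm u powr q + energy_norm v powr q) ^ (2 * n - 1)"
      unfolding q_def by (rule norm_clarkson) (use n1 np nq u v in auto)
    also have "\<dots> \<le> 2 * (b powr q + b powr q) ^ (2 * n - 1)"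
      using b q0 norm_nonneg
      by (intro mult_left_mono power_mono add_mono powr_mono2 add_nonneg_nonneg) auto
    also have "b powr q + b powr q = 2 * b powr q" by simp
    also have "2 * (2 * b powr q) ^ (2 * n - 1) = 2 ^ (2 * n) * b ^ (2 * n)"
      using n1 unfolding power_mult_distrib bb by (simp add: power_eq_if)
    finally show "energy_norm (\<lambda>x. u x - v x) ^ (2 * n) \<le> 2 ^ (2 * n) * (b ^ (2 * n) - a ^ (2 * n))"
      by (simp add: power_mult_distrib algebra_simps)
  qed
qed

text \<open>
  The energy is lower semicontinuous for convergence in \<open>L\<^sup>p\<close>.  The sets \<open>C n\<close> of the elements whose
  \<open>L\<^sup>p\<close>-distance to \<open>f\<close> has \<open>p\<close>-th power at most \<open>1 / (n + 1)\<close> are closed under midpoints, so by uniform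
  convexity a sequence of near-minimisers of the energy over \<open>C n\<close> is Cauchy; this replaces weak compactness.
  The limit determines \<open>f\<close> only up to an additive constant, which is recovered because the energy norm
  dominates the oscillation.
\<close>

lemma energy_lower_semicontinuous:
  assumes "prob_space m"
    and meas: "\<And>u. u \<in> \<F> \<Longrightarrow> u \<in> borel_measurable m"
    and osc: "\<And>u x y. u \<in> \<F> \<Longrightarrow> \<bar>u x - u y\<bar> \<le> \<Delta> * energy_norm u"
    and f[measurable]: "f \<in> borel_measurable m"
    and approx: "\<And>e. 0 < e \<Longrightarrow>
       \<exists>v\<in>\<F>. \<E> v \<le> L \<and> (\<integral>\<^sup>+x. ennreal (\<bar>v x - f x\<bar> powr p) \<partial>m) \<le> ennreal e"
  shows "\<exists>u\<in>\<F>. (AE x in m. f x = u x) \<and> \<E> u \<le> L"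
proof -
  interpret prob_space m by fact
  have p0: "0 < p" "1 \<le> p" using p_gt_1 by auto
  define I where "I v = (\<integral>\<^sup>+x. ennreal (\<bar>v x - f x\<bar> powr p) \<partial>m)" for v
  define C where "C n = {v \<in> \<F>. I v \<le> ennreal (1 / real (Suc n))}" for n
  define B where "B = L powr (1 / p)"
  have C_approx: "\<exists>v\<in>C n. energy_norm v \<le> B" for n
  proof -
    obtain v where v: "v \<in> \<F>" "\<E> v \<le> L" "I v \<le> ennreal (1 / real (Suc n))"
      using approx[of "1 / real (Suc n)"] unfolding I_def by auto
    have "energy_norm v \<le> B"
      unfolding energy_norm_def B_def using v energy_nonneg[of v] p0 by (intro powr_mono2) auto
    then show ?thesis using v by (auto simp: C_def)
  qed
  have C_mono: "C k \<subseteq> C n" if "n \<le> k" for n k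
  proof -
    have "ennreal (1 / real (Suc k)) \<le> ennreal (1 / real (Suc n))"
      using that by (intro ennreal_leI) (simp add: field_simps)
    then show ?thesis by (auto simp: C_def simp del: of_nat_Suc elim: order.trans)
  qed
  have C_mid: "(\<lambda>x. (1/2) * (u x + v x)) \<in> C n" if uv: "u \<in> C n" "v \<in> C n" for u v n
  proof -
    have uv': "u \<in> \<F>" "v \<in> \<F>" using uv by (auto simp: C_def)
    note [measurable] = meas[OF uv'(1)] meas[OF uv'(2)]
    have pt: "\<bar>(1/2) * (u x + v x) - f x\<bar> powr p
        \<le> (1/2) * \<bar>u x - f x\<bar> powr p + (1/2) * \<bar>v x - f x\<bar> powr p" for x
    proof -
      have "(1/2) * (u x + v x) - f x = (1/2) * (u x - f x) + (1/2) * (v x - f x)" by (simp add: field_simps)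
      then show ?thesis
        using convex_onD[OF convex_abs_powr[OF p0(2)], of "1/2" "u x - f x" "v x - f x"] by simp
    qed
    have "I (\<lambda>x. (1/2) * (u x + v x))
      \<le> (\<integral>\<^sup>+x. ennreal (1/2) * ennreal (\<bar>u x - f x\<bar> powr p) + ennreal (1/2) * ennreal (\<bar>v x - f x\<bar> powr p) \<partial>m)"
      unfolding I_def
      by (intro nn_integral_mono ennreal_le_lincomb pt) auto
    also have "\<dots> = ennreal (1/2) * I u + ennreal (1/2) * I v"
      unfolding I_def by (subst nn_integral_add) (auto simp: nn_integral_cmult)
    also have "\<dots> \<le> ennreal (1/2) * ennreal (1 / real (Suc n)) + ennreal (1/2) * ennreal (1 / real (Suc n))"
      using uv by (intro add_mono mult_left_mono) (auto simp: C_def)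
    also have "\<dots> = ennreal ((1/2) * (1 / real (Suc n)) + (1/2) * (1 / real (Suc n)))"
      by (simp only: ennreal_mult'[symmetric] ennreal_plus[symmetric] zero_le_divide_1_iff
          of_nat_0_le_iff zero_le_numeral mult_nonneg_nonneg)
    also have "(1/2) * (1 / real (Suc n)) + (1/2) * (1 / real (Suc n)) = 1 / real (Suc n)"
      by (simp add: field_simps)
    finally show ?thesis
      using scale_in[OF add_in[OF uv'], of "1/2"] unfolding C_def by blast
  qed
  define a where "a n = Inf (energy_norm ` C n)" for n
  have bdd: "bdd_below (energy_norm ` C n)" for n
    by (rule bdd_belowI[of _ 0]) (auto simp: norm_nonneg)
  have a_le: "a n \<le> energy_norm v" if "v \<in> C n" for n v
    unfolding a_def using that bdd by (intro cInf_lower) auto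
  have a_nonneg: "0 \<le> a n" for n
    unfolding a_def using C_approx[of n] by (intro cInf_greatest) (auto simp: norm_nonneg)
  have a_B: "a n \<le> B" for n using C_approx[of n] a_le[of _ n] by force
  have a_mono: "incseq a"
    unfolding incseq_def a_def
  proof (intro allI impI cInf_superset_mono)
    fix n k :: nat assume "n \<le> k"
    then show "energy_norm ` C k \<subseteq> energy_norm ` C n" by (intro image_mono C_mono)
    show "energy_norm ` C k \<noteq> {}" using C_approx[of k] by blast
  qed (rule bdd)
  obtain A where A: "a \<longlonglongrightarrow> A" "\<And>n. a n \<le> A"
    using incseq_convergent[OF a_mono] a_B by blast
  have A_B: "A \<le> B" using A(1) a_B by (intro LIMSEQ_le_const2) auto
  define b where "b n = A + 1 / real (Suc n)" for n
  have b_lim: "b \<longlonglongrightarrow> A"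
    unfolding b_def using tendsto_add[OF tendsto_const LIMSEQ_Suc[OF lim_1_over_n], of A] by simp
  have "\<exists>v\<in>C n. energy_norm v \<le> b n" for n
  proof -
    have "Inf (energy_norm ` C n) < b n"
      using A(2)[of n] unfolding a_def[symmetric] b_def by (smt (verit) of_nat_0_less_iff zero_less_Suc zero_less_divide_1_iff)
    then show ?thesis
      using cInf_lessD[of "energy_norm ` C n" "b n"] C_approx[of n] by force
  qed
  then obtain v where v: "\<And>n. v n \<in> C n" "\<And>n. energy_norm (v n) \<le> b n" by metis
  have vF: "v n \<in> \<F>" for n using v(1)[of n] by (simp add: C_def)
  have b_anti: "b k \<le> b n" if "n \<le> k" for n k using that by (simp add: b_def field_simps)
  obtain M where M: "1 \<le> M" and uc:
    "\<And>u v a b. u \<in> \<F> \<Longrightarrow> v \<in> \<F> \<Longrightarrow> 0 \<le> a \<Longrightarrow> energy_norm u \<le> b \<Longrightarrow> energy_norm v \<le> b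
      \<Longrightarrow> 2 * a \<le> energy_norm (\<lambda>x. u x + v x)
      \<Longrightarrow> energy_norm (\<lambda>x. u x - v x) ^ (2 * M) \<le> 2 ^ (2 * M) * (b ^ (2 * M) - a ^ (2 * M))"
    using uniformly_convex by blast
  define g where "g n = 2 ^ (2 * M) * (b n ^ (2 * M) - a n ^ (2 * M))" for n
  have g_lim: "g \<longlonglongrightarrow> 0"
  proof -
    have "g \<longlonglongrightarrow> 2 ^ (2 * M) * (A ^ (2 * M) - A ^ (2 * M))"
      unfolding g_def by (intro tendsto_intros b_lim A(1))
    then show ?thesis by simp
  qed
  have close: "energy_norm (\<lambda>x. v n x - v k x) ^ (2 * M) \<le> g n" if nk: "n \<le> k" for n k
    unfolding g_def
  proof (rule uc)
    have "(\<lambda>x. (1/2) * (v n x + v k x)) \<in> C n"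
      using v(1)[of n] v(1)[of k] C_mono[OF nk] by (intro C_mid) auto
    hence "a n \<le> (1/2) * energy_norm (\<lambda>x. v n x + v k x)"
      using a_le[of _ n] norm_scale[OF add_in[OF vF vF], of "1/2" n k] by fastforce
    then show "2 * a n \<le> energy_norm (\<lambda>x. v n x + v k x)" by simp
    show "energy_norm (v k) \<le> b n" using v(2)[of k] b_anti[OF nk] by linarith
  qed (rule vF a_nonneg v(2))+
  have "\<exists>N. \<forall>j\<ge>N. \<forall>k\<ge>N. energy_norm (\<lambda>x. v j x - v k x) < e" if e: "e > 0" for e
  proof -
    have "eventually (\<lambda>n. g n < e ^ (2 * M)) sequentially"
      using g_lim e by (intro order_tendstoD) auto
    then obtain N where N: "\<And>n. n \<ge> N \<Longrightarrow> g n < e ^ (2 * M)" by (auto simp: eventually_sequentially)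
    have *: "energy_norm (\<lambda>x. v j x - v k x) < e" if "N \<le> j" "j \<le> k" for j k
    proof -
      have "energy_norm (\<lambda>x. v j x - v k x) ^ (2 * M) < e ^ (2 * M)"
        using close[OF that(2)] N[OF that(1)] by linarith
      then show ?thesis by (rule power_less_imp_less_base) (use e in simp)
    qed
    have "energy_norm (\<lambda>x. v j x - v k x) < e" if "N \<le> j" "N \<le> k" for j k
      using *[of j k] *[of k j] that norm_minus_commute[OF vF vF, of j k] by (cases "j \<le> k") auto
    then show ?thesis by blast
  qed
  then obtain w where w: "w \<in> \<F>" "(\<lambda>n. energy_norm (\<lambda>x. v n x - w x)) \<longlonglongrightarrow> 0"
    using norm_complete[of v] vF by blast
  have w_norm: "energy_norm w \<le> B"
  proof -
    have "energy_norm w \<le> b n + energy_norm (\<lambda>x. v n x - w x)" for n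
      using norm_add[OF vF diff_in[OF w(1) vF], of n n] v(2)[of n] norm_minus_commute[OF vF w(1), of n]
      by simp
    hence "energy_norm w \<le> A + 0"
      by (intro LIMSEQ_le_const[OF tendsto_add[OF b_lim w(2)]]) auto
    then show ?thesis using A_B by simp
  qed
  \<comment> \<open>The constants \<open>d n\<close> normalise \<open>v n - w\<close> at an arbitrary point.\<close>
  define d where "d n = v n undefined - w undefined" for n
  define \<delta> where "\<delta> n = \<Delta> * energy_norm (\<lambda>x. v n x - w x)" for n
  have \<delta>_lim: "\<delta> \<longlonglongrightarrow> 0" unfolding \<delta>_def using tendsto_mult_left[OF w(2), of \<Delta>] by simp
  define \<eta> where "\<eta> n = 2 powr p * (1 / real (Suc n) + \<bar>\<delta> n\<bar> powr p)" for n
  have \<eta>_lim: "\<eta> \<longlonglongrightarrow> 0"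
  proof -
    have "(\<lambda>n. \<bar>\<delta> n\<bar> powr p) \<longlonglongrightarrow> 0"
      using \<delta>_lim p0 by (intro tendsto_zero_powrI[where b = p]) (auto intro: tendsto_rabs_zero)
    hence "\<eta> \<longlonglongrightarrow> 2 powr p * (0 + 0)"
      unfolding \<eta>_def using LIMSEQ_Suc[OF lim_1_over_n] by (intro tendsto_intros) auto
    then show ?thesis by simp
  qed
  have \<eta>0: "0 \<le> \<eta> n" for n by (simp add: \<eta>_def)
  note [measurable] = meas[OF w(1)] meas[OF vF]
  define D where "D s = (\<integral>\<^sup>+x. ennreal (\<bar>(w x + s) - f x\<bar> powr p) \<partial>m)" for s
  have D_le: "D (d n) \<le> ennreal (\<eta> n)" for n
  proof -
    have pt: "\<bar>(w x + d n) - v n x\<bar> powr p \<le> \<bar>\<delta> n\<bar> powr p" for x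
    proof -
      have "\<bar>(v n x - w x) - (v n undefined - w undefined)\<bar> \<le> \<delta> n"
        unfolding \<delta>_def using osc[OF diff_in[OF vF w(1)]] .
      then show ?thesis using p0 by (intro powr_mono2) (auto simp: d_def)
    qed
    have "D (d n) \<le> ennreal (2 powr p) * ((\<integral>\<^sup>+x. ennreal (\<bar>(w x + d n) - v n x\<bar> powr p) \<partial>m) + I (v n))"
      unfolding D_def I_def by (rule nn_integral_diff_powr_le[OF p0(1)]) measurable
    also have "\<dots> \<le> ennreal (2 powr p) * ((\<integral>\<^sup>+x. ennreal (\<bar>\<delta> n\<bar> powr p) \<partial>m) + ennreal (1 / real (Suc n)))"
      using v(1)[of n] by (intro mult_left_mono add_mono nn_integral_mono ennreal_leI pt) (auto simp: C_def)
    also have "\<dots> = ennreal (\<eta> n)"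
      by (simp add: emeasure_space_1 \<eta>_def ennreal_mult[symmetric] ennreal_plus[symmetric] add.commute
          del: ennreal_plus)
    finally show ?thesis .
  qed
  have D_shift: "D t \<le> ennreal (2 powr p) * (ennreal (\<bar>t - s\<bar> powr p) + D s)" for s t
    unfolding D_def
    by (rule order.trans[OF nn_integral_diff_powr_le[OF p0(1), of _ m "\<lambda>x. w x + s"]])
      (auto simp: emeasure_space_1)
  have d_diff: "\<bar>d n - d k\<bar> powr p \<le> 2 powr p * (\<eta> n + \<eta> k)" for n k
  proof -
    have "ennreal (\<bar>d n - d k\<bar> powr p) = (\<integral>\<^sup>+x. ennreal (\<bar>(w x + d n) - (w x + d k)\<bar> powr p) \<partial>m)"
      by (simp add: emeasure_space_1)
    also have "\<dots> \<le> ennreal (2 powr p) * (D (d n) + D (d k))"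
      unfolding D_def
      by (rule order.trans[OF nn_integral_diff_powr_le[OF p0(1), of _ m f]])
        (auto simp: abs_minus_commute[of "f _"])
    also have "\<dots> \<le> ennreal (2 powr p) * (ennreal (\<eta> n) + ennreal (\<eta> k))"
      by (intro mult_left_mono add_mono D_le) auto
    also have "\<dots> = ennreal (2 powr p * (\<eta> n + \<eta> k))"
      using \<eta>0 by (simp add: ennreal_mult[symmetric] ennreal_plus[symmetric] del: ennreal_plus)
    finally show ?thesis using \<eta>0 by (subst (asm) ennreal_le_iff) auto
  qed
  have "Cauchy d"
  proof (rule metric_CauchyI)
    fix e :: real assume e: "e > 0"
    have "eventually (\<lambda>n. \<eta> n < e powr p / (2 * 2 powr p)) sequentially"
      using \<eta>_lim e by (intro order_tendstoD) auto
    then obtain N where N: "\<And>n. n \<ge> N \<Longrightarrow> \<eta> n < e powr p / (2 * 2 powr p)"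
      by (auto simp: eventually_sequentially)
    have "dist (d n) (d k) < e" if "N \<le> n" "N \<le> k" for n k
    proof (rule ccontr)
      assume "\<not> ?thesis"
      hence "e powr p \<le> \<bar>d n - d k\<bar> powr p" using e p0 by (intro powr_mono2) (auto simp: dist_real_def)
      moreover have "2 powr p * (\<eta> n + \<eta> k) < e powr p"
        using N[OF that(1)] N[OF that(2)] by (simp add: field_simps)
      ultimately show False using d_diff[of n k] by linarith
    qed
    then show "\<exists>N. \<forall>n\<ge>N. \<forall>k\<ge>N. dist (d n) (d k) < e" by blast
  qed
  then obtain c where c: "d \<longlonglongrightarrow> c" using Cauchy_convergent convergentD by blast
  have "D c = 0"
  proof -
    define h where "h n = 2 powr p * (\<bar>c - d n\<bar> powr p + \<eta> n)" for n
    have h_lim: "h \<longlonglongrightarrow> 0"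
    proof -
      have "(\<lambda>n. \<bar>c - d n\<bar>) \<longlonglongrightarrow> \<bar>c - c\<bar>" by (intro tendsto_intros c)
      hence "(\<lambda>n. \<bar>c - d n\<bar> powr p) \<longlonglongrightarrow> 0"
        using p0 by (intro tendsto_zero_powrI[where b = p]) auto
      hence "h \<longlonglongrightarrow> 2 powr p * (0 + 0)"
        unfolding h_def using \<eta>_lim by (intro tendsto_intros) auto
      then show ?thesis by simp
    qed
    have "D c \<le> ennreal (h n)" for n
    proof -
      have "D c \<le> ennreal (2 powr p) * (ennreal (\<bar>c - d n\<bar> powr p) + D (d n))" by (rule D_shift)
      also have "\<dots> \<le> ennreal (2 powr p) * (ennreal (\<bar>c - d n\<bar> powr p) + ennreal (\<eta> n))"
        by (intro mult_left_mono add_left_mono D_le) auto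
      also have "\<dots> = ennreal (h n)"
        using \<eta>0 by (simp add: h_def ennreal_mult[symmetric] ennreal_plus[symmetric] del: ennreal_plus)
      finally show ?thesis .
    qed
    moreover have "(\<lambda>n. ennreal (h n)) \<longlonglongrightarrow> ennreal 0" by (intro tendsto_ennrealI h_lim)
    ultimately have "D c \<le> ennreal 0" by (intro LIMSEQ_le_const) auto
    then show ?thesis by simp
  qed
  hence "AE x in m. ennreal (\<bar>(w x + c) - f x\<bar> powr p) = 0"
    unfolding D_def by (subst (asm) nn_integral_0_iff_AE) auto
  hence ae: "AE x in m. f x = w x + c" by eventually_elim auto
  have wc: "(\<lambda>x. w x + c) \<in> \<F>" using w(1) const_in by (intro add_in)
  have "energy_norm (\<lambda>x. w x + c) \<le> B"
    using norm_add[OF w(1) const_in, of c] w_norm norm_const[of c] by simp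
  hence "\<E> (\<lambda>x. w x + c) \<le> B powr p"
    unfolding energy_eq[OF wc] using p0 norm_nonneg by (intro powr_mono2) auto
  also have "B powr p = L"
  proof -
    obtain u where "u \<in> \<F>" "\<E> u \<le> L" using approx[of 1] by auto
    hence "0 \<le> L" using energy_nonneg[of u] by linarith
    then show ?thesis using p0 by (simp add: B_def powr_powr)
  qed
  finally show ?thesis using wc ae by (intro bexI[of _ "\<lambda>x. w x + c"]) auto
qed

end

section \<open>Words and partitions of the shift space\<close>

primrec word_map :: "('i \<Rightarrow> 'a \<Rightarrow> 'a) \<Rightarrow> 'i list \<Rightarrow> 'a \<Rightarrow> 'a" where
  "word_map F [] = id"
| "word_map F (i # w) = F i \<circ> word_map F w"

primrec word_seq :: "'i list \<Rightarrow> (nat \<Rightarrow> 'i) \<Rightarrow> nat \<Rightarrow> 'i" where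
  "word_seq [] \<omega> = \<omega>"
| "word_seq (i # w) \<omega> = word_cons i (word_seq w \<omega>)"

definition weight :: "('i \<Rightarrow> real) \<Rightarrow> 'i list \<Rightarrow> real" where
  "weight \<rho> w = prod_list (map \<rho> w)"

text \<open>
  Finite sets of words whose cylinders partition the shift space, generated by successive subdivision,
  so that every self-similarity property extends from the one-letter words by induction.
\<close>

inductive word_partition :: "'i set \<Rightarrow> 'i list set \<Rightarrow> bool" for S where
  root: "word_partition S {[]}"
| split: "(\<And>i. i \<in> S \<Longrightarrow> word_partition S (P i)) \<Longrightarrow> word_partition S (\<Union>i\<in>S. (#) i ` P i)"

lemma word_map_append: "word_map F (u @ v) x = word_map F u (word_map F v x)"
  by (induction u) auto

lemma word_seq_nth: "word_seq w \<omega> k = (if k < length w then w ! k else \<omega> (k - length w))"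
  by (induction w arbitrary: k) (auto simp: word_cons_def split: nat.split)

lemma left_shift_funpow: "(left_shift ^^ n) \<omega> = (\<lambda>k. \<omega> (k + n))"
  by (induction n) (auto simp: left_shift_def)

lemma weight_simps [simp]: "weight \<rho> [] = 1" "weight \<rho> (i # w) = \<rho> i * weight \<rho> w"
  by (simp_all add: weight_def)

lemma weight_pos:
  assumes "\<And>i. i \<in> S \<Longrightarrow> 0 < \<rho> i" "w \<in> lists S"
  shows "0 < weight \<rho> w"
  using assms(2) by (induction w) (auto intro: mult_pos_pos assms(1))

lemma word_partition_finite: "word_partition S P \<Longrightarrow> finite S \<Longrightarrow> finite P"
  by (induction rule: word_partition.induct) auto

lemma word_partition_lists: "word_partition S P \<Longrightarrow> P \<subseteq> lists S"
  by (induction rule: word_partition.induct) fastforce+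

lemma word_partition_branch:
  assumes "word_partition S P" "w \<in> P" "v \<in> P" "w \<noteq> v"
  shows "\<exists>z i j w' v'. w = z @ i # w' \<and> v = z @ j # v' \<and> i \<noteq> j"
  using assms
proof (induction arbitrary: w v rule: word_partition.induct)
  case (split P)
  then obtain i j w1 v1 where *: "i \<in> S" "w1 \<in> P i" "w = i # w1" "j \<in> S" "v1 \<in> P j" "v = j # v1"
    by auto
  show ?case
  proof (cases "i = j")
    case True
    with * split.prems have "w1 \<noteq> v1" by auto
    with split.IH[of i w1 v1] * True obtain z i' j' w' v'
      where "w1 = z @ i' # w'" "v1 = z @ j' # v'" "i' \<noteq> j'" by blast
    then show ?thesis using * True
      by (intro exI[of _ "i # z"] exI[of _ i'] exI[of _ j'] exI[of _ w'] exI[of _ v']) auto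
  next
    case False
    then show ?thesis using *
      by (intro exI[of _ "[]"] exI[of _ i] exI[of _ j] exI[of _ w1] exI[of _ v1]) auto
  qed
qed auto

lemma word_partition_seq_inj:
  assumes "word_partition S P" "w \<in> P" "v \<in> P" "word_seq w \<omega> = word_seq v \<eta>"
  shows "w = v"
proof (rule ccontr)
  assume "w \<noteq> v"
  then obtain z i j w' v' where *: "w = z @ i # w'" "v = z @ j # v'" "i \<noteq> j"
    using word_partition_branch[OF assms(1-3)] by blast
  have "word_seq w \<omega> (length z) = i" "word_seq v \<eta> (length z) = j"
    by (simp_all add: word_seq_nth *)
  with assms(4) *(3) show False by simp
qed

lemma sum_word_partition_split:
  assumes "finite S" "\<And>i. i \<in> S \<Longrightarrow> finite (P i)"
  shows "(\<Sum>w\<in>(\<Union>i\<in>S. (#) i ` P i). g w) = (\<Sum>i\<in>S. \<Sum>w\<in>P i. g (i # w))"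
proof -
  have "(\<Sum>w\<in>(\<Union>i\<in>S. (#) i ` P i). g w) = (\<Sum>i\<in>S. \<Sum>w\<in>(#) i ` P i. g w)"
    using assms by (intro sum.UNION_disjoint) auto
  also have "\<dots> = (\<Sum>i\<in>S. \<Sum>w\<in>P i. g (i # w))"
    by (rule sum.cong[OF refl]) (simp add: sum.reindex)
  finally show ?thesis .
qed

text \<open>
  Stopping a subdivision as soon as the weight reaches \<open>t\<close> gives cells of comparable weight.
  The induction needs thresholds slightly below \<open>1\<close>, where the empty word already qualifies.
\<close>

lemma ex_word_partition_of_weight:
  assumes S: "finite S" "S \<noteq> {}" and \<rho>: "\<And>i. i \<in> S \<Longrightarrow> 1 < \<rho> i \<and> \<rho> i \<le> M" and t: "1 \<le> t"
  shows "\<exists>P. word_partition S P \<and> (\<forall>w\<in>P. t \<le> weight \<rho> w \<and> weight \<rho> w \<le> M * t)"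
proof -
  define l where "l = Min (\<rho> ` S)"
  have l: "1 < l" "\<And>i. i \<in> S \<Longrightarrow> l \<le> \<rho> i" using S \<rho> by (auto simp: l_def)
  have M: "1 < M" using S \<rho> by force
  have step: "\<exists>P. word_partition S P \<and> (\<forall>w\<in>P. t \<le> weight \<rho> w \<and> weight \<rho> w \<le> M * t)"
    if "t \<le> l ^ n" "1 \<le> M * t" for n and t :: real
    using that
  proof (induction n arbitrary: t)
    case 0
    then show ?case by (intro exI[of _ "{[]}"]) (auto intro: word_partition.root)
  next
    case (Suc n)
    show ?case
    proof (cases "t \<le> 1")
      case True
      then show ?thesis using Suc.prems by (intro exI[of _ "{[]}"]) (auto intro: word_partition.root)
    next
      case False
      have "\<exists>Q. word_partition S Q \<and> (\<forall>w\<in>Q. t / \<rho> i \<le> weight \<rho> w \<and> weight \<rho> w \<le> M * (t / \<rho> i))"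
        if i: "i \<in> S" for i
      proof (rule Suc.IH)
        have r: "0 < \<rho> i" "\<rho> i \<le> M" "l \<le> \<rho> i" using \<rho>[OF i] l i by auto
        have "t \<le> l ^ n * l" using Suc.prems by (simp add: mult.commute)
        also have "\<dots> \<le> l ^ n * \<rho> i" using r l by (intro mult_left_mono) auto
        finally show "t / \<rho> i \<le> l ^ n" using r by (simp add: divide_le_eq)
        have "\<rho> i * 1 \<le> M * t" using r False M by (intro mult_mono) auto
        then show "1 \<le> M * (t / \<rho> i)" using r by (simp add: le_divide_eq)
      qed
      then obtain Q where Q: "\<And>i. i \<in> S \<Longrightarrow> word_partition S (Q i)"
        "\<And>i w. i \<in> S \<Longrightarrow> w \<in> Q i \<Longrightarrow> t / \<rho> i \<le> weight \<rho> w \<and> weight \<rho> w \<le> M * (t / \<rho> i)"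
        by metis
      have "t \<le> \<rho> i * weight \<rho> w \<and> \<rho> i * weight \<rho> w \<le> M * t" if i: "i \<in> S" "w \<in> Q i" for i w
        using Q(2)[OF i] \<rho>[OF i(1)] by (simp add: field_simps)
      then show ?thesis
        using Q(1) by (intro exI[of _ "\<Union>i\<in>S. (#) i ` Q i"] conjI word_partition.split) auto
    qed
  qed
  obtain n where "t < l ^ n" using real_arch_pow[OF l(1)] by blast
  moreover have "1 \<le> M * t" using M t mult_mono[of 1 M 1 t] by simp
  ultimately show ?thesis using step[of t n] by simp
qed

section \<open>Cells of post-critically finite structures\<close>

locale pcf_structure =
  fixes S :: "'i set" and F :: "'i \<Rightarrow> 'a \<Rightarrow> 'a::metric_space" and \<kappa> :: "(nat \<Rightarrow> 'i) \<Rightarrow> 'a"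
  assumes self_similar: "self_similar_structure S F"
    and coding: "coding_map S F \<kappa>"
    and finite_post_critical: "finite (post_critical_set S F \<kappa>)"
begin

abbreviation cell :: "'i list \<Rightarrow> 'a set" where
  "cell w \<equiv> range (word_map F w)"

definition V0 :: "'a set" where
  "V0 = \<kappa> ` post_critical_set S F \<kappa>"

definition neighbours :: "'i list set \<Rightarrow> 'i list \<Rightarrow> 'i list set" where
  "neighbours P w = {v \<in> P. cell w \<inter> cell v \<noteq> {}}"

definition point_bound :: nat where
  "point_bound = Suc (card (critical_set S F \<kappa>))"

definition degree_bound :: nat where
  "degree_bound = Suc (card V0 * point_bound)"

lemma finite_S: "finite S" and S_nonempty: "S \<noteq> {}"
  using self_similar by (auto simp: self_similar_structure_def)

lemma compact_space: "compact (UNIV :: 'a set)"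
  using self_similar by (simp add: self_similar_structure_def)

lemma finite_V0: "finite V0"
  unfolding V0_def using finite_post_critical by simp

lemma seqs_iff: "\<omega> \<in> topspace (shift_space S) \<longleftrightarrow> (\<forall>n. \<omega> n \<in> S)"
  by (simp add: shift_space_def PiE_UNIV_domain Pi_def)

lemma coding_surj: obtains \<omega> where "\<And>n. \<omega> n \<in> S" "\<kappa> \<omega> = x"
proof -
  have "x \<in> \<kappa> ` topspace (shift_space S)" using coding by (simp add: coding_map_def)
  then obtain \<omega> where "x = \<kappa> \<omega>" "\<omega> \<in> topspace (shift_space S)" by (rule imageE)
  then show ?thesis using that[of \<omega>] unfolding seqs_iff by simp
qed

lemma coding_cons: "i \<in> S \<Longrightarrow> (\<And>n. \<omega> n \<in> S) \<Longrightarrow> \<kappa> (word_cons i \<omega>) = F i (\<kappa> \<omega>)"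
  using coding seqs_iff by (auto simp: coding_map_def)

lemma word_seq_in: "w \<in> lists S \<Longrightarrow> (\<And>n. \<omega> n \<in> S) \<Longrightarrow> word_seq w \<omega> k \<in> S"
  by (auto simp: word_seq_nth in_lists_conv_set)

lemma coding_word: "w \<in> lists S \<Longrightarrow> (\<And>n. \<omega> n \<in> S) \<Longrightarrow> \<kappa> (word_seq w \<omega>) = word_map F w (\<kappa> \<omega>)"
  by (induction w) (auto simp: coding_cons word_seq_in)

lemma word_map_inj: "w \<in> lists S \<Longrightarrow> inj (word_map F w)"
proof (induction w)
  case (Cons i w)
  hence "inj (F i)" using self_similar by (auto simp: self_similar_structure_def)
  then show ?case using Cons unfolding word_map.simps by (intro inj_compose) auto
qed auto

lemma word_map_continuous: "w \<in> lists S \<Longrightarrow> continuous_on UNIV (word_map F w)"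
proof (induction w)
  case (Cons i w)
  hence "continuous_on UNIV (F i)" using self_similar by (auto simp: self_similar_structure_def)
  then show ?case using Cons unfolding word_map.simps
    by (intro continuous_on_compose) (auto intro: continuous_on_subset)
qed (auto simp: id_def)

lemma cells_cover:
  assumes "word_partition S P"
  shows "\<exists>w\<in>P. x \<in> cell w"
  using assms
proof (induction arbitrary: x rule: word_partition.induct)
  case (split P)
  obtain \<omega> where \<omega>: "\<And>n. \<omega> n \<in> S" "\<kappa> \<omega> = x" using coding_surj[of x] by blast
  have "word_cons (\<omega> 0) (\<lambda>n. \<omega> (Suc n)) = \<omega>" by (auto simp: word_cons_def split: nat.split)
  hence x: "x = F (\<omega> 0) (\<kappa> (\<lambda>n. \<omega> (Suc n)))"
    using coding_cons[of "\<omega> 0" "\<lambda>n. \<omega> (Suc n)"] \<omega> by simp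
  obtain w y where "w \<in> P (\<omega> 0)" "\<kappa> (\<lambda>n. \<omega> (Suc n)) = word_map F w y"
    using split.IH[of "\<omega> 0" "\<kappa> (\<lambda>n. \<omega> (Suc n))"] \<omega> by auto
  then show ?case using \<omega> x by (intro bexI[of _ "\<omega> 0 # w"]) auto
qed auto

text \<open>
  After cancelling the common prefix, a point common to two cells of a partition has a critical code;
  removing the rest of the word from that code leaves a post-critical sequence.
\<close>

lemma cells_meet_in_boundary:
  assumes P: "word_partition S P" "w \<in> P" "v \<in> P" "w \<noteq> v"
    and eq: "word_map F w a = word_map F v b"
  shows "a \<in> V0"
proof -
  obtain z i j w' v' where *: "w = z @ i # w'" "v = z @ j # v'" "i \<noteq> j"
    using word_partition_branch[OF P] by blast
  have l: "w \<in> lists S" "v \<in> lists S" using word_partition_lists[OF P(1)] P by auto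
  hence z: "z \<in> lists S" "i \<in> S" "j \<in> S" "w' \<in> lists S" "v' \<in> lists S" using * by auto
  have "word_map F z (word_map F (i # w') a) = word_map F z (word_map F (j # v') b)"
    using eq unfolding * word_map_append .
  hence y: "word_map F (i # w') a = word_map F (j # v') b"
    using word_map_inj[OF z(1)] by (auto dest: injD)
  obtain \<alpha> where \<alpha>: "\<And>n. \<alpha> n \<in> S" "\<kappa> \<alpha> = a" using coding_surj[of a] by blast
  have iw: "i # w' \<in> lists S" using z by simp
  have "\<kappa> (word_seq (i # w') \<alpha>) = word_map F (i # w') a"
    using coding_word[OF iw] \<alpha> by simp
  moreover have "word_map F (i # w') a \<in> range (F i)" by simp
  moreover have "word_map F (i # w') a \<in> range (F j)" unfolding y by simp
  ultimately have "\<kappa> (word_seq (i # w') \<alpha>) \<in> range (F i) \<inter> range (F j)" by simp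
  hence crit: "word_seq (i # w') \<alpha> \<in> critical_set S F \<kappa>"
    using word_seq_in[OF iw] \<alpha> *(3) z(2,3) unfolding critical_set_def seqs_iff by blast
  have "(left_shift ^^ length (i # w')) (word_seq (i # w') \<alpha>) = \<alpha>"
    unfolding left_shift_funpow by (rule ext) (simp add: word_seq_nth del: word_seq.simps)
  hence "\<alpha> \<in> post_critical_set S F \<kappa>"
    unfolding post_critical_set_def using crit
    by (intro UN_I[of "length (i # w')"]) (auto intro!: image_eqI[of _ _ "word_seq (i # w') \<alpha>"] simp del: word_seq.simps)
  then show ?thesis using \<alpha> by (auto simp: V0_def)
qed

lemma finite_critical_set: "finite (critical_set S F \<kappa>)"
proof (rule finite_subset)
  show "critical_set S F \<kappa> \<subseteq> (\<Union>i\<in>S. word_cons i ` post_critical_set S F \<kappa>)"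
  proof
    fix \<omega> assume \<omega>: "\<omega> \<in> critical_set S F \<kappa>"
    hence "\<omega> 0 \<in> S" by (auto simp: critical_set_def seqs_iff)
    moreover have "left_shift \<omega> \<in> post_critical_set S F \<kappa>"
      unfolding post_critical_set_def using \<omega> by (intro UN_I[of 1]) auto
    moreover have "\<omega> = word_cons (\<omega> 0) (left_shift \<omega>)"
      by (auto simp: word_cons_def left_shift_def split: nat.split)
    ultimately show "\<omega> \<in> (\<Union>i\<in>S. word_cons i ` post_critical_set S F \<kappa>)" by blast
  qed
  show "finite (\<Union>i\<in>S. word_cons i ` post_critical_set S F \<kappa>)"
    using finite_S finite_post_critical by auto
qed

text \<open>
  If all cells containing \<open>x\<close> lie in one first-level cell, one can zoom in.  Otherwise \<open>x\<close> lies in two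
  first-level cells, so all its codes are critical, and different cells give different codes.
\<close>

lemma card_cells_at_point:
  assumes "word_partition S P"
  shows "card {v \<in> P. x \<in> cell v} \<le> point_bound"
  using assms
proof (induction arbitrary: x rule: word_partition.induct)
  case root
  have "card {v \<in> {[] :: 'i list}. x \<in> cell v} \<le> card {[] :: 'i list}" by (intro card_mono) auto
  then show ?case by (simp add: point_bound_def)
next
  case (split P)
  let ?P = "\<Union>i\<in>S. (#) i ` P i"
  let ?T = "{v \<in> ?P. x \<in> cell v}"
  have part: "word_partition S ?P" using split.hyps by (rule word_partition.split)
  show ?case
  proof (cases "\<exists>i\<in>S. \<exists>j\<in>S. i \<noteq> j \<and> x \<in> range (F i) \<inter> range (F j)")
    case True
    have "\<exists>\<omega>. (\<forall>n. \<omega> n \<in> S) \<and> \<kappa> (word_seq v \<omega>) = x" if "v \<in> ?T" for v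
    proof -
      have "x \<in> cell v" using that unfolding mem_Collect_eq by (rule conjunct2)
      then obtain y where y: "x = word_map F v y" by (rule rangeE)
      obtain \<omega> where \<omega>: "\<And>n. \<omega> n \<in> S" "\<kappa> \<omega> = y" using coding_surj[of y] by blast
      have "v \<in> lists S" using that word_partition_lists[OF part] by auto
      then show ?thesis using coding_word[of v \<omega>] \<omega> y by auto
    qed
    hence "\<forall>v\<in>?T. \<exists>\<omega>. (\<forall>n. \<omega> n \<in> S) \<and> \<kappa> (word_seq v \<omega>) = x" by (rule ballI)
    from bchoice[OF this] obtain g
      where g': "\<forall>v\<in>?T. (\<forall>n. g v n \<in> S) \<and> \<kappa> (word_seq v (g v)) = x" ..
    note g = bspec[OF g']
    have "(\<lambda>v. word_seq v (g v)) ` ?T \<subseteq> critical_set S F \<kappa>"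
    proof
      fix \<omega> assume "\<omega> \<in> (\<lambda>v. word_seq v (g v)) ` ?T"
      then obtain v where v: "v \<in> ?T" "\<omega> = word_seq v (g v)" by blast
      have "v \<in> lists S" using v word_partition_lists[OF part] by auto
      hence "\<forall>n. \<omega> n \<in> S" using g[OF v(1)] v(2) word_seq_in by blast
      moreover have "\<kappa> \<omega> = x" using g[OF v(1)] v(2) by simp
      ultimately show "\<omega> \<in> critical_set S F \<kappa>"
        using True unfolding critical_set_def seqs_iff by blast
    qed
    moreover have "inj_on (\<lambda>v. word_seq v (g v)) ?T"
      using word_partition_seq_inj[OF part] by (intro inj_onI) auto
    ultimately have "card ?T \<le> card (critical_set S F \<kappa>)"
      using finite_critical_set by (intro card_inj_on_le)
    then show ?thesis by (simp add: point_bound_def)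
  next
    case False
    show ?thesis
    proof (cases "?T = {}")
      case True
      then show ?thesis by (metis card.empty le0)
    next
      case ne: False
      then obtain i v0 y where i: "i \<in> S" "v0 \<in> P i" "x = F i (word_map F v0 y)" by auto
      define x' where "x' = word_map F v0 y"
      have inj: "inj (F i)" using self_similar i by (auto simp: self_similar_structure_def)
      have "?T \<subseteq> (#) i ` {v \<in> P i. x' \<in> cell v}"
      proof
        fix v assume "v \<in> ?T"
        then obtain j v1 y1 where j: "j \<in> S" "v1 \<in> P j" "v = j # v1" "x = F j (word_map F v1 y1)" by auto
        have "j = i" using False i j by blast
        moreover have "x' = word_map F v1 y1"
        proof (rule injD[OF inj])
          show "F i x' = F i (word_map F v1 y1)"
            unfolding x'_def using i(3) j(4) unfolding \<open>j = i\<close> by (rule subst)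
        qed
        ultimately show "v \<in> (#) i ` {v \<in> P i. x' \<in> cell v}" using j by auto
      qed
      moreover have fin: "finite {v \<in> P i. x' \<in> cell v}"
        using word_partition_finite[OF split.hyps[OF i(1)] finite_S] by simp
      ultimately have "card ?T \<le> card ((#) i ` {v \<in> P i. x' \<in> cell v})"
        by (intro card_mono finite_imageI)
      also have "\<dots> \<le> card {v \<in> P i. x' \<in> cell v}"
        using fin by (rule card_image_le)
      finally show ?thesis using split.IH[OF i(1), of x'] by simp
    qed
  qed
qed

lemma neighbours_subset: "neighbours P w \<subseteq> P"
  by (auto simp: neighbours_def)

lemma neighbours_sym: "w \<in> P \<Longrightarrow> v \<in> neighbours P w \<Longrightarrow> w \<in> neighbours P v"
  by (auto simp: neighbours_def)

lemma self_neighbour: "w \<in> P \<Longrightarrow> w \<in> neighbours P w"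
  by (auto simp: neighbours_def)

lemma card_neighbours:
  assumes P: "word_partition S P" and w: "w \<in> P"
  shows "card (neighbours P w) \<le> degree_bound"
proof -
  have fin: "finite P" using word_partition_finite[OF P finite_S] .
  let ?N = "\<lambda>q. {v \<in> P. word_map F w q \<in> cell v}"
  have "neighbours P w \<subseteq> insert w (\<Union>q\<in>V0. ?N q)"
  proof
    fix v assume v: "v \<in> neighbours P w"
    then obtain a b where ab: "word_map F w a = word_map F v b" "v \<in> P" by (auto simp: neighbours_def)
    show "v \<in> insert w (\<Union>q\<in>V0. ?N q)"
    proof (cases "v = w")
      case False
      hence "a \<in> V0" using cells_meet_in_boundary[OF P w ab(2) _ ab(1)] by simp
      then show ?thesis using ab by auto
    qed auto
  qed
  moreover have "finite (\<Union>q\<in>V0. ?N q)" using fin finite_V0 by auto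
  ultimately have "card (neighbours P w) \<le> card (insert w (\<Union>q\<in>V0. ?N q))"
    by (intro card_mono finite.insertI)
  also have "\<dots> \<le> Suc (card (\<Union>q\<in>V0. ?N q))"
    by (simp add: card_insert_if \<open>finite (\<Union>q\<in>V0. ?N q)\<close>)
  also have "card (\<Union>q\<in>V0. ?N q) \<le> (\<Sum>q\<in>V0. card (?N q))"
    by (rule card_UN_le[OF finite_V0])
  also have "(\<Sum>q\<in>V0. card (?N q)) \<le> of_nat (card V0) * point_bound"
    by (intro sum_bounded_above card_cells_at_point P)
  finally show ?thesis by (simp add: degree_bound_def)
qed

text \<open>The image of a convergent sequence of codes: prefixes of \<open>\<omega>\<close> continued arbitrarily.\<close>

lemma prefix_maps_tendsto:
  assumes \<omega>: "\<And>n. \<omega> n \<in> S"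
  shows "(\<lambda>n. word_map F (map \<omega> [0..<n]) x) \<longlonglongrightarrow> \<kappa> \<omega>"
proof -
  obtain \<eta> where \<eta>: "\<And>n. \<eta> n \<in> S" "\<kappa> \<eta> = x" using coding_surj[of x] by blast
  let ?s = "\<lambda>n. word_seq (map \<omega> [0..<n]) \<eta>"
  have pre: "map \<omega> [0..<n] \<in> lists S" for n using \<omega> by (auto simp: in_lists_conv_set)
  have lim: "limitin (shift_space S) ?s \<omega> sequentially"
    unfolding shift_space_def limitin_componentwise
  proof (intro conjI ballI)
    show "\<forall>\<^sub>F n in sequentially. ?s n \<in> topspace (product_topology (\<lambda>_. discrete_topology S) UNIV)"
      using word_seq_in[OF pre] \<eta> by (simp add: PiE_UNIV_domain Pi_def)
    fix k :: nat
    have "\<forall>\<^sub>F n in sequentially. ?s n k = \<omega> k"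
      using eventually_gt_at_top[of k] by eventually_elim (simp add: word_seq_nth)
    then show "limitin (discrete_topology S) (\<lambda>n. ?s n k) (\<omega> k) sequentially"
      using \<omega> by (intro limitin_eventually) auto
  qed auto
  have cont: "continuous_map (shift_space S) euclidean \<kappa>" using coding by (simp add: coding_map_def)
  have "limitin euclidean (\<kappa> \<circ> ?s) (\<kappa> \<omega>) sequentially"
    by (rule continuous_map_limit[OF cont lim])
  hence "(\<lambda>n. \<kappa> (?s n)) \<longlonglongrightarrow> \<kappa> \<omega>" by (simp add: o_def)
  moreover have "\<kappa> (?s n) = word_map F (map \<omega> [0..<n]) x" for n
    using coding_word[OF pre \<eta>(1)] \<eta>(2) by simp
  ultimately show ?thesis by simp
qed

lemma glue_continuous:
  assumes P: "word_partition S P"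
    and g: "\<And>w. w \<in> P \<Longrightarrow> continuous_on UNIV (g w :: 'a \<Rightarrow> real)"
    and compat: "\<And>w v a b. w \<in> P \<Longrightarrow> v \<in> P \<Longrightarrow> word_map F w a = word_map F v b \<Longrightarrow> g w a = g v b"
  shows "\<exists>u. continuous_on UNIV u \<and> (\<forall>w\<in>P. u \<circ> word_map F w = g w)"
proof -
  have fin: "finite P" using word_partition_finite[OF P finite_S] .
  have PS: "w \<in> lists S" if "w \<in> P" for w using word_partition_lists[OF P] that by auto
  obtain cw where cw: "\<And>x. cw x \<in> P" "\<And>x. x \<in> cell (cw x)" using cells_cover[OF P] by metis
  define u where "u x = g (cw x) (inv (word_map F (cw x)) x)" for x
  have u: "u (word_map F w a) = g w a" if w: "w \<in> P" for w a
  proof -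
    let ?x = "word_map F w a"
    have "word_map F w a = word_map F (cw ?x) (inv (word_map F (cw ?x)) ?x)"
      using f_inv_into_f[OF cw(2)[of ?x]] by (rule sym)
    from compat[OF w cw(1) this] show ?thesis unfolding u_def by (rule sym)
  qed
  have "continuous_on (\<Union>w\<in>P. cell w) u"
  proof (rule continuous_on_closed_Union[OF fin])
    fix w assume w: "w \<in> P"
    have cont: "continuous_on UNIV (word_map F w)" and inj: "inj (word_map F w)"
      using word_map_continuous word_map_inj PS[OF w] by auto
    show "closed (cell w)"
      using compact_continuous_image[OF cont compact_space] by (rule compact_imp_closed)
    have "continuous_on (cell w) (inv (word_map F w))"
      using inj by (intro continuous_on_inv[OF cont compact_space]) simp
    hence "continuous_on (cell w) (g w \<circ> inv (word_map F w))"
      using g[OF w] by (intro continuous_on_compose) (auto intro: continuous_on_subset)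
    moreover have "(g w \<circ> inv (word_map F w)) x = u x" if x: "x \<in> cell w" for x
    proof -
      obtain a where a: "x = word_map F w a" using x by auto
      have "inv (word_map F w) x = a" unfolding a by (rule inv_f_f[OF inj])
      then show ?thesis using u[OF w, of a] a by simp
    qed
    ultimately show "continuous_on (cell w) u" using continuous_on_eq by blast
  qed
  moreover have "(\<Union>w\<in>P. cell w) = UNIV"
    by (intro set_eqI iffI UNIV_I) (use cells_cover[OF P] in \<open>simp only: UN_iff\<close>)
  ultimately have "continuous_on UNIV u" by simp
  moreover have "u \<circ> word_map F w = g w" if "w \<in> P" for w using u[OF that] by (intro ext) simp
  ultimately show ?thesis by blast
qed

end

section \<open>Self-similar energy: scaling, interpolation, local geometry\<close>

locale pcf_energy = p_form p \<E> \<F> + pcf_structure S F \<kappa>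
  for p :: real and \<E> :: "('a::metric_space \<Rightarrow> real) \<Rightarrow> real" and \<F> :: "('a \<Rightarrow> real) set"
    and S :: "'i set" and F :: "'i \<Rightarrow> 'a \<Rightarrow> 'a" and \<kappa> :: "(nat \<Rightarrow> 'i) \<Rightarrow> 'a" +
  fixes \<rho> :: "'i \<Rightarrow> real" and df :: real and m :: "'a measure"
  assumes self_similar_form: "self_similar_p_resistance_form p S F \<rho> \<E> \<F>"
    and rho_gt_1: "\<And>i. i \<in> S \<Longrightarrow> 1 < \<rho> i"
    and df_pos: "0 < df"
    and self_similar_m: "self_similar_measure S F (\<lambda>i. \<rho> i powr (- df / (p - 1))) m"
begin

definition \<alpha> :: real where "\<alpha> = df / (p - 1)"

definition rho_max :: real where "rho_max = Max (\<rho> ` S)"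

definition mass :: "'i list \<Rightarrow> real" where "mass w = weight \<rho> w powr - \<alpha>"

lemma p_pos: "0 < p" and p_ge_1: "1 \<le> p"
  using p_gt_1 by auto

lemma alpha_pos: "0 < \<alpha>"
  using df_pos p_gt_1 by (simp add: \<alpha>_def)

lemma rho_le_max: "i \<in> S \<Longrightarrow> \<rho> i \<le> rho_max"
  using finite_S by (auto simp: rho_max_def)

lemma rho_max_gt_1: "1 < rho_max"
  using S_nonempty rho_gt_1 rho_le_max by force

lemma partition_of_weight:
  assumes "1 \<le> t"
  obtains P where "word_partition S P"
    "\<And>w. w \<in> P \<Longrightarrow> t \<le> weight \<rho> w" "\<And>w. w \<in> P \<Longrightarrow> weight \<rho> w \<le> rho_max * t"
  using ex_word_partition_of_weight[OF finite_S S_nonempty _ assms, of \<rho> rho_max] rho_gt_1 rho_le_max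
  by blast

lemma word_weight_pos: "w \<in> lists S \<Longrightarrow> 0 < weight \<rho> w"
proof (rule weight_pos)
  show "0 < \<rho> i" if "i \<in> S" for i using rho_gt_1[OF that] by linarith
qed

lemma form_continuous: "u \<in> \<F> \<Longrightarrow> continuous_on UNIV u"
  using self_similar_form by (auto simp: self_similar_p_resistance_form_def)

lemma form_measurable: "u \<in> \<F> \<Longrightarrow> u \<in> borel_measurable borel"
  using form_continuous by (intro borel_measurable_continuous_onI) auto

lemma form_eq: "\<F> = {u. continuous_on UNIV u \<and> (\<forall>i\<in>S. u \<circ> F i \<in> \<F>)}"
  using self_similar_form unfolding self_similar_p_resistance_form_def by blast

lemma energy_split: "u \<in> \<F> \<Longrightarrow> \<E> u = (\<Sum>i\<in>S. \<rho> i * \<E> (u \<circ> F i))"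
  using self_similar_form unfolding self_similar_p_resistance_form_def by blast

lemma comp_letter_in: "u \<in> \<F> \<Longrightarrow> i \<in> S \<Longrightarrow> u \<circ> F i \<in> \<F>"
  using form_eq by blast

lemma comp_word_Cons: "u \<circ> word_map F (i # w) = (u \<circ> F i) \<circ> word_map F w"
  by (simp add: o_assoc)

lemma comp_word_in: "u \<in> \<F> \<Longrightarrow> w \<in> lists S \<Longrightarrow> u \<circ> word_map F w \<in> \<F>"
proof (induction w arbitrary: u)
  case (Cons i w)
  then show ?case unfolding comp_word_Cons by (intro Cons.IH comp_letter_in) auto
qed auto

lemma in_form_partition:
  assumes "word_partition S P" "continuous_on UNIV u" "\<And>w. w \<in> P \<Longrightarrow> u \<circ> word_map F w \<in> \<F>"
  shows "u \<in> \<F>"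
  using assms
proof (induction arbitrary: u rule: word_partition.induct)
  case root
  then show ?case by simp
next
  case (split P)
  have "u \<circ> F i \<in> \<F>" if i: "i \<in> S" for i
  proof (rule split.IH[OF i])
    have "continuous_on UNIV (F i)" using self_similar i by (auto simp: self_similar_structure_def)
    then show "continuous_on UNIV (u \<circ> F i)"
      using split.prems(1) by (intro continuous_on_compose) (auto intro: continuous_on_subset)
    show "u \<circ> F i \<circ> word_map F w \<in> \<F>" if "w \<in> P i" for w
    proof -
      have "i # w \<in> (\<Union>i\<in>S. (#) i ` P i)" using that i by blast
      from split.prems(2)[OF this] show ?thesis unfolding comp_word_Cons .
    qed
  qed
  then show ?case using split.prems(1) form_eq by blast
qed

lemma energy_partition:
  assumes "word_partition S P" "u \<in> \<F>"
  shows "\<E> u = (\<Sum>w\<in>P. weight \<rho> w * \<E> (u \<circ> word_map F w))"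
  using assms
proof (induction arbitrary: u rule: word_partition.induct)
  case root
  then show ?case by simp
next
  case (split P)
  have fin: "\<And>i. i \<in> S \<Longrightarrow> finite (P i)" using split.hyps word_partition_finite finite_S by blast
  have "\<E> u = (\<Sum>i\<in>S. \<rho> i * \<E> (u \<circ> F i))" by (rule energy_split[OF split.prems])
  also have "\<dots> = (\<Sum>i\<in>S. \<Sum>w\<in>P i. weight \<rho> (i # w) * \<E> (u \<circ> word_map F (i # w)))"
  proof (rule sum.cong[OF refl])
    fix i assume i: "i \<in> S"
    show "\<rho> i * \<E> (u \<circ> F i) = (\<Sum>w\<in>P i. weight \<rho> (i # w) * \<E> (u \<circ> word_map F (i # w)))"
      unfolding split.IH[OF i comp_letter_in[OF split.prems i]] comp_word_Cons sum_distrib_left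
      by (simp add: mult.assoc)
  qed
  also have "\<dots> = (\<Sum>w\<in>(\<Union>i\<in>S. (#) i ` P i). weight \<rho> w * \<E> (u \<circ> word_map F w))"
    by (rule sum_word_partition_split[symmetric, OF finite_S fin])
  finally show ?case .
qed

lemma energy_word_le:
  "u \<in> \<F> \<Longrightarrow> w \<in> lists S \<Longrightarrow> weight \<rho> w * \<E> (u \<circ> word_map F w) \<le> \<E> u"
proof (induction w arbitrary: u)
  case (Cons i w)
  hence i: "i \<in> S" and w: "w \<in> lists S" by auto
  have r: "0 < \<rho> j" if "j \<in> S" for j using rho_gt_1[OF that] by linarith
  have "weight \<rho> (i # w) * \<E> (u \<circ> word_map F (i # w)) = \<rho> i * (weight \<rho> w * \<E> ((u \<circ> F i) \<circ> word_map F w))"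
    unfolding comp_word_Cons by simp
  also have "\<dots> \<le> \<rho> i * \<E> (u \<circ> F i)"
    using r[OF i] by (intro mult_left_mono Cons.IH comp_letter_in Cons.prems i w less_imp_le)
  also have "\<dots> \<le> (\<Sum>j\<in>S. \<rho> j * \<E> (u \<circ> F j))"
  proof (rule member_le_sum[OF i _ finite_S])
    fix j assume "j \<in> S - {i}"
    then show "0 \<le> \<rho> j * \<E> (u \<circ> F j)"
      using comp_letter_in[OF Cons.prems(1)] energy_nonneg r by (intro mult_nonneg_nonneg) (auto intro: less_imp_le)
  qed
  also have "\<dots> = \<E> u" using energy_split[OF Cons.prems(1)] by simp
  finally show ?case .
qed simp

text \<open>
  A point is the limit of the images of a base point under the maps of its code prefixes.  Consecutive
  images differ, as measured by \<open>u\<close>, by a geometrically decreasing multiple of the energy norm of \<open>u\<close>.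
\<close>

lemma oscillation_bound:
  "\<exists>\<Delta>. \<forall>u\<in>\<F>. \<forall>x y. \<bar>u x - u y\<bar> \<le> \<Delta> * energy_norm u"
proof -
  define z :: 'a where "z = undefined"
  define D where "D = (\<Sum>i\<in>S. Res (F i z) z powr (1 / p))"
  define l where "l = (1 / Min (\<rho> ` S)) powr (1 / p)"
  have min: "1 < Min (\<rho> ` S)" "\<And>i. i \<in> S \<Longrightarrow> Min (\<rho> ` S) \<le> \<rho> i"
    using finite_S S_nonempty rho_gt_1 by auto
  have l: "0 < l" "l < 1"
    using min(1) p_pos powr_less_mono2[of "1 / p" "1 / Min (\<rho> ` S)" 1] by (auto simp: l_def)
  have D0: "0 \<le> D" unfolding D_def by (intro sum_nonneg) auto
  have norm_word: "energy_norm (u \<circ> word_map F w) \<le> l ^ length w * energy_norm u"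
    if u: "u \<in> \<F>" and w: "w \<in> lists S" for u w
  proof -
    have wt: "Min (\<rho> ` S) ^ length w \<le> weight \<rho> w" using w
    proof (induction w)
      case (Cons i w)
      then show ?case using min(1) min(2)[of i] by (auto intro!: mult_mono)
    qed simp
    have "Min (\<rho> ` S) ^ length w * \<E> (u \<circ> word_map F w) \<le> weight \<rho> w * \<E> (u \<circ> word_map F w)"
      using wt energy_nonneg[OF comp_word_in[OF u w]] by (intro mult_right_mono)
    also have "\<dots> \<le> \<E> u" by (rule energy_word_le[OF u w])
    finally have "\<E> (u \<circ> word_map F w) \<le> (1 / Min (\<rho> ` S)) ^ length w * \<E> u"
      using min(1) by (simp add: field_simps power_one_over)
    hence "energy_norm (u \<circ> word_map F w) \<le> ((1 / Min (\<rho> ` S)) ^ length w * \<E> u) powr (1 / p)"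
      unfolding energy_norm_def using p_pos energy_nonneg[OF comp_word_in[OF u w]]
      by (intro powr_mono2) auto
    also have "\<dots> = l ^ length w * energy_norm u"
      unfolding l_def energy_norm_def using min(1) energy_nonneg[OF u]
      by (simp add: powr_mult powr_power powr_realpow[symmetric] powr_powr mult.commute)
    finally show ?thesis .
  qed
  have base: "\<bar>u x - u z\<bar> \<le> D / (1 - l) * energy_norm u" if u: "u \<in> \<F>" for u x
  proof -
    obtain \<omega> where \<omega>: "\<And>n. \<omega> n \<in> S" "\<kappa> \<omega> = x" using coding_surj[of x] by blast
    define X where "X n = word_map F (map \<omega> [0..<n]) z" for n
    have pre: "map \<omega> [0..<n] \<in> lists S" for n using \<omega> by (auto simp: in_lists_conv_set)
    have step: "\<bar>u (X (Suc n)) - u (X n)\<bar> \<le> D * energy_norm u * l ^ n" for n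
    proof -
      let ?v = "u \<circ> word_map F (map \<omega> [0..<n])"
      have v: "?v \<in> \<F>" by (rule comp_word_in[OF u pre])
      have "\<bar>u (X (Suc n)) - u (X n)\<bar> = \<bar>?v (F (\<omega> n) z) - ?v z\<bar>"
        by (simp add: X_def word_map_append)
      also have "\<dots> = (\<bar>?v (F (\<omega> n) z) - ?v z\<bar> powr p) powr (1 / p)"
        using p_pos by (simp add: powr_powr)
      also have "\<dots> \<le> (Res (F (\<omega> n) z) z * \<E> ?v) powr (1 / p)"
        using p_pos by (intro powr_mono2 diff_le_Res v) auto
      also have "\<dots> = Res (F (\<omega> n) z) z powr (1 / p) * energy_norm ?v"
        unfolding energy_norm_def by (simp add: powr_mult)
      also have "\<dots> \<le> D * (l ^ n * energy_norm u)"
      proof (intro mult_mono)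
        show "Res (F (\<omega> n) z) z powr (1 / p) \<le> D"
          unfolding D_def using \<omega>(1) finite_S by (intro member_le_sum) auto
        show "energy_norm ?v \<le> l ^ n * energy_norm u" using norm_word[OF u pre[of n]] by simp
      qed (auto simp: D0 norm_nonneg)
      finally show ?thesis by (simp add: mult_ac)
    qed
    have part: "\<bar>u (X n) - u z\<bar> \<le> D * energy_norm u * (\<Sum>k<n. l ^ k)" for n
    proof (induction n)
      case (Suc n)
      have "\<bar>u (X (Suc n)) - u z\<bar> \<le> \<bar>u (X (Suc n)) - u (X n)\<bar> + \<bar>u (X n) - u z\<bar>" by linarith
      then show ?case using Suc step[of n] by (simp add: distrib_left)
    qed (simp add: X_def)
    have bound: "\<bar>u (X n) - u z\<bar> \<le> D / (1 - l) * energy_norm u" for n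
    proof -
      have "(\<Sum>k<n. l ^ k) = (1 - l ^ n) / (1 - l)" using l by (simp add: sum_gp_strict)
      also have "\<dots> \<le> 1 / (1 - l)" using l by (intro divide_right_mono) auto
      finally have "D * energy_norm u * (\<Sum>k<n. l ^ k) \<le> D * energy_norm u * (1 / (1 - l))"
        using D0 norm_nonneg by (intro mult_left_mono mult_nonneg_nonneg)
      then show ?thesis using part[of n] by simp
    qed
    have "X \<longlonglongrightarrow> x" unfolding X_def using prefix_maps_tendsto[of \<omega> z] \<omega> by simp
    moreover have "isCont u x" using form_continuous[OF u] by (simp add: continuous_on_eq_continuous_at)
    ultimately have "(\<lambda>n. u (X n)) \<longlonglongrightarrow> u x" by (rule isCont_tendsto_compose[rotated])
    hence "(\<lambda>n. \<bar>u (X n) - u z\<bar>) \<longlonglongrightarrow> \<bar>u x - u z\<bar>" by (intro tendsto_intros)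
    then show ?thesis by (rule LIMSEQ_le_const2) (use bound in blast)
  qed
  have "\<bar>u x - u y\<bar> \<le> 2 * (D / (1 - l)) * energy_norm u" if u: "u \<in> \<F>" for u x y
    using base[OF u, of x] base[OF u, of y] by linarith
  then show ?thesis by blast
qed

definition \<Delta> :: real where
  "\<Delta> = (SOME \<Delta>. \<forall>u\<in>\<F>. \<forall>x y. \<bar>u x - u y\<bar> \<le> \<Delta> * energy_norm u)"

lemma oscillation: "u \<in> \<F> \<Longrightarrow> \<bar>u x - u y\<bar> \<le> \<Delta> * energy_norm u"
  using someI_ex[OF oscillation_bound] unfolding \<Delta>_def by blast

lemma oscillation_powr:
  assumes "u \<in> \<F>"
  shows "\<bar>u x - u y\<bar> powr p \<le> \<Delta> powr p * \<E> u"
proof -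
  have "\<bar>u x - u y\<bar> powr p \<le> (\<Delta> * energy_norm u) powr p"
    using oscillation[OF assms] p_pos by (intro powr_mono2) auto
  also have "\<dots> = \<Delta> powr p * \<E> u"
    by (simp add: powr_mult energy_eq[OF assms])
  finally show ?thesis .
qed

lemma neighbour_difference:
  assumes P: "word_partition S P" "w \<in> P" "v \<in> neighbours P w" and u: "u \<in> \<F>"
    and xy: "x \<in> cell w" "y \<in> cell v"
  shows "\<bar>u x - u y\<bar> powr p
    \<le> (2 * \<Delta>) powr p * (\<E> (u \<circ> word_map F w) + \<E> (u \<circ> word_map F v))"
proof -
  have l: "w \<in> lists S" "v \<in> lists S" using word_partition_lists[OF P(1)] P neighbours_subset by blast+
  obtain a b c d where *: "x = word_map F w a" "y = word_map F v b" "word_map F w c = word_map F v d"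
    using xy P(3) by (auto simp: neighbours_def)
  have "\<bar>u x - u y\<bar> powr p = \<bar>(u x - u (word_map F w c)) + (u (word_map F v d) - u y)\<bar> powr p"
    using * by simp
  also have "\<dots> \<le> 2 powr p * (\<bar>(u \<circ> word_map F w) a - (u \<circ> word_map F w) c\<bar> powr p
      + \<bar>(u \<circ> word_map F v) d - (u \<circ> word_map F v) b\<bar> powr p)"
    using abs_add_powr_le[OF p_pos, of "u x - u (word_map F w c)" "u (word_map F v d) - u y"]
    by (simp add: *)
  also have "\<dots> \<le> 2 powr p * (\<Delta> powr p * \<E> (u \<circ> word_map F w) + \<Delta> powr p * \<E> (u \<circ> word_map F v))"
    by (intro mult_left_mono add_mono oscillation_powr comp_word_in u l) auto
  also have "\<dots> = (2 * \<Delta>) powr p * (\<E> (u \<circ> word_map F w) + \<E> (u \<circ> word_map F v))"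
    by (simp add: powr_mult distrib_left mult.assoc)
  finally show ?thesis .
qed

lemma Res_neighbours_le:
  assumes P: "word_partition S P" "w \<in> P" "v \<in> neighbours P w" and t: "0 < t" "\<And>w. w \<in> P \<Longrightarrow> t \<le> weight \<rho> w"
    and xy: "x \<in> cell w" "y \<in> cell v"
  shows "Res x y \<le> 2 * (2 * \<Delta>) powr p / t"
proof (rule Res_leI)
  fix u assume u: "u \<in> \<F>"
  have small: "\<E> (u \<circ> word_map F w) \<le> \<E> u / t" if "w \<in> P" for w
  proof -
    have l: "w \<in> lists S" using word_partition_lists[OF P(1)] that by auto
    have "t * \<E> (u \<circ> word_map F w) \<le> weight \<rho> w * \<E> (u \<circ> word_map F w)"
      using t(2)[OF that] energy_nonneg[OF comp_word_in[OF u l]] by (intro mult_right_mono)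
    also have "\<dots> \<le> \<E> u" by (rule energy_word_le[OF u l])
    finally show ?thesis using t by (simp add: field_simps)
  qed
  have v: "v \<in> P" using P(3) neighbours_subset by blast
  have "\<bar>u x - u y\<bar> powr p \<le> (2 * \<Delta>) powr p * (\<E> (u \<circ> word_map F w) + \<E> (u \<circ> word_map F v))"
    by (rule neighbour_difference[OF P u xy])
  also have "\<dots> \<le> (2 * \<Delta>) powr p * (\<E> u / t + \<E> u / t)"
    by (intro mult_left_mono add_mono small P v) auto
  finally show "\<bar>u x - u y\<bar> powr p \<le> 2 * (2 * \<Delta>) powr p / t * \<E> u"
    by (simp add: algebra_simps)
qed (use t in auto)

definition hat :: "'a \<Rightarrow> 'a \<Rightarrow> real" where
  "hat q = (SOME h. h \<in> \<F> \<and> h q = 1 \<and> (\<forall>y\<in>V0 - {q}. h y = 0))"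

lemma hat: "hat q \<in> \<F>" "hat q q = 1" "y \<in> V0 \<Longrightarrow> y \<noteq> q \<Longrightarrow> hat q y = 0"
proof -
  have "hat q \<in> \<F> \<and> hat q q = 1 \<and> (\<forall>y\<in>V0 - {q}. hat q y = 0)"
    unfolding hat_def
    by (rule someI_ex[where P = "\<lambda>h. h \<in> \<F> \<and> h q = 1 \<and> (\<forall>y\<in>V0 - {q}. h y = 0)"])
      (use ex_hat[of "V0 - {q}" q] finite_V0 in blast)
  then show "hat q \<in> \<F>" "hat q q = 1" "y \<in> V0 \<Longrightarrow> y \<noteq> q \<Longrightarrow> hat q y = 0" by auto
qed

definition hat_bound :: "'a \<Rightarrow> real" where
  "hat_bound q = (1 + \<Delta> * energy_norm (hat q)) powr p + \<E> (hat q)"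

definition interp_const :: real where
  "interp_const = real (card V0) powr p * (\<Sum>q\<in>V0. hat_bound q) + 1"

definition vertex_deviation :: "('a \<Rightarrow> real) \<Rightarrow> 'i list \<Rightarrow> real \<Rightarrow> real" where
  "vertex_deviation val w c = (\<Sum>q\<in>V0. \<bar>val (word_map F w q) - c\<bar> powr p)"

lemma hat_bound_nonneg: "0 \<le> hat_bound q"
  unfolding hat_bound_def using energy_nonneg[OF hat(1)] by simp

lemma hat_le: "\<bar>hat q x\<bar> powr p \<le> hat_bound q"
proof -
  have "\<bar>hat q x\<bar> \<le> 1 + \<Delta> * energy_norm (hat q)"
    using oscillation[OF hat(1), of q x q] hat(2)[of q] by linarith
  hence "\<bar>hat q x\<bar> powr p \<le> (1 + \<Delta> * energy_norm (hat q)) powr p"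
    using p_pos by (intro powr_mono2) auto
  then show ?thesis unfolding hat_bound_def using energy_nonneg[OF hat(1), of q] by linarith
qed

lemma interp_const_pos: "0 < interp_const"
  unfolding interp_const_def using hat_bound_nonneg
  by (intro add_nonneg_pos mult_nonneg_nonneg sum_nonneg) auto

lemma hat_combination_le:
  fixes d b :: "'a \<Rightarrow> real"
  assumes b: "\<And>q. 0 \<le> b q" "\<And>q. b q powr p \<le> hat_bound q"
  shows "(\<Sum>q\<in>V0. \<bar>d q\<bar> * b q) powr p \<le> interp_const * (\<Sum>q\<in>V0. \<bar>d q\<bar> powr p)"
proof -
  have "(\<Sum>q\<in>V0. \<bar>d q\<bar> * b q) powr p \<le> real (card V0) powr p * (\<Sum>q\<in>V0. (\<bar>d q\<bar> * b q) powr p)"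
    using finite_V0 b p_pos by (intro powr_sum_le) auto
  also have "\<dots> \<le> real (card V0) powr p * (\<Sum>q\<in>V0. \<bar>d q\<bar> powr p * (\<Sum>q\<in>V0. hat_bound q))"
  proof (intro mult_left_mono sum_mono)
    fix q assume q: "q \<in> V0"
    have "b q powr p \<le> (\<Sum>q\<in>V0. hat_bound q)"
      using b(2)[of q] member_le_sum[of q V0 hat_bound] q finite_V0 hat_bound_nonneg by fastforce
    then show "(\<bar>d q\<bar> * b q) powr p \<le> \<bar>d q\<bar> powr p * (\<Sum>q\<in>V0. hat_bound q)"
      using b by (simp add: powr_mult mult_left_mono)
  qed auto
  also have "\<dots> = real (card V0) powr p * (\<Sum>q\<in>V0. hat_bound q) * (\<Sum>q\<in>V0. \<bar>d q\<bar> powr p)"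
    by (simp add: sum_distrib_right[symmetric] mult_ac)
  also have "\<dots> \<le> interp_const * (\<Sum>q\<in>V0. \<bar>d q\<bar> powr p)"
    unfolding interp_const_def by (intro mult_right_mono sum_nonneg) auto
  finally show ?thesis .
qed

text \<open>
  Piecewise interpolation of vertex values.  On each cell the interpolant is an affine combination of
  the finitely many rescaled hat functions; the pieces fit together because two cells meet in vertices
  only.  Both estimates are relative to an arbitrary reference value \<open>c w\<close> on each cell, so where the
  vertex values are equal to \<open>c w\<close>, the interpolant is constant.
\<close>

lemma interpolation:
  assumes P: "word_partition S P"
  obtains u where "u \<in> \<F>" "\<And>w. w \<in> P \<Longrightarrow> \<E> (u \<circ> word_map F w) \<le> interp_const * vertex_deviation val w (c w)"
    "\<And>w x. w \<in> P \<Longrightarrow> \<bar>u (word_map F w x) - c w\<bar> powr p \<le> interp_const * vertex_deviation val w (c w)"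
proof -
  define s where "s w x = (\<Sum>q\<in>V0. (val (word_map F w q) - c w) * hat q x)" for w x
  define g where "g w x = c w + s w x" for w x
  have sF: "s w \<in> \<F>" for w
    unfolding s_def[abs_def] by (intro sum_in scale_in hat)
  have gF: "g w \<in> \<F>" for w unfolding g_def[abs_def] by (intro add_in const_in sF)
  have g_vertex: "g w a = val (word_map F w a)" if "a \<in> V0" for w a
  proof -
    have "s w a = (\<Sum>q\<in>V0. if q = a then val (word_map F w a) - c w else 0)"
      unfolding s_def using hat(2) hat(3)[OF that] by (intro sum.cong) auto
    also have "\<dots> = val (word_map F w a) - c w" using that finite_V0 by simp
    finally show ?thesis by (simp add: g_def)
  qed
  have compat: "g w a = g v b" if "w \<in> P" "v \<in> P" "word_map F w a = word_map F v b" for w v a b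
  proof (cases "w = v")
    case True
    have "w \<in> lists S" using that word_partition_lists[OF P] by auto
    from injD[OF word_map_inj[OF this]] have "a = b" using that(3) True by blast
    then show ?thesis using True by simp
  next
    case False
    have "a \<in> V0" using cells_meet_in_boundary[OF P that(1,2) False that(3)] .
    moreover have "b \<in> V0" using cells_meet_in_boundary[OF P that(2,1) _ that(3)[symmetric]] False by simp
    ultimately show ?thesis using g_vertex that(3) by simp
  qed
  obtain u where u: "continuous_on UNIV u" "\<And>w. w \<in> P \<Longrightarrow> u \<circ> word_map F w = g w"
    using glue_continuous[OF P, of g] form_continuous[OF gF] compat by blast
  have uF: "u \<in> \<F>" using in_form_partition[OF P u(1)] u(2) gF by simp
  have "\<E> (u \<circ> word_map F w) \<le> interp_const * vertex_deviation val w (c w)" if w: "w \<in> P" for w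
  proof -
    let ?d = "\<lambda>q. val (word_map F w q) - c w"
    have "energy_norm (g w) \<le> energy_norm (\<lambda>_. c w) + energy_norm (s w)"
      unfolding g_def[abs_def] by (rule norm_add[OF const_in sF])
    also have "\<dots> = energy_norm (s w)" by (simp add: norm_const)
    also have "\<dots> \<le> (\<Sum>q\<in>V0. energy_norm (\<lambda>x. ?d q * hat q x))"
      unfolding s_def[abs_def] by (intro norm_sum scale_in hat)
    also have "\<dots> = (\<Sum>q\<in>V0. \<bar>?d q\<bar> * energy_norm (hat q))" by (simp add: norm_scale[OF hat(1)])
    finally have "energy_norm (g w) powr p \<le> (\<Sum>q\<in>V0. \<bar>?d q\<bar> * energy_norm (hat q)) powr p"
      using p_pos norm_nonneg by (intro powr_mono2) auto
    also have "\<dots> \<le> interp_const * vertex_deviation val w (c w)"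
      unfolding vertex_deviation_def
      by (rule hat_combination_le) (auto simp: norm_nonneg hat_bound_def energy_eq[OF hat(1)])
    finally show ?thesis unfolding u(2)[OF w] energy_eq[OF gF] .
  qed
  moreover have "\<bar>u (word_map F w x) - c w\<bar> powr p \<le> interp_const * vertex_deviation val w (c w)"
    if w: "w \<in> P" for w x
  proof -
    let ?d = "\<lambda>q. val (word_map F w q) - c w"
    have "u (word_map F w x) = g w x" using fun_cong[OF u(2)[OF w], of x] by simp
    hence "\<bar>u (word_map F w x) - c w\<bar> = \<bar>\<Sum>q\<in>V0. ?d q * hat q x\<bar>" by (simp add: g_def s_def)
    also have "\<dots> \<le> (\<Sum>q\<in>V0. \<bar>?d q\<bar> * \<bar>hat q x\<bar>)"
      by (rule order.trans[OF sum_abs]) (simp add: abs_mult)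
    finally have "\<bar>u (word_map F w x) - c w\<bar> powr p \<le> (\<Sum>q\<in>V0. \<bar>?d q\<bar> * \<bar>hat q x\<bar>) powr p"
      using p_pos by (intro powr_mono2) auto
    also have "\<dots> \<le> interp_const * vertex_deviation val w (c w)"
      unfolding vertex_deviation_def by (rule hat_combination_le) (auto simp: hat_le)
    finally show ?thesis .
  qed
  ultimately show ?thesis using uF that by blast
qed

text \<open>
  Up to the factor \<open>t\<close>, a bound for the energy of the function that separates a cell of weight about \<open>t\<close>
  from the cells not meeting it.
\<close>

definition sep :: real where
  "sep = 1 + real degree_bound * (rho_max * (interp_const * real (card V0)))"

lemma sep_ge_1: "1 \<le> sep"
  using interp_const_pos rho_max_gt_1 by (simp add: sep_def)

text \<open>
  The interpolant that is \<open>1\<close> on a cell and \<open>0\<close> on every cell not meeting it has energy at most of the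
  order \<open>t\<close>, which bounds from below the resistance between points of cells that do not meet.
\<close>

lemma Res_separated_cells:
  assumes P: "word_partition S P" and t: "0 < t" "\<And>w. w \<in> P \<Longrightarrow> weight \<rho> w \<le> rho_max * t"
    and w: "w \<in> P" and v: "v \<in> P" "v \<notin> neighbours P w" and xy: "x \<in> cell w" "y \<in> cell v"
  shows "1 \<le> sep * t * Res x y"
proof -
  \<comment> \<open>Vertices in the cell of \<open>w\<close> get the value \<open>1\<close>, all others \<open>0\<close>.\<close>
  define val :: "'a \<Rightarrow> real" where "val = indicator (cell w)"
  define c :: "'i list \<Rightarrow> real" where "c v = (if v = w then 1 else 0)" for v
  define s where "s v = vertex_deviation val v (c v)" for v
  obtain u where u: "u \<in> \<F>" "\<And>v. v \<in> P \<Longrightarrow> \<E> (u \<circ> word_map F v) \<le> interp_const * s v"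
    "\<And>v x. v \<in> P \<Longrightarrow> \<bar>u (word_map F v x) - c v\<bar> powr p \<le> interp_const * s v"
    unfolding s_def by (rule interpolation[OF P, of val c]) blast
  have s_far: "s v = 0" if "v \<in> P" "v \<notin> neighbours P w \<or> v = w" for v
  proof -
    have "val (word_map F v q) = c v" for q
      using that w self_neighbour[OF w] by (auto simp: val_def c_def neighbours_def indicator_def)
    then show ?thesis by (simp add: s_def vertex_deviation_def)
  qed
  have s_le: "s v \<le> real (card V0)" for v
  proof -
    have "\<bar>val z - c v\<bar> \<le> 1" for z by (auto simp: val_def c_def indicator_def)
    hence "\<bar>val z - c v\<bar> powr p \<le> 1 powr p" for z using p_pos by (intro powr_mono2) auto
    hence "s v \<le> (\<Sum>q\<in>V0. 1)" unfolding s_def vertex_deviation_def by (intro sum_mono) auto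
    then show ?thesis by simp
  qed
  have u_val: "u z = c v'" if "v' \<in> P" "v' \<notin> neighbours P w \<or> v' = w" "z \<in> cell v'" for v' z
    using u(3)[OF that(1)] s_far[OF that(1,2)] that(3) by auto
  have ux: "u x = 1" using u_val[of w x] w xy by (simp add: c_def)
  have uy: "u y = 0" using u_val[of v y] v xy self_neighbour[OF w] by (auto simp: c_def)
  have fin: "finite P" by (rule word_partition_finite[OF P finite_S])
  have "\<E> u = (\<Sum>v\<in>P. weight \<rho> v * \<E> (u \<circ> word_map F v))" by (rule energy_partition[OF P u(1)])
  also have "\<dots> \<le> (\<Sum>v\<in>P. if v \<in> neighbours P w then rho_max * t * (interp_const * real (card V0)) else 0)"
  proof (rule sum_mono)
    fix v assume v: "v \<in> P"
    have l: "v \<in> lists S" using word_partition_lists[OF P] v by auto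
    have "weight \<rho> v * \<E> (u \<circ> word_map F v) \<le> rho_max * t * (interp_const * s v)"
      using t rho_max_gt_1 word_weight_pos[OF l]
      by (intro mult_mono u t v energy_nonneg comp_word_in l) auto
    also have "\<dots> \<le> (if v \<in> neighbours P w then rho_max * t * (interp_const * real (card V0)) else 0)"
      using s_far[OF v] s_le[of v] interp_const_pos t rho_max_gt_1 by (auto intro!: mult_left_mono)
    finally show "weight \<rho> v * \<E> (u \<circ> word_map F v)
        \<le> (if v \<in> neighbours P w then rho_max * t * (interp_const * real (card V0)) else 0)" .
  qed
  also have "\<dots> = real (card (neighbours P w)) * (rho_max * t * (interp_const * real (card V0)))"
    using fin neighbours_subset by (simp add: sum.inter_restrict[symmetric] Int_absorb1)
  also have "\<dots> \<le> real degree_bound * (rho_max * t * (interp_const * real (card V0)))"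
    using card_neighbours[OF P w] interp_const_pos t rho_max_gt_1 by (intro mult_right_mono) auto
  also have "\<dots> \<le> sep * t" using t by (simp add: sep_def algebra_simps)
  finally have E: "\<E> u \<le> sep * t" .
  have "1 \<le> Res x y * \<E> u" using diff_le_Res[OF u(1), of x y] ux uy by simp
  also have "\<dots> \<le> Res x y * (sep * t)" using E Res_nonneg by (intro mult_left_mono)
  finally show ?thesis by (simp add: mult_ac)
qed

end

context pcf_energy
begin

section \<open>The self-similar measure: cells and resistance balls\<close>

lemma sets_m [measurable_cong]: "sets m = sets borel" and prob_m: "prob_space m"
  using self_similar_m by (auto simp: self_similar_measure_def)

sublocale prob_space m by (rule prob_m)

lemma space_m: "space m = UNIV"
  using sets_eq_imp_space_eq[OF sets_m] by simp

lemma letter_map_measurable: "i \<in> S \<Longrightarrow> F i \<in> m \<rightarrow>\<^sub>M m"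
proof -
  assume "i \<in> S"
  hence "continuous_on UNIV (F i)" using self_similar by (auto simp: self_similar_structure_def)
  then show ?thesis
    by (subst measurable_cong_sets[OF sets_m sets_m]) (rule borel_measurable_continuous_onI)
qed

lemma word_map_measurable: "w \<in> lists S \<Longrightarrow> word_map F w \<in> m \<rightarrow>\<^sub>M m"
  by (subst measurable_cong_sets[OF sets_m sets_m])
    (intro borel_measurable_continuous_onI word_map_continuous)

lemma form_measurable_m: "u \<in> \<F> \<Longrightarrow> u \<in> borel_measurable m"
  using form_measurable by (simp add: measurable_cong_sets[OF sets_m refl])

lemma nn_integral_letters:
  assumes g: "g \<in> borel_measurable m"
  shows "(\<integral>\<^sup>+x. g x \<partial>m) = (\<Sum>i\<in>S. ennreal (\<rho> i powr - \<alpha>) * (\<integral>\<^sup>+x. g (F i x) \<partial>m))"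
proof -
  let ?R = "\<lambda>g :: 'a \<Rightarrow> ennreal. \<Sum>i\<in>S. ennreal (\<rho> i powr - \<alpha>) * (\<integral>\<^sup>+x. g (F i x) \<partial>m)"
  have comp: "(\<lambda>x. h (F i x)) \<in> borel_measurable m" if "h \<in> borel_measurable m" "i \<in> S" for h :: "'a \<Rightarrow> ennreal" and i
    using measurable_compose[OF letter_map_measurable[OF that(2)] that(1)] .
  show ?thesis using g
  proof (induction rule: borel_measurable_induct)
    case (cong f g)
    have "f = g" by (rule ext) (simp add: cong(3) space_m)
    with cong show ?case by simp
  next
    case (set A)
    have A: "A \<in> sets borel" using set sets_m by simp
    have "emeasure (distr m borel (F i)) A = (\<integral>\<^sup>+x. indicator A (F i x) \<partial>m)" if i: "i \<in> S" for i
    proof -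
      have Fi: "F i \<in> borel_measurable m"
        using letter_map_measurable[OF i] by (simp add: measurable_cong_sets[OF refl sets_m])
      have "(\<integral>\<^sup>+x. indicator A (F i x) \<partial>m) = (\<integral>\<^sup>+x. indicator A x \<partial>distr m borel (F i))"
        using Fi A by (subst nn_integral_distr) auto
      then show ?thesis using A by simp
    qed
    moreover have "emeasure m A = (\<Sum>i\<in>S. ennreal (\<rho> i powr (- df / (p - 1))) * emeasure (distr m borel (F i)) A)"
      using self_similar_m A by (auto simp: self_similar_measure_def)
    ultimately show ?case using set by (simp add: \<alpha>_def)
  next
    case (mult u c)
    have "(\<integral>\<^sup>+x. c * u x \<partial>m) = c * ?R u"
      using mult by (simp add: nn_integral_cmult)
    also have "\<dots> = ?R (\<lambda>x. c * u x)"
      unfolding sum_distrib_left using comp[OF mult(2)]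
      by (intro sum.cong refl) (simp add: nn_integral_cmult mult_ac)
    finally show ?case .
  next
    case (add u v)
    have "(\<integral>\<^sup>+x. v x + u x \<partial>m) = ?R v + ?R u"
      using add by (simp add: nn_integral_add)
    also have "\<dots> = ?R (\<lambda>x. v x + u x)"
      unfolding sum.distrib[symmetric] using comp[OF add(1)] comp[OF add(3)]
      by (intro sum.cong refl) (simp add: nn_integral_add distrib_left)
    finally show ?case .
  next
    case (seq U)
    have sup: "Sup (range U) x = (SUP n. U n x)" for x by (simp add: image_image)
    have lim: "(\<lambda>n. U n x) \<longlonglongrightarrow> (SUP n. U n x)" for x
      using seq(3) by (intro LIMSEQ_SUP) (auto simp: incseq_def le_fun_def)
    have "(\<lambda>n. \<integral>\<^sup>+x. U n x \<partial>m) \<longlonglongrightarrow> (\<integral>\<^sup>+x. (SUP n. U n x) \<partial>m)"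
      using seq lim by (intro nn_integral_LIMSEQ) auto
    moreover have "(\<lambda>n. ?R (U n)) \<longlonglongrightarrow> ?R (\<lambda>x. SUP n. U n x)"
    proof (intro tendsto_sum ennreal_tendsto_cmult)
      fix i assume i: "i \<in> S"
      show "(\<lambda>n. \<integral>\<^sup>+x. U n (F i x) \<partial>m) \<longlonglongrightarrow> (\<integral>\<^sup>+x. (SUP n. U n (F i x)) \<partial>m)"
        using seq lim comp[OF _ i]
        by (intro nn_integral_LIMSEQ) (auto simp: incseq_def le_fun_def)
    qed auto
    ultimately have "(\<integral>\<^sup>+x. (SUP n. U n x) \<partial>m) = ?R (\<lambda>x. SUP n. U n x)"
      unfolding seq.IH by (rule LIMSEQ_unique)
    then show ?case unfolding sup .
  qed
qed

lemma mass_simps [simp]: "mass [] = 1" "mass (i # w) = \<rho> i powr - \<alpha> * mass w"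
  by (simp_all add: mass_def powr_mult)

lemma nn_integral_partition:
  assumes "word_partition S P" "g \<in> borel_measurable m"
  shows "(\<integral>\<^sup>+x. g x \<partial>m) = (\<Sum>w\<in>P. ennreal (mass w) * (\<integral>\<^sup>+x. g (word_map F w x) \<partial>m))"
  using assms
proof (induction arbitrary: g rule: word_partition.induct)
  case root
  then show ?case by simp
next
  case (split P)
  have fin: "\<And>i. i \<in> S \<Longrightarrow> finite (P i)" using split.hyps word_partition_finite finite_S by blast
  have "(\<integral>\<^sup>+x. g x \<partial>m) = (\<Sum>i\<in>S. ennreal (\<rho> i powr - \<alpha>) * (\<integral>\<^sup>+x. g (F i x) \<partial>m))"
    by (rule nn_integral_letters[OF split.prems])
  also have "\<dots> = (\<Sum>i\<in>S. \<Sum>w\<in>P i. ennreal (mass (i # w)) * (\<integral>\<^sup>+x. g (word_map F (i # w) x) \<partial>m))"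
  proof (rule sum.cong[OF refl])
    fix i assume i: "i \<in> S"
    have "(\<integral>\<^sup>+x. g (F i x) \<partial>m) = (\<Sum>w\<in>P i. ennreal (mass w) * (\<integral>\<^sup>+x. g (F i (word_map F w x)) \<partial>m))"
      by (rule split.IH[OF i measurable_compose[OF letter_map_measurable[OF i] split.prems]])
    then show "ennreal (\<rho> i powr - \<alpha>) * (\<integral>\<^sup>+x. g (F i x) \<partial>m)
        = (\<Sum>w\<in>P i. ennreal (mass (i # w)) * (\<integral>\<^sup>+x. g (word_map F (i # w) x) \<partial>m))"
      by (simp add: sum_distrib_left ennreal_mult' mult.assoc)
  qed
  also have "\<dots> = (\<Sum>w\<in>(\<Union>i\<in>S. (#) i ` P i). ennreal (mass w) * (\<integral>\<^sup>+x. g (word_map F w x) \<partial>m))"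
    by (rule sum_word_partition_split[symmetric, OF finite_S fin])
  finally show ?case .
qed

lemma mass_le: "0 < t \<Longrightarrow> t \<le> weight \<rho> w \<Longrightarrow> mass w \<le> t powr - \<alpha>"
  unfolding mass_def using alpha_pos by (intro powr_mono2') auto

lemma mass_ge: "w \<in> lists S \<Longrightarrow> weight \<rho> w \<le> t \<Longrightarrow> t powr - \<alpha> \<le> mass w"
  unfolding mass_def using alpha_pos word_weight_pos by (intro powr_mono2') auto

lemma cell_borel: "w \<in> lists S \<Longrightarrow> cell w \<in> sets m"
  unfolding sets_m
  using compact_imp_closed[OF compact_continuous_image[OF word_map_continuous compact_space]]
  by (intro borel_closed) auto

lemma cell_measure_ge:
  assumes P: "word_partition S P" "w \<in> P"
  shows "mass w \<le> measure m (cell w)"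
proof -
  have w: "w \<in> lists S" using word_partition_lists[OF P(1)] P by auto
  have fin: "finite P" by (rule word_partition_finite[OF P(1) finite_S])
  have "ennreal (mass w) = ennreal (mass w) * (\<integral>\<^sup>+x. indicator (cell w) (word_map F w x) \<partial>m)"
    by (simp add: emeasure_space_1)
  also have "\<dots> \<le> (\<Sum>v\<in>P. ennreal (mass v) * (\<integral>\<^sup>+x. indicator (cell w) (word_map F v x) \<partial>m))"
    by (rule member_le_sum[OF P(2) _ fin]) simp
  also have "\<dots> = (\<integral>\<^sup>+x. indicator (cell w) x \<partial>m)"
    by (rule nn_integral_partition[symmetric, OF P(1)]) (use cell_borel[OF w] in simp)
  also have "\<dots> = ennreal (measure m (cell w))"
    using cell_borel[OF w] by (simp add: emeasure_eq_measure)
  finally show ?thesis by (simp add: ennreal_le_iff)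
qed

text \<open>
  The common points of two cells might carry mass; counting neighbours bounds the measure of a cell all
  the same.
\<close>

lemma cell_measure_le:
  assumes P: "word_partition S P" "w \<in> P" and t: "0 < t" "\<And>w. w \<in> P \<Longrightarrow> t \<le> weight \<rho> w"
  shows "measure m (cell w) \<le> real degree_bound * t powr - \<alpha>"
proof -
  have w: "w \<in> lists S" using word_partition_lists[OF P(1)] P by auto
  have fin: "finite P" by (rule word_partition_finite[OF P(1) finite_S])
  have "ennreal (measure m (cell w)) = (\<integral>\<^sup>+x. indicator (cell w) x \<partial>m)"
    using cell_borel[OF w] by (simp add: emeasure_eq_measure)
  also have "\<dots> = (\<Sum>v\<in>P. ennreal (mass v) * (\<integral>\<^sup>+x. indicator (cell w) (word_map F v x) \<partial>m))"
    by (rule nn_integral_partition[OF P(1)]) (use cell_borel[OF w] in simp)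
  also have "\<dots> \<le> (\<Sum>v\<in>P. if v \<in> neighbours P w then ennreal (t powr - \<alpha>) else 0)"
  proof (rule sum_mono)
    fix v assume v: "v \<in> P"
    show "ennreal (mass v) * (\<integral>\<^sup>+x. indicator (cell w) (word_map F v x) \<partial>m)
        \<le> (if v \<in> neighbours P w then ennreal (t powr - \<alpha>) else 0)"
    proof (cases "v \<in> neighbours P w")
      case True
      have "(\<integral>\<^sup>+x. indicator (cell w) (word_map F v x) \<partial>m) \<le> (\<integral>\<^sup>+x. 1 \<partial>m)"
        by (intro nn_integral_mono) (auto simp: indicator_def)
      hence "ennreal (mass v) * (\<integral>\<^sup>+x. indicator (cell w) (word_map F v x) \<partial>m) \<le> ennreal (t powr - \<alpha>) * 1"
        using mass_le[OF t(1) t(2)[OF v]] by (intro mult_mono ennreal_leI) (auto simp: emeasure_space_1)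
      then show ?thesis using True by simp
    next
      case False
      hence "indicator (cell w) (word_map F v x) = (0::ennreal)" for x
        using v by (auto simp: neighbours_def indicator_def)
      then show ?thesis using False by simp
    qed
  qed
  also have "\<dots> = (\<Sum>v\<in>neighbours P w. ennreal (t powr - \<alpha>))"
    using fin neighbours_subset by (simp add: sum.inter_restrict[symmetric] Int_absorb1)
  also have "\<dots> = ennreal (real (card (neighbours P w)) * t powr - \<alpha>)"
    by (simp add: ennreal_mult' ennreal_of_nat_eq_real_of_nat)
  also have "\<dots> \<le> ennreal (real degree_bound * t powr - \<alpha>)"
    using card_neighbours[OF P] by (intro ennreal_leI mult_right_mono) auto
  finally show ?thesis by (subst (asm) ennreal_le_iff) auto
qed

text \<open>
  Balls are indexed by the inverse \<open>\<tau>\<close> of the resistance, which is the scale on which the cells of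
  weight about \<open>\<tau>\<close> live.
\<close>

definition rball :: "real \<Rightarrow> 'a \<Rightarrow> 'a set" where
  "rball \<tau> x = {z. Res x z < 1 / \<tau>}"

text \<open>
  Cells of weight at least \<open>reach * \<tau>\<close> are so small that any two points of adjacent ones are at
  resistance less than \<open>1 / \<tau>\<close>.
\<close>

definition reach :: real where "reach = 2 * (2 * \<Delta>) powr p + 1"

lemma reach_ge_1: "1 \<le> reach"
  by (simp add: reach_def)

lemma neighbours_if_close:
  assumes "word_partition S P" "0 < \<tau>" "\<And>w. w \<in> P \<Longrightarrow> weight \<rho> w \<le> rho_max * (\<tau> / sep)"
    "w \<in> P" "v \<in> P" "x \<in> cell w" "y \<in> cell v" "y \<in> rball \<tau> x"
  shows "v \<in> neighbours P w"
proof (rule ccontr)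
  assume far: "v \<notin> neighbours P w"
  have "0 < \<tau> / sep" using assms(2) sep_ge_1 by simp
  from Res_separated_cells[OF assms(1) this assms(3,4,5) far assms(6,7)]
  have "1 \<le> sep * (\<tau> / sep) * Res x y" .
  also have "\<dots> = \<tau> * Res x y" using sep_ge_1 by simp
  also have "\<dots> < 1" using assms(2,8) by (simp add: rball_def field_simps)
  finally show False by simp
qed

lemma close_if_neighbours:
  assumes P: "word_partition S P" "w \<in> P" "v \<in> neighbours P w" and \<tau>: "0 < \<tau>"
    and t: "\<And>w. w \<in> P \<Longrightarrow> reach * \<tau> \<le> weight \<rho> w" and xy: "x \<in> cell w" "y \<in> cell v"
  shows "y \<in> rball \<tau> x"
proof -
  have "0 < reach * \<tau>" using \<tau> reach_ge_1 by simp
  hence "Res x y \<le> 2 * (2 * \<Delta>) powr p / (reach * \<tau>)"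
    using Res_neighbours_le[OF P _ t xy] by simp
  also have "\<dots> < reach / (reach * \<tau>)"
    by (rule divide_strict_right_mono[OF _ \<open>0 < reach * \<tau>\<close>]) (simp add: reach_def)
  also have "\<dots> = 1 / \<tau>" using reach_ge_1 by simp
  finally show ?thesis by (simp add: rball_def)
qed

lemma Res_refl: "Res x x = 0"
proof -
  have "Res x x \<le> 0" using p_pos by (intro Res_leI) auto
  then show ?thesis using Res_nonneg[of x x] by simp
qed

text \<open>The resistance is a supremum of continuous functions, so its sublevel sets are closed.\<close>

lemma rball_borel: "rball \<tau> x \<in> sets m"
proof -
  have closed: "closed {z. Res x z \<le> b}" if "0 \<le> b" for b
  proof -
    have "{z. Res x z \<le> b} = (\<Inter>u\<in>\<F>. {z. \<bar>u x - u z\<bar> powr p \<le> b * \<E> u})"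
    proof (intro set_eqI iffI)
      fix z assume z: "z \<in> {z. Res x z \<le> b}"
      have "\<bar>u x - u z\<bar> powr p \<le> b * \<E> u" if u: "u \<in> \<F>" for u
        using diff_le_Res[OF u, of x z] mult_right_mono[of "Res x z" b "\<E> u"] z energy_nonneg[OF u] by auto
      then show "z \<in> (\<Inter>u\<in>\<F>. {z. \<bar>u x - u z\<bar> powr p \<le> b * \<E> u})" by simp
    qed (use that in \<open>auto intro!: Res_leI\<close>)
    moreover have "closed {z. \<bar>u x - u z\<bar> powr p \<le> b * \<E> u}" if u: "u \<in> \<F>" for u
      using form_continuous[OF u] p_pos by (intro closed_Collect_le continuous_on_powr' continuous_intros) auto
    ultimately show ?thesis by (auto intro!: closed_INT)
  qed
  have "rball \<tau> x = (\<Union>n. {z. Res x z \<le> 1 / \<tau> - 1 / real (Suc n)})"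
  proof (intro set_eqI iffI)
    fix z assume "z \<in> rball \<tau> x"
    hence "0 < 1 / \<tau> - Res x z" by (simp add: rball_def)
    from reals_Archimedean[OF this] obtain n where "inverse (real (Suc n)) < 1 / \<tau> - Res x z" by blast
    hence "Res x z \<le> 1 / \<tau> - 1 / real (Suc n)" by (simp add: inverse_eq_divide)
    then show "z \<in> (\<Union>n. {z. Res x z \<le> 1 / \<tau> - 1 / real (Suc n)})" by blast
  next
    fix z assume "z \<in> (\<Union>n. {z. Res x z \<le> 1 / \<tau> - 1 / real (Suc n)})"
    then obtain n where "Res x z \<le> 1 / \<tau> - 1 / real (Suc n)" by blast
    moreover have "0 < 1 / real (Suc n)" by simp
    ultimately show "z \<in> rball \<tau> x" unfolding rball_def mem_Collect_eq by linarith
  qed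
  moreover have "{z. Res x z \<le> b} \<in> sets borel" for b
  proof (cases "0 \<le> b")
    case False
    hence "{z. Res x z \<le> b} = {}" using Res_nonneg[of x] by (auto dest: order.trans)
    then show ?thesis by simp
  qed (use closed in auto)
  ultimately show ?thesis unfolding sets_m by auto
qed

text \<open>The next two estimates are the Ahlfors regularity of \<open>m\<close> for the resistance metric.\<close>

lemma rball_measure_ge:
  "\<exists>c>0. \<forall>\<tau>\<ge>1. \<forall>x. c * \<tau> powr - \<alpha> \<le> measure m (rball \<tau> x)"
proof -
  define c where "c = (rho_max * reach) powr - \<alpha>"
  have c: "0 < c" unfolding c_def using rho_max_gt_1 reach_ge_1 by simp
  have "c * \<tau> powr - \<alpha> \<le> measure m (rball \<tau> x)" if \<tau>: "1 \<le> \<tau>" for \<tau> x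
  proof -
    have "1 \<le> reach * \<tau>" using \<tau> reach_ge_1 mult_mono[of 1 reach 1 \<tau>] by simp
    then obtain P where P: "word_partition S P" "\<And>w. w \<in> P \<Longrightarrow> reach * \<tau> \<le> weight \<rho> w"
      "\<And>w. w \<in> P \<Longrightarrow> weight \<rho> w \<le> rho_max * (reach * \<tau>)" using partition_of_weight by blast
    obtain w where w: "w \<in> P" "x \<in> cell w" using cells_cover[OF P(1)] by blast
    have l: "w \<in> lists S" using word_partition_lists[OF P(1)] w by auto
    have "c * \<tau> powr - \<alpha> = (rho_max * (reach * \<tau>)) powr - \<alpha>"
      unfolding c_def by (simp add: powr_mult mult.assoc)
    also have "\<dots> \<le> mass w" by (rule mass_ge[OF l P(3)[OF w(1)]])
    also have "\<dots> \<le> measure m (cell w)" by (rule cell_measure_ge[OF P(1) w(1)])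
    also have "\<dots> \<le> measure m (rball \<tau> x)"
      using close_if_neighbours[OF P(1) w(1) self_neighbour[OF w(1)] _ P(2) w(2)] \<tau>
      by (intro finite_measure_mono rball_borel subsetI) auto
    finally show ?thesis .
  qed
  with c show ?thesis by blast
qed

lemma rball_measure_le:
  "\<exists>C\<ge>1. \<forall>\<tau>\<ge>sep. \<forall>x. measure m (rball \<tau> x) \<le> C * \<tau> powr - \<alpha>"
proof -
  define C where "C = (real degree_bound)\<^sup>2 * sep powr \<alpha>"
  have "1 \<le> real degree_bound" by (simp add: degree_bound_def)
  moreover have "1 \<le> sep powr \<alpha>" using sep_ge_1 alpha_pos by (intro ge_one_powr_ge_zero) auto
  ultimately have C: "1 \<le> C" unfolding C_def using mult_mono[of 1 "(real degree_bound)\<^sup>2" 1 "sep powr \<alpha>"] by simp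
  have "measure m (rball \<tau> x) \<le> C * \<tau> powr - \<alpha>" if \<tau>: "sep \<le> \<tau>" for \<tau> x
  proof -
    define t where "t = \<tau> / sep"
    have t: "1 \<le> t" "0 < \<tau>" using \<tau> sep_ge_1 by (auto simp: t_def)
    obtain P where P: "word_partition S P" "\<And>w. w \<in> P \<Longrightarrow> t \<le> weight \<rho> w"
      "\<And>w. w \<in> P \<Longrightarrow> weight \<rho> w \<le> rho_max * t" using partition_of_weight[OF t(1)] by blast
    obtain w where w: "w \<in> P" "x \<in> cell w" using cells_cover[OF P(1)] by blast
    have fin: "finite (neighbours P w)"
      using word_partition_finite[OF P(1) finite_S] neighbours_subset finite_subset by blast
    have l: "v \<in> lists S" if "v \<in> neighbours P w" for v
      using word_partition_lists[OF P(1)] that neighbours_subset by blast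
    have "rball \<tau> x \<subseteq> (\<Union>v\<in>neighbours P w. cell v)"
    proof
      fix y assume y: "y \<in> rball \<tau> x"
      obtain v where v: "v \<in> P" "y \<in> cell v" using cells_cover[OF P(1)] by blast
      have "v \<in> neighbours P w"
        using neighbours_if_close[OF P(1) t(2) _ w(1) v(1) w(2) v(2) y] P(3) by (simp add: t_def)
      with v show "y \<in> (\<Union>v\<in>neighbours P w. cell v)" by blast
    qed
    hence "measure m (rball \<tau> x) \<le> measure m (\<Union>v\<in>neighbours P w. cell v)"
      using fin cell_borel[OF l] by (intro finite_measure_mono) auto
    also have "\<dots> \<le> (\<Sum>v\<in>neighbours P w. measure m (cell v))"
      using fin cell_borel[OF l] by (intro finite_measure_subadditive_finite) auto
    also have "\<dots> \<le> (\<Sum>v\<in>neighbours P w. real degree_bound * t powr - \<alpha>)"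
      using neighbours_subset t P(2) by (intro sum_mono cell_measure_le[OF P(1)]) auto
    also have "\<dots> \<le> real degree_bound * (real degree_bound * t powr - \<alpha>)"
      using card_neighbours[OF P(1) w(1)] by (simp add: mult_right_mono)
    also have "t powr - \<alpha> = sep powr \<alpha> * \<tau> powr - \<alpha>"
      unfolding t_def using sep_ge_1 t by (simp add: powr_divide powr_minus field_simps)
    finally show ?thesis by (simp add: C_def power2_eq_square mult_ac)
  qed
  with C show ?thesis by blast
qed

text \<open>
  Every cell has positive mass, and on small cells an element of the form oscillates little, so it is
  determined by its class modulo null sets.
\<close>

lemma ae_const_imp_const:
  assumes u: "u \<in> \<F>" and ae: "AE x in m. u x = c"
  shows "u x = c"
proof (rule ccontr)
  assume ne: "u x \<noteq> c"
  define e where "e = \<bar>u x - c\<bar> powr p"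
  have e: "0 < e" using ne by (simp add: e_def)
  define t where "t = 1 + \<Delta> powr p * \<E> u / e"
  have t: "1 \<le> t" using e energy_nonneg[OF u] by (simp add: t_def)
  obtain P where P: "word_partition S P" "\<And>w. w \<in> P \<Longrightarrow> t \<le> weight \<rho> w"
    by (rule partition_of_weight[OF t]) blast
  obtain w where w: "w \<in> P" "x \<in> cell w" using cells_cover[OF P(1)] by blast
  have l: "w \<in> lists S" using word_partition_lists[OF P(1)] w by auto
  have "\<exists>y\<in>cell w. u y = c"
  proof (rule ccontr)
    assume "\<not> ?thesis"
    hence "AE x in m. x \<notin> cell w" using ae by (auto elim: AE_mp)
    hence "measure m (cell w) = 0"
      using cell_borel[OF l] by (simp add: AE_iff_measurable[OF _ refl] measure_def space_m prob_eq_0)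
    moreover have "0 < mass w" unfolding mass_def using word_weight_pos[OF l] by simp
    ultimately show False using cell_measure_ge[OF P(1) w(1)] by simp
  qed
  then obtain a b where ab: "x = word_map F w a" "u (word_map F w b) = c" using w by auto
  have "e = \<bar>(u \<circ> word_map F w) a - (u \<circ> word_map F w) b\<bar> powr p" using ab by (simp add: e_def)
  also have "\<dots> \<le> \<Delta> powr p * \<E> (u \<circ> word_map F w)" by (intro oscillation_powr comp_word_in u l)
  finally have "t * e \<le> t * (\<Delta> powr p * \<E> (u \<circ> word_map F w))" using t by (intro mult_left_mono) auto
  also have "\<dots> = \<Delta> powr p * (t * \<E> (u \<circ> word_map F w))" by simp
  also have "\<dots> \<le> \<Delta> powr p * (weight \<rho> w * \<E> (u \<circ> word_map F w))"
    by (intro mult_left_mono mult_right_mono P w energy_nonneg comp_word_in u l) auto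
  also have "\<dots> \<le> \<Delta> powr p * \<E> u" by (intro mult_left_mono energy_word_le u l) auto
  finally have "t * e \<le> \<Delta> powr p * \<E> u" .
  moreover have "t * e = e + \<Delta> powr p * \<E> u" using e by (simp add: t_def distrib_right)
  ultimately show False using e by linarith
qed

lemma ae_eq_imp_eq:
  assumes "u \<in> \<F>" "v \<in> \<F>" "AE x in m. u x = v x"
  shows "u = v"
proof
  fix x
  have "AE x in m. u x - v x = 0" using assms(3) by eventually_elim simp
  from ae_const_imp_const[OF diff_in[OF assms(1,2)] this, of x] show "u x = v x" by simp
qed

text \<open>
  The space has more than one point: otherwise every ball would have mass \<open>1\<close>, but the mass of balls
  tends to \<open>0\<close>.
\<close>

lemma ex_nonconstant: "\<exists>u\<in>\<F>. \<not> (\<exists>c. AE x in m. u x = c)"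
proof -
  obtain C where C: "1 \<le> C" "\<And>\<tau> x. sep \<le> \<tau> \<Longrightarrow> measure m (rball \<tau> x) \<le> C * \<tau> powr - \<alpha>"
    using rball_measure_le by blast
  have "\<exists>x y :: 'a. x \<noteq> y"
  proof (rule ccontr)
    assume "\<not> ?thesis"
    hence one: "z = undefined" for z :: 'a by blast
    define \<tau> where "\<tau> = sep + (2 * C) powr (1 / \<alpha>)"
    have \<tau>: "sep \<le> \<tau>" "(2 * C) powr (1 / \<alpha>) \<le> \<tau>" using sep_ge_1 by (auto simp: \<tau>_def)
    have "2 * C = ((2 * C) powr (1 / \<alpha>)) powr \<alpha>" using C alpha_pos by (simp add: powr_powr)
    also have "\<dots> \<le> \<tau> powr \<alpha>" using \<tau> alpha_pos by (intro powr_mono2) auto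
    finally have big: "2 * C \<le> \<tau> powr \<alpha>" .
    have t0: "0 < \<tau>" using \<tau> sep_ge_1 by linarith
    have "z \<in> rball \<tau> undefined" for z
      using one[of z] Res_refl[of undefined] t0 by (simp add: rball_def)
    hence "rball \<tau> undefined = UNIV" by blast
    hence "1 \<le> C * \<tau> powr - \<alpha>" using C(2)[OF \<tau>(1), of undefined] prob_space space_m by simp
    hence "\<tau> powr \<alpha> \<le> C" using t0 by (simp add: powr_minus field_simps)
    then show False using big C(1) by linarith
  qed
  then obtain x y :: 'a where "x \<noteq> y" by blast
  then obtain u where u: "u \<in> \<F>" "u x \<noteq> u y" using separates by blast
  have "\<not> (\<exists>c. AE x in m. u x = c)"
    using ae_const_imp_const[OF u(1)] u(2) by metis
  then show ?thesis using u by blast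
qed

end

context pcf_energy
begin

section \<open>The energy dominates the Korevaar-Schoen functionals\<close>

text \<open>
  The functional \<open>J\<close> at the critical exponent, with the radius \<open>r\<close> of a ball of the resistance metric
  expressed by \<open>\<tau> = r\<^bsup>1 - p\<^esup>\<close>; then \<open>r\<^bsup>df + p - 1\<^esup> = \<tau>\<^bsup>- (\<alpha> + 1)\<^esup>\<close>.
\<close>

definition kernel :: "real \<Rightarrow> 'a \<Rightarrow> 'a \<Rightarrow> real" where
  "kernel \<tau> x y = indicator (rball \<tau> x) y * \<tau> powr (\<alpha> + 1) / measure m (rball \<tau> x)"

definition J_scale :: "real \<Rightarrow> ('a \<Rightarrow> real) \<Rightarrow> ennreal" where
  "J_scale \<tau> f = (\<integral>\<^sup>+x. (\<integral>\<^sup>+y. ennreal (\<bar>f x - f y\<bar> powr p * kernel \<tau> x y) \<partial>m) \<partial>m)"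

definition adjacent :: "'i list set \<Rightarrow> ('i list \<times> 'i list) set" where
  "adjacent P = (SIGMA w:P. neighbours P w)"

lemma adjacent_iff: "(w, v) \<in> adjacent P \<longleftrightarrow> w \<in> P \<and> v \<in> neighbours P w"
  by (auto simp: adjacent_def)

lemma adjacent_in: "(w, v) \<in> adjacent P \<Longrightarrow> w \<in> P \<and> v \<in> P"
  using neighbours_subset by (auto simp: adjacent_def)

lemma finite_adjacent: "word_partition S P \<Longrightarrow> finite (adjacent P)"
  unfolding adjacent_def
  by (intro finite_SigmaI finite_subset[OF neighbours_subset] word_partition_finite[OF _ finite_S])

lemma adjacent_sym: "(w, v) \<in> adjacent P \<Longrightarrow> (v, w) \<in> adjacent P"
  using neighbours_sym neighbours_subset unfolding adjacent_iff by blast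

lemma sum_adjacent_le:
  assumes P: "word_partition S P" and e: "\<And>w. w \<in> P \<Longrightarrow> 0 \<le> e w"
  shows "(\<Sum>(w, v)\<in>adjacent P. e w + e v) \<le> 2 * real degree_bound * (\<Sum>w\<in>P. e w)"
proof -
  have fin: "finite P" "\<And>w. finite (neighbours P w)"
    using word_partition_finite[OF P finite_S] neighbours_subset finite_subset by blast+
  have first: "(\<Sum>(w, v)\<in>adjacent P. e w) \<le> real degree_bound * (\<Sum>w\<in>P. e w)"
  proof -
    have "(\<Sum>(w, v)\<in>adjacent P. e w) = (\<Sum>w\<in>P. \<Sum>v\<in>neighbours P w. e w)"
      unfolding adjacent_def using fin by (subst sum.Sigma) auto
    also have "\<dots> = (\<Sum>w\<in>P. real (card (neighbours P w)) * e w)" by simp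
    also have "\<dots> \<le> (\<Sum>w\<in>P. real degree_bound * e w)"
      using card_neighbours[OF P] e by (intro sum_mono mult_right_mono) auto
    finally show ?thesis by (simp add: sum_distrib_left)
  qed
  have "(\<Sum>(w, v)\<in>adjacent P. e v) = (\<Sum>(w, v)\<in>adjacent P. e w)"
    by (rule sum.reindex_bij_witness[of _ prod.swap prod.swap])
      (auto intro: adjacent_sym)
  then show ?thesis using first by (simp add: case_prod_beta sum.distrib)
qed

lemma J_scale_le_energy:
  "\<exists>C\<ge>1. \<forall>u\<in>\<F>. \<forall>\<tau>>0. J_scale \<tau> u \<le> ennreal (C * \<E> u)"
proof -
  obtain c where c: "0 < c" "\<And>\<tau> x. 1 \<le> \<tau> \<Longrightarrow> c * \<tau> powr - \<alpha> \<le> measure m (rball \<tau> x)"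
    using rball_measure_ge by blast
  define C1 where "C1 = \<Delta> powr p * sep powr (\<alpha> + 1) / (c * sep powr - \<alpha>)"
  define C2 where "C2 = (2 * \<Delta>) powr p / c * (2 * real degree_bound) * (real degree_bound)\<^sup>2 * sep powr (2 * \<alpha> + 1)"
  define C where "C = 1 + C1 + C2"
  have C12: "0 \<le> C1" "0 \<le> C2" unfolding C1_def C2_def using c by auto
  \<comment> \<open>For large balls the oscillation bound suffices.\<close>
  have large: "J_scale \<tau> u \<le> ennreal (C1 * \<E> u)" if u: "u \<in> \<F>" and \<tau>: "0 < \<tau>" "\<tau> < sep" for u \<tau>
  proof -
    have pt: "\<bar>u x - u y\<bar> powr p * kernel \<tau> x y \<le> C1 * \<E> u"
      for x y
    proof -
      have "1 / sep \<le> 1 / \<tau>" using \<tau> by (intro frac_le) auto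
      hence "rball sep x \<subseteq> rball \<tau> x" by (auto simp: rball_def)
      hence ms: "c * sep powr - \<alpha> \<le> measure m (rball \<tau> x)"
        using c(2)[OF sep_ge_1, of x] finite_measure_mono[OF _ rball_borel, of "rball sep x" \<tau> x] by linarith
      have cs: "0 < c * sep powr - \<alpha>" using c sep_ge_1 by simp
      have "\<bar>u x - u y\<bar> powr p * kernel \<tau> x y
          \<le> (\<Delta> powr p * \<E> u) * (sep powr (\<alpha> + 1) / (c * sep powr - \<alpha>))"
      proof (intro mult_mono oscillation_powr u)
        have "indicator (rball \<tau> x) y * \<tau> powr (\<alpha> + 1) \<le> 1 * sep powr (\<alpha> + 1)"
          using \<tau> alpha_pos by (intro mult_mono powr_mono2) (auto simp: indicator_def)
        then show "kernel \<tau> x y \<le> sep powr (\<alpha> + 1) / (c * sep powr - \<alpha>)"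
          unfolding kernel_def using ms cs by (intro frac_le) auto
      qed (auto simp: energy_nonneg[OF u] kernel_def)
      then show ?thesis by (simp add: C1_def mult_ac)
    qed
    have "J_scale \<tau> u \<le> (\<integral>\<^sup>+x. (\<integral>\<^sup>+y. ennreal (C1 * \<E> u) \<partial>m) \<partial>m)"
      unfolding J_scale_def by (intro nn_integral_mono ennreal_leI pt)
    then show ?thesis by (simp add: emeasure_space_1)
  qed
  \<comment> \<open>Two points of a small ball lie in adjacent cells of weight about \<open>\<tau> / sep\<close>.\<close>
  have small: "J_scale \<tau> u \<le> ennreal (C2 * \<E> u)" if u: "u \<in> \<F>" and \<tau>: "sep \<le> \<tau>" for u \<tau>
  proof -
    define t where "t = \<tau> / sep"
    have t: "1 \<le> t" "0 < \<tau>" "1 \<le> \<tau>" using \<tau> sep_ge_1 by (auto simp: t_def)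
    obtain P where P: "word_partition S P" "\<And>w. w \<in> P \<Longrightarrow> t \<le> weight \<rho> w"
      "\<And>w. w \<in> P \<Longrightarrow> weight \<rho> w \<le> rho_max * t" using partition_of_weight[OF t(1)] by blast
    have l: "w \<in> lists S" if "w \<in> P" for w using word_partition_lists[OF P(1)] that by auto
    define e where "e w = \<E> (u \<circ> word_map F w)" for w
    have e0: "0 \<le> e w" if "w \<in> P" for w
      unfolding e_def by (intro energy_nonneg comp_word_in u l that)
    define K where "K = (2 * \<Delta>) powr p * (\<tau> powr (\<alpha> + 1) / (c * \<tau> powr - \<alpha>))"
    have K: "0 \<le> K" unfolding K_def using c by simp
    have fin: "finite (adjacent P)" by (rule finite_adjacent[OF P(1)])
    have pt: "ennreal (\<bar>u x - u y\<bar> powr p * kernel \<tau> x y)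
      \<le> (\<Sum>(w, v)\<in>adjacent P. ennreal (K * (e w + e v)) * (indicator (cell w) x * indicator (cell v) y))" for x y
    proof (cases "y \<in> rball \<tau> x")
      case True
      obtain w where w: "w \<in> P" "x \<in> cell w" using cells_cover[OF P(1)] by blast
      obtain v where v: "v \<in> P" "y \<in> cell v" using cells_cover[OF P(1)] by blast
      have nb: "v \<in> neighbours P w"
        using neighbours_if_close[OF P(1) t(2) _ w(1) v(1) w(2) v(2) True] P(3) by (simp add: t_def)
      have cs: "0 < c * \<tau> powr - \<alpha>" using c t by simp
      have "\<bar>u x - u y\<bar> powr p * kernel \<tau> x y
          \<le> ((2 * \<Delta>) powr p * (e w + e v)) * (\<tau> powr (\<alpha> + 1) / (c * \<tau> powr - \<alpha>))"
      proof (intro mult_mono)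
        show "\<bar>u x - u y\<bar> powr p \<le> (2 * \<Delta>) powr p * (e w + e v)"
          unfolding e_def by (rule neighbour_difference[OF P(1) w(1) nb u w(2) v(2)])
        show "kernel \<tau> x y \<le> \<tau> powr (\<alpha> + 1) / (c * \<tau> powr - \<alpha>)"
          unfolding kernel_def using c(2)[OF t(3), of x] cs by (intro frac_le) (auto simp: indicator_def)
      qed (use e0 w v in \<open>auto simp: kernel_def\<close>)
      also have "\<dots> = K * (e w + e v)" by (simp add: K_def mult_ac)
      finally have "ennreal (\<bar>u x - u y\<bar> powr p * kernel \<tau> x y)
          \<le> ennreal (K * (e w + e v)) * (indicator (cell w) x * indicator (cell v) y)"
        using w v by (simp add: ennreal_leI)
      also have "\<dots> = (case (w, v) of (w, v) \<Rightarrow> ennreal (K * (e w + e v)) * (indicator (cell w) x * indicator (cell v) y))"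
        by simp
      also have "\<dots> \<le> (\<Sum>(w, v)\<in>adjacent P. ennreal (K * (e w + e v)) * (indicator (cell w) x * indicator (cell v) y))"
        by (rule member_le_sum[OF _ _ fin]) (use w nb in \<open>auto simp: adjacent_iff\<close>)
      finally show ?thesis .
    qed (simp add: kernel_def)
    have "J_scale \<tau> u \<le> (\<integral>\<^sup>+x. (\<integral>\<^sup>+y. (\<Sum>(w, v)\<in>adjacent P.
        ennreal (K * (e w + e v)) * (indicator (cell w) x * indicator (cell v) y)) \<partial>m) \<partial>m)"
      unfolding J_scale_def by (intro nn_integral_mono pt)
    also have "\<dots> = (\<integral>\<^sup>+x. (\<Sum>(w, v)\<in>adjacent P.
        ennreal (K * (e w + e v)) * (indicator (cell w) x * emeasure m (cell v))) \<partial>m)"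
    proof (rule nn_integral_cong)
      fix x
      have meas: "cell v \<in> sets m" if "(w, v) \<in> adjacent P" for w v
        using adjacent_in[OF that] by (intro cell_borel l) simp
      show "(\<integral>\<^sup>+y. (\<Sum>(w, v)\<in>adjacent P. ennreal (K * (e w + e v)) * (indicator (cell w) x * indicator (cell v) y)) \<partial>m)
        = (\<Sum>(w, v)\<in>adjacent P. ennreal (K * (e w + e v)) * (indicator (cell w) x * emeasure m (cell v)))"
        unfolding case_prod_beta using meas
        by (subst nn_integral_sum) (auto simp: nn_integral_cmult mult.assoc[symmetric] intro!: sum.cong)
    qed
    also have "\<dots> = (\<Sum>(w, v)\<in>adjacent P. ennreal (K * (e w + e v)) * (emeasure m (cell w) * emeasure m (cell v)))"
    proof -
      have meas: "cell w \<in> sets m" if "(w, v) \<in> adjacent P" for w v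
        using adjacent_in[OF that] by (intro cell_borel l) simp
      show ?thesis
        unfolding case_prod_beta using meas
        by (subst nn_integral_sum) (auto simp: nn_integral_cmult nn_integral_multc intro!: sum.cong)
    qed
    also have "\<dots> \<le> (\<Sum>(w, v)\<in>adjacent P. ennreal (K * (e w + e v) * (real degree_bound * t powr - \<alpha>)\<^sup>2))"
    proof (rule sum_mono, clarify)
      fix w v assume "(w, v) \<in> adjacent P"
      hence wv: "w \<in> P" "v \<in> P" using adjacent_in by auto
      have em: "emeasure m (cell w) \<le> ennreal (real degree_bound * t powr - \<alpha>)" if "w \<in> P" for w
        unfolding emeasure_eq_measure using t by (intro ennreal_leI cell_measure_le[OF P(1) that _ P(2)]) auto
      have "ennreal (K * (e w + e v)) * (emeasure m (cell w) * emeasure m (cell v))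
        \<le> ennreal (K * (e w + e v)) * (ennreal (real degree_bound * t powr - \<alpha>) * ennreal (real degree_bound * t powr - \<alpha>))"
        by (intro mult_left_mono mult_mono em wv) auto
      also have "\<dots> = ennreal (K * (e w + e v) * (real degree_bound * t powr - \<alpha>)\<^sup>2)"
        using K e0 wv by (simp add: ennreal_mult'[symmetric] ennreal_mult[symmetric] power2_eq_square)
      finally show "ennreal (K * (e w + e v)) * (emeasure m (cell w) * emeasure m (cell v))
        \<le> ennreal (K * (e w + e v) * (real degree_bound * t powr - \<alpha>)\<^sup>2)" .
    qed
    also have "\<dots> = ennreal (\<Sum>(w, v)\<in>adjacent P. K * (e w + e v) * (real degree_bound * t powr - \<alpha>)\<^sup>2)"
      unfolding case_prod_beta using K e0 adjacent_in
      by (intro sum_ennreal) (auto intro!: mult_nonneg_nonneg add_nonneg_nonneg)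
    also have "(\<Sum>(w, v)\<in>adjacent P. K * (e w + e v) * (real degree_bound * t powr - \<alpha>)\<^sup>2)
        = K * (real degree_bound * t powr - \<alpha>)\<^sup>2 * (\<Sum>(w, v)\<in>adjacent P. e w + e v)"
      unfolding sum_distrib_left case_prod_beta by (simp add: mult_ac)
    also have "\<dots> \<le> K * (real degree_bound * t powr - \<alpha>)\<^sup>2 * (2 * real degree_bound * (\<E> u / t))"
    proof (intro mult_left_mono)
      have "t * (\<Sum>w\<in>P. e w) = (\<Sum>w\<in>P. t * e w)" by (rule sum_distrib_left)
      also have "\<dots> \<le> (\<Sum>w\<in>P. weight \<rho> w * e w)" by (intro sum_mono mult_right_mono P e0)
      also have "\<dots> = \<E> u" unfolding e_def by (rule energy_partition[OF P(1) u, symmetric])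
      finally have "(\<Sum>w\<in>P. e w) \<le> \<E> u / t" using t by (simp add: field_simps)
      hence "2 * real degree_bound * (\<Sum>w\<in>P. e w) \<le> 2 * real degree_bound * (\<E> u / t)"
        by (intro mult_left_mono) auto
      then show "(\<Sum>(w, v)\<in>adjacent P. e w + e v) \<le> 2 * real degree_bound * (\<E> u / t)"
        using sum_adjacent_le[OF P(1), of e, OF e0] by linarith
    qed (use K in auto)
    also have "\<dots> = C2 * \<E> u"
    proof -
      have s0: "0 < sep" using sep_ge_1 by simp
      have "(t powr - \<alpha>)\<^sup>2 / t * (\<tau> powr (\<alpha> + 1) / \<tau> powr - \<alpha>) = sep powr (2 * \<alpha> + 1)"
      proof -
        have "(t powr - \<alpha>)\<^sup>2 / t = t powr (- (2 * \<alpha> + 1))"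
        proof -
          have "t powr (- (2 * \<alpha> + 1)) = t powr - \<alpha> * t powr - \<alpha> * t powr - 1"
            using t by (simp add: powr_add[symmetric] powr_diff)
          then show ?thesis using t by (simp add: powr_minus power2_eq_square divide_inverse)
        qed
        also have "\<dots> = sep powr (2 * \<alpha> + 1) / \<tau> powr (2 * \<alpha> + 1)"
          unfolding t_def powr_minus using t s0 by (simp add: powr_divide)
        finally have 1: "(t powr - \<alpha>)\<^sup>2 / t = sep powr (2 * \<alpha> + 1) / \<tau> powr (2 * \<alpha> + 1)" .
        have 2: "\<tau> powr (\<alpha> + 1) / \<tau> powr - \<alpha> = \<tau> powr (2 * \<alpha> + 1)"
          by (simp add: powr_diff[symmetric])
        show ?thesis unfolding 1 2 using t by simp
      qed
      hence *: "C2 * \<E> u = (2 * \<Delta>) powr p / c * (2 * real degree_bound) * (real degree_bound)\<^sup>2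
          * ((t powr - \<alpha>)\<^sup>2 / t * (\<tau> powr (\<alpha> + 1) / \<tau> powr - \<alpha>)) * \<E> u"
        by (simp add: C2_def)
      show ?thesis unfolding * K_def by (simp add: power_mult_distrib mult_ac)
    qed
    finally show ?thesis using C12 energy_nonneg[OF u] by (simp add: ennreal_leI)
  qed
  have "J_scale \<tau> u \<le> ennreal (C * \<E> u)" if u: "u \<in> \<F>" and \<tau>: "0 < \<tau>" for u \<tau>
  proof -
    have "C1 * \<E> u \<le> C * \<E> u" "C2 * \<E> u \<le> C * \<E> u"
      unfolding C_def using C12 energy_nonneg[OF u] by (intro mult_right_mono; simp)+
    then show ?thesis
      using large[OF u \<tau>] small[OF u, of \<tau>] by (cases "\<tau> < sep") (auto intro: order.trans ennreal_leI)
  qed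
  moreover have "1 \<le> C" using C12 by (simp add: C_def)
  ultimately show ?thesis by blast
qed

end

section \<open>The Korevaar-Schoen functionals dominate the energy\<close>

lemma (in prob_space) abs_powr_expectation_le:
  assumes p: "1 \<le> p" and g[measurable]: "g \<in> borel_measurable M"
    and int: "integrable M (\<lambda>x. \<bar>g x\<bar> powr p)"
  shows "ennreal (\<bar>c - expectation g\<bar> powr p) \<le> (\<integral>\<^sup>+x. ennreal (\<bar>c - g x\<bar> powr p) \<partial>M)"
proof -
  have "integrable M (\<lambda>x. 1 + \<bar>g x\<bar> powr p)" using int by (intro Bochner_Integration.integrable_add) auto
  moreover have "norm (g x) \<le> norm (1 + \<bar>g x\<bar> powr p)" for x
  proof (cases "\<bar>g x\<bar> \<le> 1")
    case False
    hence "\<bar>g x\<bar> powr 1 \<le> \<bar>g x\<bar> powr p" using p by (intro powr_mono) auto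
    then show ?thesis using False by simp
  next
    case True
    have "0 \<le> \<bar>g x\<bar> powr p" by simp
    then show ?thesis using True unfolding real_norm_def by linarith
  qed
  ultimately have g_int: "integrable M g" by (intro Bochner_Integration.integrable_bound[OF _ g]) auto
  have dom: "integrable M (\<lambda>x. 2 powr p * (\<bar>c\<bar> powr p + \<bar>g x\<bar> powr p))"
    using int by (intro integrable_mult_right Bochner_Integration.integrable_add) auto
  have "norm (\<bar>c - g x\<bar> powr p) \<le> norm (2 powr p * (\<bar>c\<bar> powr p + \<bar>g x\<bar> powr p))" for x
    using abs_diff_powr_le[of p c "g x" 0] p by simp
  hence bnd: "AE x in M. norm (\<bar>c - g x\<bar> powr p) \<le> norm (2 powr p * (\<bar>c\<bar> powr p + \<bar>g x\<bar> powr p))"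
    by (rule AE_I2)
  have q_int: "integrable M (\<lambda>x. \<bar>c - g x\<bar> powr p)"
    by (rule Bochner_Integration.integrable_bound[OF dom _ bnd]) measurable
  have "\<bar>expectation (\<lambda>x. c - g x)\<bar> powr p \<le> expectation (\<lambda>x. \<bar>c - g x\<bar> powr p)"
    using g_int q_int convex_abs_powr[OF p]
    by (intro jensens_inequality[where I = UNIV and q = "\<lambda>x. \<bar>x\<bar> powr p"]) auto
  moreover have "expectation (\<lambda>x. c - g x) = c - expectation g"
    using g_int by (simp add: prob_space)
  moreover have "(\<integral>\<^sup>+x. ennreal (\<bar>c - g x\<bar> powr p) \<partial>M) = ennreal (expectation (\<lambda>x. \<bar>c - g x\<bar> powr p))"
    using q_int by (intro nn_integral_eq_integral) auto
  ultimately show ?thesis by (simp add: ennreal_leI)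
qed

text \<open>
  The inequality holds for arbitrary \<open>f\<close>, so functionals with different exponents can be compared without
  discussing the measurability of \<open>x \<mapsto> m (B(x, r))\<close>.
\<close>

lemma nn_integral_cmult_le:
  assumes c: "0 < c"
  shows "(\<integral>\<^sup>+x. ennreal c * f x \<partial>M) \<le> ennreal c * (\<integral>\<^sup>+x. f x \<partial>M)"
  unfolding nn_integral_def[of M "\<lambda>x. ennreal c * f x"]
proof (rule SUP_least)
  fix g assume g: "g \<in> {g. simple_function M g \<and> g \<le> (\<lambda>x. ennreal c * f x)}"
  define h where "h x = ennreal (1 / c) * g x" for x
  have h: "simple_function M h" using g unfolding h_def by (auto intro: simple_function_mult)
  have one: "ennreal c * ennreal (1 / c) = 1" "ennreal (1 / c) * ennreal c = 1"
    using c by (simp_all add: ennreal_mult[symmetric])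
  have gh: "g x = ennreal c * h x" for x
    unfolding h_def mult.assoc[symmetric] one by simp
  have "h x \<le> f x" for x
  proof -
    have "h x \<le> ennreal (1 / c) * (ennreal c * f x)"
      unfolding h_def using g by (intro mult_left_mono) (auto simp: le_fun_def)
    also have "\<dots> = f x" unfolding mult.assoc[symmetric] one by simp
    finally show ?thesis .
  qed
  hence "integral\<^sup>S M h \<le> (\<integral>\<^sup>+x. f x \<partial>M)"
    unfolding nn_integral_def using h by (intro SUP_upper) (auto simp: le_fun_def)
  hence "ennreal c * integral\<^sup>S M h \<le> ennreal c * (\<integral>\<^sup>+x. f x \<partial>M)" by (intro mult_left_mono) auto
  moreover have "integral\<^sup>S M g = ennreal c * integral\<^sup>S M h"
    using simple_integral_mult[OF h, of "ennreal c"] by (simp add: gh[symmetric])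
  ultimately show "integral\<^sup>S M g \<le> ennreal c * (\<integral>\<^sup>+x. f x \<partial>M)" by simp
qed

context pcf_energy
begin

lemma nn_integral_partition_pairs:
  assumes P: "word_partition S P" and g[measurable]: "(\<lambda>(x, y). g x y) \<in> borel_measurable (m \<Otimes>\<^sub>M m)"
  shows "(\<integral>\<^sup>+x. (\<integral>\<^sup>+y. g x y \<partial>m) \<partial>m) = (\<Sum>w\<in>P. \<Sum>v\<in>P. ennreal (mass w) * (ennreal (mass v) *
    (\<integral>\<^sup>+a. (\<integral>\<^sup>+b. g (word_map F w a) (word_map F v b) \<partial>m) \<partial>m)))"
proof -
  have wm: "word_map F w \<in> m \<rightarrow>\<^sub>M m" if "w \<in> P" for w
    using word_partition_lists[OF P] that by (intro word_map_measurable) auto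
  have g_y: "g x \<in> borel_measurable m" for x
    using measurable_compose[OF measurable_Pair1' g, of x] by (simp add: space_m)
  have g_ab: "(\<lambda>a. \<integral>\<^sup>+b. g (word_map F w a) (word_map F v b) \<partial>m) \<in> borel_measurable m"
    if "w \<in> P" "v \<in> P" for w v
  proof (rule borel_measurable_nn_integral)
    have [measurable]: "word_map F w \<in> m \<rightarrow>\<^sub>M m" "word_map F v \<in> m \<rightarrow>\<^sub>M m" using wm that by auto
    have "(\<lambda>(a, b). (word_map F w a, word_map F v b)) \<in> (m \<Otimes>\<^sub>M m) \<rightarrow>\<^sub>M (m \<Otimes>\<^sub>M m)" by measurable
    from measurable_compose[OF this g]
    show "(\<lambda>(a, b). g (word_map F w a) (word_map F v b)) \<in> borel_measurable (m \<Otimes>\<^sub>M m)"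
      by (simp add: case_prod_beta)
  qed
  have "(\<integral>\<^sup>+x. (\<integral>\<^sup>+y. g x y \<partial>m) \<partial>m)
      = (\<Sum>w\<in>P. ennreal (mass w) * (\<integral>\<^sup>+a. (\<integral>\<^sup>+y. g (word_map F w a) y \<partial>m) \<partial>m))"
    by (rule nn_integral_partition[OF P borel_measurable_nn_integral[OF g]])
  also have "\<dots> = (\<Sum>w\<in>P. ennreal (mass w) *
      (\<integral>\<^sup>+a. (\<Sum>v\<in>P. ennreal (mass v) * (\<integral>\<^sup>+b. g (word_map F w a) (word_map F v b) \<partial>m)) \<partial>m))"
    by (subst nn_integral_partition[OF P g_y]) simp
  also have "\<dots> = (\<Sum>w\<in>P. ennreal (mass w) *
      (\<Sum>v\<in>P. ennreal (mass v) * (\<integral>\<^sup>+a. (\<integral>\<^sup>+b. g (word_map F w a) (word_map F v b) \<partial>m) \<partial>m)))"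
  proof (rule sum.cong[OF refl])
    fix w assume w: "w \<in> P"
    show "ennreal (mass w) * (\<integral>\<^sup>+a. (\<Sum>v\<in>P. ennreal (mass v) * (\<integral>\<^sup>+b. g (word_map F w a) (word_map F v b) \<partial>m)) \<partial>m)
        = ennreal (mass w) * (\<Sum>v\<in>P. ennreal (mass v) * (\<integral>\<^sup>+a. (\<integral>\<^sup>+b. g (word_map F w a) (word_map F v b) \<partial>m) \<partial>m))"
      using g_ab[OF w] by (subst nn_integral_sum) (auto simp: nn_integral_cmult)
  qed
  finally show ?thesis by (simp add: sum_distrib_left)
qed

definition pair_integral :: "('a \<Rightarrow> real) \<Rightarrow> 'i list \<Rightarrow> 'i list \<Rightarrow> ennreal" where
  "pair_integral f w v =
    (\<integral>\<^sup>+a. (\<integral>\<^sup>+b. ennreal (\<bar>f (word_map F w a) - f (word_map F v b)\<bar> powr p) \<partial>m) \<partial>m)"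

text \<open>
  Restrict the double integral \<open>J\<close> to the pairs of points in adjacent cells, where the kernel is of order
  \<open>\<tau>\<^bsup>2\<alpha>+1\<^esup>\<close>, and pull it back to the cells, each of mass of order \<open>\<tau>\<^bsup>-\<alpha>\<^esup>\<close>.
\<close>

lemma pair_integrals_le_J:
  "\<exists>C>0. \<forall>f\<in>borel_measurable m. \<forall>\<tau>\<ge>sep. \<forall>P. word_partition S P \<longrightarrow>
     (\<forall>w\<in>P. reach * \<tau> \<le> weight \<rho> w \<and> weight \<rho> w \<le> rho_max * (reach * \<tau>)) \<longrightarrow>
     (\<Sum>(w, v)\<in>adjacent P. pair_integral f w v) \<le> ennreal (C / \<tau>) * J_scale \<tau> f"
proof -
  obtain B where B: "1 \<le> B" "\<And>\<tau> x. sep \<le> \<tau> \<Longrightarrow> measure m (rball \<tau> x) \<le> B * \<tau> powr - \<alpha>"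
    using rball_measure_le by blast
  obtain b where b: "0 < b" "\<And>\<tau> x. 1 \<le> \<tau> \<Longrightarrow> b * \<tau> powr - \<alpha> \<le> measure m (rball \<tau> x)"
    using rball_measure_ge by blast
  define C where "C = B * (rho_max * reach) powr (2 * \<alpha>)"
  have C: "0 < C" unfolding C_def using B rho_max_gt_1 reach_ge_1 by simp
  have "(\<Sum>(w, v)\<in>adjacent P. pair_integral f w v) \<le> ennreal (C / \<tau>) * J_scale \<tau> f"
    if f[measurable]: "f \<in> borel_measurable m" and \<tau>: "sep \<le> \<tau>" and P: "word_partition S P"
      "\<And>w. w \<in> P \<Longrightarrow> reach * \<tau> \<le> weight \<rho> w" "\<And>w. w \<in> P \<Longrightarrow> weight \<rho> w \<le> rho_max * (reach * \<tau>)" for f \<tau> P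
  proof -
    have \<tau>1: "1 \<le> \<tau>" "0 < \<tau>" using \<tau> sep_ge_1 by auto
    have l: "w \<in> lists S" if "w \<in> P" for w using word_partition_lists[OF P(1)] that by auto
    have fin: "finite P" by (rule word_partition_finite[OF P(1) finite_S])
    define X where "X = (\<Sum>(w, v)\<in>adjacent P. pair_integral f w v)"
    define D where "D = (\<Union>(w, v)\<in>adjacent P. cell w \<times> cell v)"
    define g where "g x y = ennreal (\<bar>f x - f y\<bar> powr p) * indicator D (x, y)" for x y
    have D[measurable]: "D \<in> sets (m \<Otimes>\<^sub>M m)"
      unfolding D_def
    proof (rule sets.finite_UN[OF finite_adjacent[OF P(1)]])
      fix e assume "e \<in> adjacent P"
      then show "(case e of (w, v) \<Rightarrow> cell w \<times> cell v) \<in> sets (m \<Otimes>\<^sub>M m)"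
        using adjacent_in by (cases e) (auto intro!: pair_measureI cell_borel l)
    qed
    have g_meas[measurable]: "(\<lambda>(x, y). g x y) \<in> borel_measurable (m \<Otimes>\<^sub>M m)"
      unfolding g_def by measurable
    define \<theta> where "\<theta> = (rho_max * (reach * \<tau>)) powr - \<alpha>"
    have \<theta>: "0 < \<theta>" unfolding \<theta>_def using rho_max_gt_1 reach_ge_1 \<tau>1 by simp
    have mass_\<theta>: "\<theta> \<le> mass w" if "w \<in> P" for w
      unfolding \<theta>_def by (rule mass_ge[OF l[OF that] P(3)[OF that]])
    let ?I = "\<lambda>w v. \<integral>\<^sup>+a. (\<integral>\<^sup>+b. g (word_map F w a) (word_map F v b) \<partial>m) \<partial>m"
    have "ennreal (\<theta> * \<theta>) * X = (\<Sum>(w, v)\<in>adjacent P. ennreal \<theta> * (ennreal \<theta> * pair_integral f w v))"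
      using \<theta> unfolding X_def sum_distrib_left by (intro sum.cong) (auto simp: ennreal_mult mult.assoc)
    also have "\<dots> \<le> (\<Sum>(w, v)\<in>adjacent P. ennreal (mass w) * (ennreal (mass v) * ?I w v))"
    proof (rule sum_mono, clarify)
      fix w v assume wv: "(w, v) \<in> adjacent P"
      have "(word_map F w a, word_map F v b) \<in> D" for a b unfolding D_def using wv by blast
      hence "?I w v = pair_integral f w v" unfolding pair_integral_def g_def by simp
      then show "ennreal \<theta> * (ennreal \<theta> * pair_integral f w v) \<le> ennreal (mass w) * (ennreal (mass v) * ?I w v)"
        using mass_\<theta> adjacent_in[OF wv] by (auto intro!: mult_mono ennreal_leI)
    qed
    also have "\<dots> \<le> (\<Sum>(w, v)\<in>P \<times> P. ennreal (mass w) * (ennreal (mass v) * ?I w v))"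
      using fin adjacent_in by (intro sum_mono2) auto
    also have "\<dots> = (\<integral>\<^sup>+x. (\<integral>\<^sup>+y. g x y \<partial>m) \<partial>m)"
      unfolding nn_integral_partition_pairs[OF P(1) g_meas] by (rule sum.cartesian_product[symmetric])
    finally have X1: "ennreal (\<theta> * \<theta>) * X \<le> (\<integral>\<^sup>+x. (\<integral>\<^sup>+y. g x y \<partial>m) \<partial>m)" .
    define k where "k = \<tau> powr (\<alpha> + 1) / (B * \<tau> powr - \<alpha>)"
    have k: "0 < k" unfolding k_def using B \<tau>1 by simp
    have pt: "ennreal k * g x y \<le> ennreal (\<bar>f x - f y\<bar> powr p * kernel \<tau> x y)" for x y
    proof (cases "(x, y) \<in> D")
      case True
      then obtain w v where wv: "(w, v) \<in> adjacent P" "x \<in> cell w" "y \<in> cell v" unfolding D_def by blast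
      have y: "y \<in> rball \<tau> x"
        using close_if_neighbours[OF P(1) _ _ \<tau>1(2) P(2) wv(2,3)] wv(1) by (simp add: adjacent_iff)
      have "0 < b * \<tau> powr - \<alpha>" using b \<tau>1 by simp
      hence pos: "0 < measure m (rball \<tau> x)" using b(2)[OF \<tau>1(1), of x] by linarith
      have "k \<le> kernel \<tau> x y"
        unfolding k_def kernel_def using B(2)[OF \<tau>, of x] pos y by (auto intro!: frac_le)
      hence "k * (\<bar>f x - f y\<bar> powr p) \<le> kernel \<tau> x y * (\<bar>f x - f y\<bar> powr p)"
        by (intro mult_right_mono) auto
      then show ?thesis using True k
        by (simp add: g_def ennreal_mult[symmetric] ennreal_leI mult_ac)
    qed (simp add: g_def)
    have "ennreal k * (ennreal (\<theta> * \<theta>) * X) \<le> ennreal k * (\<integral>\<^sup>+x. (\<integral>\<^sup>+y. g x y \<partial>m) \<partial>m)"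
      using X1 by (intro mult_left_mono) auto
    also have "\<dots> = (\<integral>\<^sup>+x. (\<integral>\<^sup>+y. ennreal k * g x y \<partial>m) \<partial>m)"
      using measurable_compose[OF measurable_Pair1' g_meas] borel_measurable_nn_integral[OF g_meas]
      by (simp add: nn_integral_cmult space_m)
    also have "\<dots> \<le> J_scale \<tau> f" unfolding J_scale_def by (intro nn_integral_mono pt)
    finally have X2: "ennreal k * (ennreal (\<theta> * \<theta>) * X) \<le> J_scale \<tau> f" .
    have k\<theta>: "k * (\<theta> * \<theta>) = \<tau> / C"
    proof -
      have 1: "k = \<tau> powr (2 * \<alpha> + 1) / B"
        unfolding k_def by (simp add: powr_diff[symmetric] divide_divide_eq_left[symmetric] mult.commute[of B])
      have "\<theta> * \<theta> = (rho_max * reach * \<tau>) powr (- \<alpha> + - \<alpha>)"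
        unfolding \<theta>_def mult.assoc by (rule powr_add[symmetric])
      also have "- \<alpha> + - \<alpha> = - (2 * \<alpha>)" by simp
      finally have 2: "\<theta> * \<theta> = (rho_max * reach) powr - (2 * \<alpha>) * \<tau> powr - (2 * \<alpha>)"
        by (simp only: powr_mult)
      have 3: "\<tau> powr (2 * \<alpha> + 1) * \<tau> powr - (2 * \<alpha>) = \<tau>"
        using \<tau>1 by (simp add: powr_add[symmetric])
      have "k * (\<theta> * \<theta>) = (\<tau> powr (2 * \<alpha> + 1) * \<tau> powr - (2 * \<alpha>)) * (rho_max * reach) powr - (2 * \<alpha>) / B"
        unfolding 1 2 by simp
      then show ?thesis unfolding 3 C_def by (simp add: powr_minus divide_inverse mult_ac)
    qed
    have "ennreal (C / \<tau>) * (ennreal k * (ennreal (\<theta> * \<theta>) * X)) = ennreal (C / \<tau>) * ennreal (k * (\<theta> * \<theta>)) * X"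
      using k by (simp only: ennreal_mult'[of k] less_imp_le mult.assoc)
    also have "ennreal (C / \<tau>) * ennreal (k * (\<theta> * \<theta>)) = 1"
      unfolding k\<theta> using C \<tau>1 by (simp add: ennreal_mult[symmetric])
    finally have "X = ennreal (C / \<tau>) * (ennreal k * (ennreal (\<theta> * \<theta>) * X))" by simp
    also have "\<dots> \<le> ennreal (C / \<tau>) * J_scale \<tau> f" using X2 by (intro mult_left_mono) auto
    finally show ?thesis unfolding X_def .
  qed
  with C show ?thesis by blast
qed

definition cell_average :: "('a \<Rightarrow> real) \<Rightarrow> 'i list \<Rightarrow> real" where
  "cell_average f w = expectation (\<lambda>a. f (word_map F w a))"

lemma Lp_comp_word:
  assumes f: "f \<in> Lp_funs p m" and P: "word_partition S P" "w \<in> P"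
  shows "(\<lambda>a. f (word_map F w a)) \<in> Lp_funs p m"
proof -
  have w: "w \<in> lists S" using word_partition_lists[OF P(1)] P(2) by auto
  have f_meas[measurable]: "f \<in> borel_measurable m" and f_int: "integrable m (\<lambda>x. \<bar>f x\<bar> powr p)"
    using f by (auto simp: Lp_funs_def)
  have [measurable]: "(\<lambda>a. f (word_map F w a)) \<in> borel_measurable m"
    using measurable_compose[OF word_map_measurable[OF w] f_meas] .
  have "ennreal (mass w) * (\<integral>\<^sup>+a. ennreal (\<bar>f (word_map F w a)\<bar> powr p) \<partial>m)
      \<le> (\<Sum>v\<in>P. ennreal (mass v) * (\<integral>\<^sup>+a. ennreal (\<bar>f (word_map F v a)\<bar> powr p) \<partial>m))"
    by (rule member_le_sum[OF P(2) _ word_partition_finite[OF P(1) finite_S]]) simp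
  also have "\<dots> = (\<integral>\<^sup>+x. ennreal (\<bar>f x\<bar> powr p) \<partial>m)"
    by (rule nn_integral_partition[symmetric, OF P(1)]) measurable
  also have "\<dots> < \<infinity>" using f_int by (simp add: integrable_iff_bounded)
  finally have "ennreal (mass w) * (\<integral>\<^sup>+a. ennreal (\<bar>f (word_map F w a)\<bar> powr p) \<partial>m) < \<infinity>" .
  moreover have "0 < mass w" unfolding mass_def using word_weight_pos[OF w] by simp
  ultimately have "(\<integral>\<^sup>+a. ennreal (\<bar>f (word_map F w a)\<bar> powr p) \<partial>m) < \<infinity>"
    by (auto simp: ennreal_mult_less_top)
  then show ?thesis unfolding Lp_funs_def by (auto intro!: integrableI_bounded)
qed

lemma cell_average_le_pair_integral:
  assumes f: "f \<in> Lp_funs p m" and P: "word_partition S P" "w \<in> P" "v \<in> P"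
  shows "(\<integral>\<^sup>+a. ennreal (\<bar>cell_average f v - f (word_map F w a)\<bar> powr p) \<partial>m) \<le> pair_integral f w v"
    and "ennreal (\<bar>cell_average f v - cell_average f w\<bar> powr p) \<le> pair_integral f w v"
proof -
  have jensen: "ennreal (\<bar>c - cell_average f z\<bar> powr p) \<le> (\<integral>\<^sup>+b. ennreal (\<bar>c - f (word_map F z b)\<bar> powr p) \<partial>m)"
    if z: "z \<in> P" for c z
    using Lp_comp_word[OF f P(1) z] unfolding cell_average_def Lp_funs_def
    by (intro abs_powr_expectation_le[OF p_ge_1]) auto
  show 1: "(\<integral>\<^sup>+a. ennreal (\<bar>cell_average f v - f (word_map F w a)\<bar> powr p) \<partial>m) \<le> pair_integral f w v"
    unfolding pair_integral_def abs_minus_commute[of "cell_average f v"] by (intro nn_integral_mono jensen P)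
  show "ennreal (\<bar>cell_average f v - cell_average f w\<bar> powr p) \<le> pair_integral f w v"
    by (rule order.trans[OF jensen[OF P(2)] 1])
qed

text \<open>
  At scale \<open>\<tau>\<close> the approximant interpolates the averages of \<open>f\<close> over the cells of weight about \<open>\<tau>\<close>: each
  vertex receives the average over one of the cells containing it.  Its energy and its \<open>L\<^sup>p\<close>-distance
  to \<open>f\<close> are controlled by differences of averages over adjacent cells, hence, by Jensen's inequality, by
  double integrals over pairs of adjacent cells.
\<close>

lemma cell_average_approximation:
  "\<exists>C\<ge>1. \<forall>f\<in>Lp_funs p m. \<forall>\<tau>\<ge>sep. \<forall>j\<ge>0. J_scale \<tau> f \<le> ennreal j \<longrightarrow>
     (\<exists>u\<in>\<F>. \<E> u \<le> C * j \<and> (\<integral>\<^sup>+x. ennreal (\<bar>u x - f x\<bar> powr p) \<partial>m) \<le> ennreal (C * j / \<tau>))"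
proof -
  obtain C0 where C0: "0 < C0" and pairs: "\<And>f \<tau> P. f \<in> borel_measurable m \<Longrightarrow> sep \<le> \<tau> \<Longrightarrow> word_partition S P \<Longrightarrow>
     (\<forall>w\<in>P. reach * \<tau> \<le> weight \<rho> w \<and> weight \<rho> w \<le> rho_max * (reach * \<tau>)) \<Longrightarrow>
     (\<Sum>(w, v)\<in>adjacent P. pair_integral f w v) \<le> ennreal (C0 / \<tau>) * J_scale \<tau> f"
    using pair_integrals_le_J by blast
  define c1 where "c1 = interp_const * real (card V0)"
  define C where "C = 1 + rho_max * reach * c1 * C0 + 2 powr p * (c1 + 1) * C0"
  have c1: "0 \<le> c1" unfolding c1_def using interp_const_pos by simp
  have coeffs0: "0 \<le> rho_max * reach * c1 * C0" "0 \<le> 2 powr p * (c1 + 1) * C0"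
    using c1 C0 rho_max_gt_1 reach_ge_1 by auto
  have "\<exists>u\<in>\<F>. \<E> u \<le> C * j \<and> (\<integral>\<^sup>+x. ennreal (\<bar>u x - f x\<bar> powr p) \<partial>m) \<le> ennreal (C * j / \<tau>)"
    if f: "f \<in> Lp_funs p m" and \<tau>: "sep \<le> \<tau>" and j: "0 \<le> j" "J_scale \<tau> f \<le> ennreal j" for f \<tau> j
  proof -
    have f_meas[measurable]: "f \<in> borel_measurable m" using f by (auto simp: Lp_funs_def)
    define t where "t = reach * \<tau>"
    have \<tau>1: "1 \<le> \<tau>" "0 < \<tau>" using \<tau> sep_ge_1 by auto
    have t: "1 \<le> t" "0 < t" using \<tau>1 reach_ge_1 mult_mono[of 1 reach 1 \<tau>] by (auto simp: t_def)
    obtain P where P: "word_partition S P" "\<And>w. w \<in> P \<Longrightarrow> t \<le> weight \<rho> w"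
      "\<And>w. w \<in> P \<Longrightarrow> weight \<rho> w \<le> rho_max * t" using partition_of_weight[OF t(1)] by blast
    have l: "w \<in> lists S" if "w \<in> P" for w using word_partition_lists[OF P(1)] that by auto
    have fin: "finite P" by (rule word_partition_finite[OF P(1) finite_S])
    have fin_nb: "finite (neighbours P w)" for w by (rule finite_subset[OF neighbours_subset fin])
    let ?avg = "cell_average f"
    define \<xi> where "\<xi> = C0 / \<tau> * j"
    have \<xi>: "0 \<le> \<xi>" "\<tau> * \<xi> = C0 * j" using C0 \<tau>1 j by (auto simp: \<xi>_def)
    have X: "(\<Sum>(w, v)\<in>adjacent P. pair_integral f w v) \<le> ennreal \<xi>"
    proof -
      have "(\<Sum>(w, v)\<in>adjacent P. pair_integral f w v) \<le> ennreal (C0 / \<tau>) * J_scale \<tau> f"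
        using P by (intro pairs f_meas \<tau>) (auto simp: t_def)
      also have "\<dots> \<le> ennreal (C0 / \<tau>) * ennreal j" using j by (intro mult_left_mono) auto
      finally show ?thesis by (simp only: \<xi>_def ennreal_mult''[OF j(1)])
    qed
    have avg_sum: "(\<Sum>w\<in>P. \<Sum>v\<in>neighbours P w. \<bar>?avg v - ?avg w\<bar> powr p) \<le> \<xi>"
    proof -
      have "ennreal (\<Sum>(w, v)\<in>adjacent P. \<bar>?avg v - ?avg w\<bar> powr p)
          = (\<Sum>(w, v)\<in>adjacent P. ennreal (\<bar>?avg v - ?avg w\<bar> powr p))"
        unfolding case_prod_beta by (rule sum_ennreal[symmetric]) simp
      also have "\<dots> \<le> (\<Sum>(w, v)\<in>adjacent P. pair_integral f w v)"
        using cell_average_le_pair_integral(2)[OF f P(1)] adjacent_in by (intro sum_mono) auto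
      also note X
      finally have "(\<Sum>(w, v)\<in>adjacent P. \<bar>?avg v - ?avg w\<bar> powr p) \<le> \<xi>"
        using \<xi>(1) by (simp add: ennreal_le_iff)
      then show ?thesis unfolding adjacent_def using fin fin_nb by (subst sum.Sigma) auto
    qed
    \<comment> \<open>The cell whose average is assigned to a point.\<close>
    obtain cw where cw: "\<And>x. cw x \<in> P" "\<And>x. x \<in> cell (cw x)" using cells_cover[OF P(1)] by metis
    define val where "val x = ?avg (cw x)" for x
    define s where "s w = interp_const * vertex_deviation val w (?avg w)" for w
    have s0: "0 \<le> s w" for w
      unfolding s_def vertex_deviation_def using interp_const_pos by (intro mult_nonneg_nonneg sum_nonneg) auto
    have "s w \<le> c1 * (\<Sum>v\<in>neighbours P w. \<bar>?avg v - ?avg w\<bar> powr p)" if w: "w \<in> P" for w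
    proof -
      have "\<bar>val (word_map F w q) - ?avg w\<bar> powr p \<le> (\<Sum>v\<in>neighbours P w. \<bar>?avg v - ?avg w\<bar> powr p)" for q
      proof -
        have "word_map F w q \<in> cell w \<inter> cell (cw (word_map F w q))" using cw(2) by blast
        hence "cw (word_map F w q) \<in> neighbours P w" using cw(1) unfolding neighbours_def by blast
        from member_le_sum[OF this, of "\<lambda>v. \<bar>?avg v - ?avg w\<bar> powr p"]
        show ?thesis using fin_nb by (simp add: val_def)
      qed
      hence "vertex_deviation val w (?avg w) \<le> (\<Sum>q\<in>V0. \<Sum>v\<in>neighbours P w. \<bar>?avg v - ?avg w\<bar> powr p)"
        unfolding vertex_deviation_def by (intro sum_mono)
      from mult_left_mono[OF this, of interp_const]
      show ?thesis using interp_const_pos by (simp add: s_def c1_def mult.assoc)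
    qed
    hence "(\<Sum>w\<in>P. s w) \<le> c1 * (\<Sum>w\<in>P. \<Sum>v\<in>neighbours P w. \<bar>?avg v - ?avg w\<bar> powr p)"
      unfolding sum_distrib_left[of c1] by (intro sum_mono)
    also have "\<dots> \<le> c1 * \<xi>" by (intro mult_left_mono avg_sum c1)
    finally have s_sum: "(\<Sum>w\<in>P. s w) \<le> c1 * \<xi>" .
    obtain u where u: "u \<in> \<F>" "\<And>w. w \<in> P \<Longrightarrow> \<E> (u \<circ> word_map F w) \<le> s w"
      "\<And>w x. w \<in> P \<Longrightarrow> \<bar>u (word_map F w x) - ?avg w\<bar> powr p \<le> s w"
      unfolding s_def by (rule interpolation[OF P(1), of val ?avg]) blast
    have "\<E> u = (\<Sum>w\<in>P. weight \<rho> w * \<E> (u \<circ> word_map F w))" by (rule energy_partition[OF P(1) u(1)])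
    also have "\<dots> \<le> (\<Sum>w\<in>P. rho_max * t * s w)"
      using rho_max_gt_1 t by (intro sum_mono mult_mono P u energy_nonneg comp_word_in l) auto
    also have "\<dots> \<le> rho_max * t * (c1 * \<xi>)"
      unfolding sum_distrib_left[symmetric] using rho_max_gt_1 t by (intro mult_left_mono s_sum) auto
    also have "\<dots> = rho_max * reach * c1 * (\<tau> * \<xi>)" by (simp add: t_def)
    also have "\<dots> \<le> C * j"
      unfolding \<xi>(2) using mult_right_mono[of "rho_max * reach * c1 * C0" C j] coeffs0 j(1) by (simp add: C_def mult.assoc)
    finally have E: "\<E> u \<le> C * j" .
    have wm: "word_map F w \<in> m \<rightarrow>\<^sub>M m" if "w \<in> P" for w by (rule word_map_measurable[OF l[OF that]])
    note [measurable] = form_measurable_m[OF u(1)]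
    have "(\<integral>\<^sup>+x. ennreal (\<bar>u x - f x\<bar> powr p) \<partial>m)
        = (\<Sum>w\<in>P. ennreal (mass w) * (\<integral>\<^sup>+a. ennreal (\<bar>u (word_map F w a) - f (word_map F w a)\<bar> powr p) \<partial>m))"
      by (rule nn_integral_partition[OF P(1)]) measurable
    also have "\<dots> \<le> (\<Sum>w\<in>P. ennreal (2 powr p) * (ennreal (s w) + pair_integral f w w))"
    proof (rule sum_mono)
      fix w assume w: "w \<in> P"
      note [measurable] = measurable_compose[OF wm[OF w] f_meas] measurable_compose[OF wm[OF w] form_measurable_m[OF u(1)]]
      have "mass w \<le> t powr - \<alpha>" by (rule mass_le[OF t(2) P(2)[OF w]])
      also have "\<dots> \<le> t powr 0" using t alpha_pos by (intro powr_mono) auto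
      finally have m1: "ennreal (mass w) \<le> 1" using t by simp
      let ?L = "\<integral>\<^sup>+a. ennreal (\<bar>u (word_map F w a) - f (word_map F w a)\<bar> powr p) \<partial>m"
      have "?L \<le> ennreal (2 powr p) * ((\<integral>\<^sup>+a. ennreal (\<bar>u (word_map F w a) - ?avg w\<bar> powr p) \<partial>m)
            + (\<integral>\<^sup>+a. ennreal (\<bar>?avg w - f (word_map F w a)\<bar> powr p) \<partial>m))"
        by (rule nn_integral_diff_powr_le[OF p_pos]) measurable
      also have "\<dots> \<le> ennreal (2 powr p) * ((\<integral>\<^sup>+a. ennreal (s w) \<partial>m) + pair_integral f w w)"
        by (intro mult_left_mono add_mono nn_integral_mono ennreal_leI u(3)
            cell_average_le_pair_integral(1)[OF f P(1)] w) simp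
      finally have "ennreal (mass w) * ?L \<le> 1 * (ennreal (2 powr p) * ((\<integral>\<^sup>+a. ennreal (s w) \<partial>m) + pair_integral f w w))"
        using m1 by (intro mult_mono) auto
      then show "ennreal (mass w) * ?L \<le> ennreal (2 powr p) * (ennreal (s w) + pair_integral f w w)"
        by (simp add: emeasure_space_1)
    qed
    also have "\<dots> = ennreal (2 powr p) * (ennreal (\<Sum>w\<in>P. s w) + (\<Sum>w\<in>P. pair_integral f w w))"
      unfolding sum_distrib_left[symmetric] sum.distrib using s0 by (simp add: sum_ennreal)
    also have "\<dots> \<le> ennreal (2 powr p) * (ennreal (c1 * \<xi>) + ennreal \<xi>)"
    proof (intro mult_left_mono add_mono ennreal_leI s_sum)
      have "(\<Sum>w\<in>P. pair_integral f w w) = (\<Sum>(w, v)\<in>(\<lambda>w. (w, w)) ` P. pair_integral f w v)"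
        by (subst sum.reindex) (auto simp: inj_on_def)
      also have "\<dots> \<le> (\<Sum>(w, v)\<in>adjacent P. pair_integral f w v)"
        using finite_adjacent[OF P(1)] self_neighbour by (intro sum_mono2) (auto simp: adjacent_iff)
      also note X
      finally show "(\<Sum>w\<in>P. pair_integral f w w) \<le> ennreal \<xi>" .
    qed auto
    also have "\<dots> = ennreal (2 powr p * (c1 * \<xi> + \<xi>))"
      using c1 \<xi>(1) by (simp add: ennreal_mult')
    also have "2 powr p * (c1 * \<xi> + \<xi>) = 2 powr p * (c1 + 1) * C0 * j / \<tau>"
      by (simp add: \<xi>_def add_divide_distrib algebra_simps)
    also have "\<dots> \<le> ennreal (C * j / \<tau>)"
      using coeffs0 j(1) \<tau>1 by (intro ennreal_leI divide_right_mono mult_right_mono) (auto simp: C_def)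
    finally show ?thesis using u(1) E by blast
  qed
  moreover have "1 \<le> C" using coeffs0 by (simp add: C_def)
  ultimately show ?thesis by blast
qed

end

section \<open>The Korevaar-Schoen space of the resistance metric\<close>

lemma J_functional_cong_AE:
  assumes ae: "AE x in m. f x = u x"
  shows "J_functional p m k r f = J_functional p m k r u"
  unfolding J_functional_def
proof (rule nn_integral_cong_AE)
  show "AE x in m. (\<integral>\<^sup>+y. ennreal (\<bar>f x - f y\<bar> powr p * k r x y) \<partial>m)
      = (\<integral>\<^sup>+y. ennreal (\<bar>u x - u y\<bar> powr p * k r x y) \<partial>m)"
    using ae
  proof eventually_elim
    fix x assume x: "f x = u x"
    show "(\<integral>\<^sup>+y. ennreal (\<bar>f x - f y\<bar> powr p * k r x y) \<partial>m)
      = (\<integral>\<^sup>+y. ennreal (\<bar>u x - u y\<bar> powr p * k r x y) \<partial>m)"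
      by (rule nn_integral_cong_AE) (use ae in eventually_elim, simp add: x)
  qed
qed

lemma J_liminf_le_J_sup: "J_liminf p m k f \<le> J_sup p m k f"
proof -
  have "J_liminf p m k f \<le> Liminf (at_right (0::real)) (\<lambda>_. J_sup p m k f)"
    unfolding J_liminf_def
  proof (rule Liminf_mono)
    show "\<forall>\<^sub>F r in at_right (0::real). J_functional p m k r f \<le> J_sup p m k f"
      using eventually_at_right_less[of "0::real"]
      by eventually_elim (auto simp: J_sup_def intro!: SUP_upper)
  qed
  also have "\<dots> = J_sup p m k f" by (intro Liminf_const) simp
  finally show ?thesis .
qed

context pcf_energy
begin

abbreviation R :: "'a \<Rightarrow> 'a \<Rightarrow> real" where
  "R \<equiv> p_resistance_metric p \<E> \<F>"

definition s_crit :: real where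
  "s_crit = (df + p - 1) / p"

lemma s_crit_pos: "0 < s_crit"
  using df_pos p_gt_1 by (simp add: s_crit_def)

lemma metric_ball_eq:
  assumes r: "0 < r"
  shows "{z. R x z < r} = rball (r powr (1 - p)) x"
proof -
  have inv: "1 / r powr (1 - p) = r powr (p - 1)"
    using powr_minus_divide[of r "1 - p"] by simp
  have "Res x z powr (1 / (p - 1)) < r \<longleftrightarrow> Res x z < r powr (p - 1)" for z
  proof -
    have *: "(Res x z powr (1 / (p - 1))) powr (p - 1) = Res x z"
      using p_gt_1 Res_nonneg[of x z] by (simp add: powr_powr)
    show ?thesis
      using powr_less_mono2[of "p - 1" "Res x z powr (1 / (p - 1))" r]
        powr_mono2[of "p - 1" r "Res x z powr (1 / (p - 1))"] p_gt_1 r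
      unfolding * by (auto simp: not_less[symmetric])
  qed
  then show ?thesis by (simp add: rball_def inv p_resistance_metric_def Res_def[symmetric])
qed

lemma J_critical:
  assumes r: "0 < r"
  shows "J_functional p m (ks_kernel p R m s_crit) r f = J_scale (r powr (1 - p)) f"
proof -
  have "(r powr (1 - p)) powr (\<alpha> + 1) = r powr - (p * s_crit)"
  proof -
    have "(1 - p) * (\<alpha> + 1) = - (p * s_crit)"
      using p_gt_1 by (simp add: \<alpha>_def s_crit_def field_simps)
    then show ?thesis by (simp add: powr_powr)
  qed
  hence "ks_kernel p R m s_crit r x y = kernel (r powr (1 - p)) x y" for x y
    unfolding ks_kernel_def kernel_def metric_ball_eq[OF r]
    by (simp add: powr_minus divide_inverse)
  then show ?thesis unfolding J_functional_def J_scale_def by simp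
qed

lemma J_exponent_compare:
  assumes r: "0 < r"
  shows "J_functional p m (ks_kernel p R m s_crit) r f
    \<le> ennreal (r powr (p * (s - s_crit))) * J_functional p m (ks_kernel p R m s) r f"
proof -
  let ?c = "r powr (p * (s - s_crit))"
  have c: "0 < ?c" using r by simp
  have ker: "ks_kernel p R m s_crit r x y = ?c * ks_kernel p R m s r x y" for x y
  proof -
    have c_eq: "?c = r powr (p * s) / r powr (p * s_crit)"
      by (simp add: right_diff_distrib powr_diff)
    show ?thesis using r unfolding ks_kernel_def c_eq by simp
  qed
  have "J_functional p m (ks_kernel p R m s_crit) r f
      = (\<integral>\<^sup>+x. (\<integral>\<^sup>+y. ennreal ?c * ennreal (\<bar>f x - f y\<bar> powr p * ks_kernel p R m s r x y) \<partial>m) \<partial>m)"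
    unfolding J_functional_def ker
    by (simp add: ennreal_mult'[symmetric] mult_ac)
  also have "\<dots> \<le> (\<integral>\<^sup>+x. ennreal ?c * (\<integral>\<^sup>+y. ennreal (\<bar>f x - f y\<bar> powr p * ks_kernel p R m s r x y) \<partial>m) \<partial>m)"
    by (intro nn_integral_mono nn_integral_cmult_le c)
  also have "\<dots> \<le> ennreal ?c * J_functional p m (ks_kernel p R m s) r f"
    unfolding J_functional_def by (rule nn_integral_cmult_le[OF c])
  finally show ?thesis .
qed

lemma J_sup_le_energy:
  "\<exists>C\<ge>1. \<forall>u\<in>\<F>. J_sup p m (ks_kernel p R m s_crit) u \<le> ennreal (C * \<E> u)"
proof -
  obtain C where C: "1 \<le> C" "\<And>u \<tau>. u \<in> \<F> \<Longrightarrow> 0 < \<tau> \<Longrightarrow> J_scale \<tau> u \<le> ennreal (C * \<E> u)"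
    using J_scale_le_energy by blast
  have "J_sup p m (ks_kernel p R m s_crit) u \<le> ennreal (C * \<E> u)" if "u \<in> \<F>" for u
    unfolding J_sup_def
  proof (rule SUP_least)
    fix r :: real assume "r \<in> {0<..}"
    then show "J_functional p m (ks_kernel p R m s_crit) r u \<le> ennreal (C * \<E> u)"
      using C(2)[OF that, of "r powr (1 - p)"] by (simp add: J_critical)
  qed
  with C(1) show ?thesis by blast
qed

text \<open>
  Along scales on which \<open>J\<close> is close to its lower limit, the approximants of bounded energy converge
  to \<open>f\<close>; lower semicontinuity of the energy concludes.
\<close>

lemma energy_le_J_liminf:
  "\<exists>C\<ge>1. \<forall>f\<in>Lp_funs p m. J_liminf p m (ks_kernel p R m s_crit) f < \<infinity> \<longrightarrow>
     (\<exists>u\<in>\<F>. (AE x in m. f x = u x) \<and>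
        ennreal (\<E> u) \<le> ennreal C * J_liminf p m (ks_kernel p R m s_crit) f)"
proof -
  obtain C where C: "1 \<le> C" and approx: "\<And>f \<tau> j. f \<in> Lp_funs p m \<Longrightarrow> sep \<le> \<tau> \<Longrightarrow> 0 \<le> j \<Longrightarrow> J_scale \<tau> f \<le> ennreal j \<Longrightarrow>
     (\<exists>u\<in>\<F>. \<E> u \<le> C * j \<and> (\<integral>\<^sup>+x. ennreal (\<bar>u x - f x\<bar> powr p) \<partial>m) \<le> ennreal (C * j / \<tau>))"
    using cell_average_approximation by blast
  have "\<exists>u\<in>\<F>. (AE x in m. f x = u x) \<and>
        ennreal (\<E> u) \<le> ennreal C * J_liminf p m (ks_kernel p R m s_crit) f"
    if f: "f \<in> Lp_funs p m" and fin: "J_liminf p m (ks_kernel p R m s_crit) f < \<infinity>" for f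
  proof -
    have f_meas: "f \<in> borel_measurable m" using f by (simp add: Lp_funs_def)
    define J where "J r = J_functional p m (ks_kernel p R m s_crit) r f" for r
    obtain l where l: "J_liminf p m (ks_kernel p R m s_crit) f = ennreal l" "0 \<le> l"
      using fin by (metis ennreal_cases infinity_ennreal_def less_irrefl)
    have lim: "Liminf (at_right 0) J = ennreal l"
      using l(1) by (simp add: J_liminf_def J_def[abs_def])
    have near: "\<exists>u\<in>\<F>. (AE x in m. f x = u x) \<and> \<E> u \<le> C * l'" if l': "l < l'" for l'
    proof (rule energy_lower_semicontinuous[OF prob_m form_measurable_m oscillation f_meas])
      fix e :: real assume e: "0 < e"
      define T where "T = max sep (C * l' / e)"
      have T: "0 < T" using sep_ge_1 by (simp add: T_def)
      \<comment> \<open>Below the radius \<open>r0\<close>, the scale \<open>\<tau> = r\<^bsup>1 - p\<^esup>\<close> exceeds the threshold \<open>T\<close>.\<close>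
      define r0 where "r0 = T powr (1 / (1 - p))"
      have "\<forall>\<^sub>F r in at_right 0. r \<in> {0<..<r0}"
        using T by (intro eventually_at_right_real) (simp add: r0_def)
      moreover have "\<exists>\<^sub>F r in at_right 0. J r < ennreal l'"
      proof (rule ccontr)
        assume "\<not> ?thesis"
        hence "\<forall>\<^sub>F r in at_right 0. ennreal l' \<le> J r" by (simp add: not_frequently not_less)
        hence "ennreal l' \<le> Liminf (at_right 0) J" by (rule Liminf_bounded)
        hence "ennreal l' \<le> ennreal l" unfolding lim .
        then show False using l' l(2) by (simp add: ennreal_le_iff)
      qed
      ultimately have "\<exists>\<^sub>F r in at_right 0. J r < ennreal l' \<and> r \<in> {0<..<r0}"
        by (intro frequently_eventually_frequently)
      then obtain r where r: "J r < ennreal l'" "0 < r" "r < r0"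
        by (auto dest: frequently_ex)
      define \<tau> where "\<tau> = r powr (1 - p)"
      have "T = r0 powr (1 - p)" using T p_gt_1 by (simp add: r0_def powr_powr)
      also have "\<dots> < \<tau>"
        unfolding \<tau>_def using r p_gt_1 by (intro powr_less_mono2_neg) auto
      finally have \<tau>: "T < \<tau>" .
      have "J r = J_scale \<tau> f" unfolding J_def \<tau>_def by (rule J_critical[OF r(2)])
      hence "J_scale \<tau> f \<le> ennreal l'" using r(1) by simp
      then obtain v where v: "v \<in> \<F>" "\<E> v \<le> C * l'"
        "(\<integral>\<^sup>+x. ennreal (\<bar>v x - f x\<bar> powr p) \<partial>m) \<le> ennreal (C * l' / \<tau>)"
        using approx[OF f, of \<tau> l'] \<tau> l' l(2) by (auto simp: T_def)
      have "C * l' / e \<le> \<tau>" using \<tau> by (simp add: T_def)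
      hence "C * l' / \<tau> \<le> e" using e \<tau> T by (simp add: field_simps)
      then show "\<exists>v\<in>\<F>. \<E> v \<le> C * l' \<and> (\<integral>\<^sup>+x. ennreal (\<bar>v x - f x\<bar> powr p) \<partial>m) \<le> ennreal e"
        using v by (meson ennreal_leI order.trans)
    qed
    obtain u where u: "u \<in> \<F>" "AE x in m. f x = u x" using near[of "l + 1"] by auto
    have E: "\<E> u \<le> C * l'" if l': "l < l'" for l'
    proof -
      obtain v where v: "v \<in> \<F>" "AE x in m. f x = v x" "\<E> v \<le> C * l'" using near[OF l'] by auto
      have "AE x in m. u x = v x" using u(2) v(2) by eventually_elim simp
      then show ?thesis using ae_eq_imp_eq[OF u(1) v(1)] v(3) by simp
    qed
    have "\<E> u \<le> C * l"
    proof (rule field_le_epsilon)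
      fix e :: real assume "0 < e"
      moreover have "C * (l + e / C) = C * l + e" using C by (simp add: distrib_left)
      ultimately show "\<E> u \<le> C * l + e" using E[of "l + e / C"] C by simp
    qed
    hence "ennreal (\<E> u) \<le> ennreal C * ennreal l"
      using C by (simp add: ennreal_mult'[symmetric] ennreal_leI)
    then show ?thesis using u l(1) by auto
  qed
  with C show ?thesis by blast
qed

lemma representative_in_Lp:
  assumes f: "f \<in> borel_measurable m" and u: "u \<in> \<F>" and ae: "AE x in m. f x = u x"
  shows "f \<in> Lp_funs p m"
proof -
  define B where "B = \<bar>u undefined\<bar> + \<Delta> * energy_norm u"
  have "\<bar>u x\<bar> \<le> B" for x using oscillation[OF u, of x undefined] by (simp add: B_def)
  hence le: "\<bar>u x\<bar> powr p \<le> B powr p" for x using p_pos by (intro powr_mono2) auto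
  have "AE x in m. norm (\<bar>f x\<bar> powr p) \<le> B powr p" using ae by eventually_elim (simp add: le)
  then show ?thesis
    using f unfolding Lp_funs_def by (auto intro!: integrable_const_bound[where B = "B powr p"])
qed

lemma extended_energy_eq:
  assumes f: "f \<in> borel_measurable m" and u: "u \<in> \<F>" and ae: "AE x in m. f x = u x"
  shows "extended_energy m \<E> \<F> f = ennreal (\<E> u)"
proof -
  have "(THE v. v \<in> \<F> \<and> (AE x in m. f x = v x)) = u"
  proof (rule the_equality)
    fix v assume v: "v \<in> \<F> \<and> (AE x in m. f x = v x)"
    hence "AE x in m. v x = u x" using ae by (auto elim: AE_mp)
    then show "v = u" using ae_eq_imp_eq[of v u] v u by blast
  qed (use u ae in blast)
  then show ?thesis
    using f u ae unfolding extended_energy_def ae_representatives_def by auto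
qed

text \<open>
  If \<open>J\<close> is bounded for some exponent above \<open>s_crit\<close>, then the critical \<open>J\<close> tends to \<open>0\<close> with the radius, so the
  energy of the function vanishes.
\<close>

lemma critical_exponent: "ks_exponent p R m = ereal s_crit"
proof -
  let ?K = "\<lambda>s. ks_kernel p R m s"
  define A where "A = {s. 0 < s \<and> (\<exists>f\<in>besov_space p m (?K s). \<not> (\<exists>c. AE x in m. f x = c))}"
  have "s_crit \<in> A"
  proof -
    obtain u where u: "u \<in> \<F>" "\<not> (\<exists>c. AE x in m. u x = c)" using ex_nonconstant by blast
    obtain C where "J_sup p m (?K s_crit) u \<le> ennreal (C * \<E> u)" using J_sup_le_energy u(1) by blast
    hence "J_sup p m (?K s_crit) u < \<infinity>" by (rule le_less_trans) simp
    moreover have "u \<in> Lp_funs p m"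
      by (rule representative_in_Lp[OF form_measurable_m[OF u(1)] u(1)]) simp
    ultimately show ?thesis using u s_crit_pos unfolding A_def besov_space_def by blast
  qed
  moreover have "s \<le> s_crit" if s: "s \<in> A" for s
  proof (rule ccontr)
    assume "\<not> ?thesis"
    hence \<delta>: "0 < p * (s - s_crit)" using p_pos by simp
    obtain f where f: "f \<in> Lp_funs p m" "J_sup p m (?K s) f < \<infinity>" "\<not> (\<exists>c. AE x in m. f x = c)"
      using s by (auto simp: A_def besov_space_def)
    obtain M where M: "J_sup p m (?K s) f = ennreal M" "0 \<le> M"
      using f(2) by (metis ennreal_cases infinity_ennreal_def less_irrefl)
    have "((\<lambda>r. r powr (p * (s - s_crit))) \<longlongrightarrow> 0) (at_right (0::real))"
      using \<delta> by (intro tendsto_zero_powrI[where b = "p * (s - s_crit)"])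
        (auto intro: tendsto_ident_at simp: eventually_at_filter)
    from tendsto_mult_left_zero[OF this, of M]
    have lim: "((\<lambda>r. ennreal (r powr (p * (s - s_crit)) * M)) \<longlongrightarrow> ennreal 0) (at_right (0::real))"
      by (rule tendsto_ennrealI)
    have "J_liminf p m (?K s_crit) f \<le> Liminf (at_right 0) (\<lambda>r. ennreal (r powr (p * (s - s_crit)) * M))"
      unfolding J_liminf_def
    proof (rule Liminf_mono)
      show "\<forall>\<^sub>F r in at_right 0. J_functional p m (?K s_crit) r f \<le> ennreal (r powr (p * (s - s_crit)) * M)"
        using eventually_at_right_less[of "0::real"]
      proof eventually_elim
        fix r :: real assume r: "0 < r"
        have "J_functional p m (?K s) r f \<le> ennreal M"
          unfolding M(1)[symmetric] J_sup_def using r by (intro SUP_upper) auto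
        hence "ennreal (r powr (p * (s - s_crit))) * J_functional p m (?K s) r f
            \<le> ennreal (r powr (p * (s - s_crit))) * ennreal M"
          by (intro mult_left_mono) auto
        then show "J_functional p m (?K s_crit) r f \<le> ennreal (r powr (p * (s - s_crit)) * M)"
          using J_exponent_compare[OF r, of f s] by (simp add: ennreal_mult')
      qed
    qed
    also have "\<dots> = ennreal 0" by (rule lim_imp_Liminf[OF _ lim]) simp
    finally have zero: "J_liminf p m (?K s_crit) f = 0" by simp
    obtain C where C: "\<forall>f\<in>Lp_funs p m. J_liminf p m (?K s_crit) f < \<infinity> \<longrightarrow>
       (\<exists>u\<in>\<F>. (AE x in m. f x = u x) \<and> ennreal (\<E> u) \<le> ennreal C * J_liminf p m (?K s_crit) f)"
      using energy_le_J_liminf by blast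
    obtain u where u: "u \<in> \<F>" "AE x in m. f x = u x" "ennreal (\<E> u) \<le> 0"
      using C[rule_format, OF f(1)] zero by auto
    have "\<E> u = 0" using u(3) energy_nonneg[OF u(1)] by (simp add: ennreal_eq_0_iff)
    then obtain c where "u = (\<lambda>_. c)" using energy_zero_iff[OF u(1)] by blast
    then show False using u(2) f(3) by auto
  qed
  ultimately have "Sup (ereal ` A) = ereal s_crit"
    by (intro antisym Sup_least Sup_upper) auto
  then show ?thesis unfolding ks_exponent_def A_def .
qed

lemma critical_kernel: "ks_critical_kernel p R m = ks_kernel p R m s_crit"
  by (simp add: ks_critical_kernel_def critical_exponent)

theorem korevaar_schoen_characterization:
  "ks_exponent p R m = ereal ((df + p - 1) / p)
    \<and> ae_representatives m \<F> = ks_space p R m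
    \<and> weak_monotonicity p m (ks_critical_kernel p R m)
    \<and> (\<exists>C::real. C \<ge> 1 \<and> (\<forall>f\<in>Lp_funs p m.
          ennreal (1 / C) * J_sup p m (ks_critical_kernel p R m) f \<le> extended_energy m \<E> \<F> f
        \<and> extended_energy m \<E> \<F> f \<le> ennreal C * J_liminf p m (ks_critical_kernel p R m) f))"
proof -
  define k where "k = ks_kernel p R m s_crit"
  obtain C1 where C1: "1 \<le> C1" "\<And>u. u \<in> \<F> \<Longrightarrow> J_sup p m k u \<le> ennreal (C1 * \<E> u)"
    using J_sup_le_energy unfolding k_def by blast
  obtain C2 where C2: "1 \<le> C2" and low: "\<And>f. f \<in> Lp_funs p m \<Longrightarrow> J_liminf p m k f < \<infinity> \<Longrightarrow>
     (\<exists>u\<in>\<F>. (AE x in m. f x = u x) \<and> ennreal (\<E> u) \<le> ennreal C2 * J_liminf p m k f)"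
    using energy_le_J_liminf unfolding k_def by blast
  have up: "J_sup p m k f \<le> ennreal (C1 * \<E> u)" if "u \<in> \<F>" "AE x in m. f x = u x" for f u
    using C1(2)[OF that(1)] unfolding J_sup_def J_functional_cong_AE[OF that(2)] .
  have meas: "f \<in> borel_measurable m" if "f \<in> Lp_funs p m" for f using that by (simp add: Lp_funs_def)
  have fin: "f \<in> Lp_funs p m" "J_liminf p m k f < \<infinity>" if "f \<in> besov_space p m k" for f
    using that le_less_trans[OF J_liminf_le_J_sup] by (auto simp: besov_space_def)
  have "ae_representatives m \<F> = besov_space p m k"
  proof (intro set_eqI iffI)
    fix f assume "f \<in> ae_representatives m \<F>"
    then obtain u where u: "f \<in> borel_measurable m" "u \<in> \<F>" "AE x in m. f x = u x"
      by (auto simp: ae_representatives_def)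
    have "J_sup p m k f < \<infinity>" using up[OF u(2,3)] by (rule le_less_trans) simp
    then show "f \<in> besov_space p m k"
      using representative_in_Lp[OF u] by (simp add: besov_space_def)
  next
    fix f assume "f \<in> besov_space p m k"
    then show "f \<in> ae_representatives m \<F>"
      using low[OF fin] meas[OF fin(1)] by (auto simp: ae_representatives_def)
  qed
  moreover have "weak_monotonicity p m k"
    unfolding weak_monotonicity_def
  proof (intro exI[of _ "C1 * C2"] conjI ballI)
    show "1 \<le> C1 * C2" using C1(1) C2 mult_mono[of 1 C1 1 C2] by simp
    fix f assume f: "f \<in> besov_space p m k"
    obtain u where u: "u \<in> \<F>" "AE x in m. f x = u x" "ennreal (\<E> u) \<le> ennreal C2 * J_liminf p m k f"
      using low[OF fin[OF f]] by blast
    have "J_sup p m k f \<le> ennreal C1 * ennreal (\<E> u)"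
      using up[OF u(1,2)] C1(1) by (simp add: ennreal_mult')
    also have "\<dots> \<le> ennreal C1 * (ennreal C2 * J_liminf p m k f)"
      by (intro mult_left_mono u(3)) simp
    also have "\<dots> = ennreal (C1 * C2) * J_liminf p m k f"
      using C1(1) by (simp add: ennreal_mult' mult.assoc)
    finally show "J_sup p m k f \<le> ennreal (C1 * C2) * J_liminf p m k f" .
  qed
  moreover have "\<exists>C::real. C \<ge> 1 \<and> (\<forall>f\<in>Lp_funs p m.
          ennreal (1 / C) * J_sup p m k f \<le> extended_energy m \<E> \<F> f
        \<and> extended_energy m \<E> \<F> f \<le> ennreal C * J_liminf p m k f)"
  proof (intro exI[of _ "C1 + C2"] conjI ballI)
    show "1 \<le> C1 + C2" using C1 C2 by simp
    fix f assume f: "f \<in> Lp_funs p m"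
    show "ennreal (1 / (C1 + C2)) * J_sup p m k f \<le> extended_energy m \<E> \<F> f"
    proof (cases "f \<in> ae_representatives m \<F>")
      case True
      then obtain u where u: "u \<in> \<F>" "AE x in m. f x = u x" by (auto simp: ae_representatives_def)
      have "ennreal (1 / (C1 + C2)) * J_sup p m k f \<le> ennreal (1 / (C1 + C2)) * ennreal (C1 * \<E> u)"
        by (intro mult_left_mono up u) simp
      also have "\<dots> = ennreal (C1 / (C1 + C2) * \<E> u)" using C1 C2 by (simp add: ennreal_mult'[symmetric])
      also have "\<dots> \<le> ennreal (1 * \<E> u)"
        using C1 C2 energy_nonneg[OF u(1)] by (intro ennreal_leI mult_right_mono) auto
      finally show ?thesis using extended_energy_eq[OF meas[OF f] u] by simp
    qed (simp add: extended_energy_def)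
    show "extended_energy m \<E> \<F> f \<le> ennreal (C1 + C2) * J_liminf p m k f"
    proof (cases "J_liminf p m k f < \<infinity>")
      case True
      then obtain u where u: "u \<in> \<F>" "AE x in m. f x = u x" "ennreal (\<E> u) \<le> ennreal C2 * J_liminf p m k f"
        using low[OF f] by blast
      have "ennreal C2 * J_liminf p m k f \<le> ennreal (C1 + C2) * J_liminf p m k f"
        using C1 by (intro mult_right_mono ennreal_leI) auto
      then show ?thesis using extended_energy_eq[OF meas[OF f] u(1,2)] u(3) by simp
    next
      case False
      hence "J_liminf p m k f = \<infinity>" by (auto simp: less_top[symmetric])
      then show ?thesis using C1 C2 by (simp add: ennreal_mult_top)
    qed
  qed
  ultimately show ?thesis
    unfolding critical_kernel ks_space_def k_def[symmetric] critical_exponent by (simp add: s_crit_def)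
qed

end

theorem theorem6p17:
  fixes p df :: real
    and S :: "'i set"
    and F :: "'i \<Rightarrow> 'a \<Rightarrow> 'a::metric_space"
    and \<rho> :: "'i \<Rightarrow> real"
    and \<E> :: "('a \<Rightarrow> real) \<Rightarrow> real"
    and \<F> :: "('a \<Rightarrow> real) set"
    and m :: "'a measure"
  defines "R \<equiv> p_resistance_metric p \<E> \<F>"
  defines "k \<equiv> ks_critical_kernel p R m"
  assumes "1 < p"
    and "pcf_self_similar_structure S F"
    and "connected (UNIV :: 'a set)"
    and "self_similar_p_resistance_form p S F \<rho> \<E> \<F>"
    and "Min (\<rho> ` S) > 1"
    and "0 < df"
    and "(\<Sum>i\<in>S. \<rho> i powr (- df / (p - 1))) = 1"
    and "self_similar_measure S F (\<lambda>i. \<rho> i powr (- df / (p - 1))) m"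
  shows "ks_exponent p R m = ereal ((df + p - 1) / p)
    \<and> ae_representatives m \<F> = ks_space p R m
    \<and> weak_monotonicity p m k
    \<and> (\<exists>C::real. C \<ge> 1 \<and> (\<forall>f\<in>Lp_funs p m.
          ennreal (1 / C) * J_sup p m k f \<le> extended_energy m \<E> \<F> f
        \<and> extended_energy m \<E> \<F> f \<le> ennreal C * J_liminf p m k f))"
proof -
  obtain \<kappa> where \<kappa>: "coding_map S F \<kappa>" "finite (post_critical_set S F \<kappa>)"
    and S: "self_similar_structure S F"
    using assms(4) by (auto simp: pcf_self_similar_structure_def)
  have fin: "finite S" using S by (simp add: self_similar_structure_def)
  have \<rho>: "1 < \<rho> i" if "i \<in> S" for i
    using assms(7) fin that by (metis Min_le finite_imageI image_eqI less_le_trans)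
  interpret pcf_energy p \<E> \<F> S F \<kappa> \<rho> df m
  proof
    show "p_resistance_form p \<E> \<F>"
      using assms(6) by (simp add: self_similar_p_resistance_form_def)
  qed (use assms \<kappa> S \<rho> in auto)
  show ?thesis
    unfolding k_def R_def by (rule korevaar_schoen_characterization)
qed

end
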